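(* Let $\mathbf{X}$ be an $\omega$-categorical, relational, homogeneous structure with no algebraicity that admits weak elimination of imaginaries. Then $\mathrm{Aut}(\mathbf{X})$ has property (T).
   Context: Structures are countable first-order structures; a structure is relational if its signature has no function symbols. $G = \mathrm{Aut}(\mathbf{X})$ carries the topology of pointwise convergence, with $\mathbf{X}$ discrete. $\mathbf{X}$ is $\omega$-categorical if it is the unique (up to isomorphism) countable model of its first-order theory; equivalently, $\mathrm{Aut}(\mathbf{X})$ acting diagonally on $\mathbf{X}^n$ has finitely many orbits for each $n$. $\mathbf{X}$ is homogeneous if every isomorphism between finite substructures of $\mathbf{X}$ extends to an automorphism of $\mathbf{X}$. An element $b \in \mathbf{X}$ is algebraic over a finite tuple (or finite set) if its orbit under the pointwise stabilizer in $G$ of that tuple (set) is finite; the algebraic closure of the tuple (set) is the set of all such $b$. $\mathbf{X}$ has no algebraicity if the algebraic closure of every finite substructure $\mathbf{A}$ is $\mathbf{A}$ itself; equivalently, the pointwise stabilizer of $\mathbf{A}$ has only infinite orbits on $\mathbf{X} \setminus \mathbf{A}$. An imaginary of $\mathbf{X}$ is an equivalence class of some (parameter-free) definable equivalence relation on a definable subset of $\mathbf{X}^m$, for some $m$. $\mathbf{X}$ admits weak elimination of imaginaries if for every imaginary $\alpha \subseteq \mathbf{X}^m$ there are $n \in \mathbf{N} = \{0,1,2,\dots\}$ and a first-order formula $\phi(\bar x,\bar y)$ such that the set $\{\bar c \in \mathbf{X}^n : \alpha = \{\bar x \in \mathbf{X}^m : \phi(\bar x,\bar c)\}\}$ is finite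 and non-empty. Unitary representations are on complex Hilbert spaces and strongly continuous. If $\pi$ is a unitary representation of $G$, $Q \subseteq G$, $\varepsilon > 0$, a non-zero vector $\xi \in \mathcal{H}(\pi)$ is $(Q,\varepsilon)$-invariant if $\|\pi(x)\xi - \xi\| \le \varepsilon\|\xi\|$ for all $x \in Q$. A topological group $G$ has (Kazhdan's) property (T) if there exist a compact $Q \subseteq G$ and $\varepsilon > 0$ such that every unitary representation of $G$ that has a $(Q,\varepsilon)$-invariant vector has a non-zero invariant vector. *)

theory Defs
  imports "HOL-Analysis.Analysis" "HOL-Algebra.Module" "HOL-Algebra.Bij"
begin

section \<open>Relational structures\<close>

record 'r signature =
  symbols :: "'r set"
  arity :: "'r \<Rightarrow> nat"

record ('r, 'a) rel_structure =
  universe :: "'a set"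
  rels :: "'r \<Rightarrow> 'a list set"

definition tuples :: "'a set \<Rightarrow> nat \<Rightarrow> 'a list set" where
  "tuples A n = {xs. length xs = n \<and> set xs \<subseteq> A}"

definition relational_structure :: "'r signature \<Rightarrow> ('r, 'a) rel_structure \<Rightarrow> bool" where
  "relational_structure S X \<longleftrightarrow>
     universe X \<noteq> {} \<and> (\<forall>r\<in>symbols S. rels X r \<subseteq> tuples (universe X) (arity S r))"

definition struct_iso ::
  "'r signature \<Rightarrow> ('r, 'a) rel_structure \<Rightarrow> ('r, 'b) rel_structure \<Rightarrow> ('a \<Rightarrow> 'b) \<Rightarrow> bool" where
  "struct_iso S X Y f \<longleftrightarrow> bij_betw f (universe X) (universe Y) \<and>
     (\<forall>r\<in>symbols S. \<forall>xs\<in>tuples (universe X) (arity S r). xs \<in> rels X r \<longleftrightarrow> map f xs \<in> rels Y r)"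

text \<open>As there are no function symbols, every subset of the universe carries a substructure.\<close>

definition substructure :: "('r, 'a) rel_structure \<Rightarrow> 'a set \<Rightarrow> ('r, 'a) rel_structure" where
  "substructure X A = \<lparr>universe = A, rels = (\<lambda>r. {xs \<in> rels X r. set xs \<subseteq> A})\<rparr>"

definition aut_group :: "'r signature \<Rightarrow> ('r, 'a) rel_structure \<Rightarrow> ('a \<Rightarrow> 'a) monoid" where
  "aut_group S X = (BijGroup (universe X))
     \<lparr>carrier := {f \<in> Bij (universe X). struct_iso S X X f}\<rparr>"

definition aut_topology :: "'r signature \<Rightarrow> ('r, 'a) rel_structure \<Rightarrow> ('a \<Rightarrow> 'a) topology" where
  "aut_topology S X = subtopology
     (product_topology (\<lambda>_. discrete_topology (universe X)) (universe X))
     (carrier (aut_group S X))"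

lemma group_aut_group: "group (aut_group S X)"
proof -
  let ?U = "universe X"
  interpret B: group "BijGroup ?U" by (rule group_BijGroup)
  have "subgroup {f \<in> Bij ?U. struct_iso S X X f} (BijGroup ?U)"
  proof (rule B.subgroupI)
    show "{f \<in> Bij ?U. struct_iso S X X f} \<subseteq> carrier (BijGroup ?U)"
      by (auto simp: BijGroup_def)
    have "map (\<lambda>x\<in>?U. x) xs = xs" if "xs \<in> tuples ?U n" for xs n
      using that by (auto simp: tuples_def intro!: map_idI)
    then have "struct_iso S X X (\<lambda>x\<in>?U. x)"
      using id_Bij[of ?U] by (auto simp: struct_iso_def Bij_def)
    then show "{f \<in> Bij ?U. struct_iso S X X f} \<noteq> {}"
      using id_Bij[of ?U] by blast
  next
    fix f assume f: "f \<in> {f \<in> Bij ?U. struct_iso S X X f}"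
    let ?g = "\<lambda>x\<in>?U. inv_into ?U f x"
    have bij: "bij_betw f ?U ?U" using f by (simp add: Bij_def)
    have g: "?g \<in> Bij ?U" using f by (simp add: restrict_inv_into_Bij)
    have "inv\<^bsub>BijGroup ?U\<^esub> f = ?g"
      using f g Bij_compose_restrict_eq[of f ?U]
      by (intro B.inv_equality) (auto simp: BijGroup_def)
    moreover have "struct_iso S X X ?g"
      unfolding struct_iso_def
    proof (intro conjI ballI)
      show "bij_betw ?g ?U ?U" using g by (simp add: Bij_def)
      fix r xs assume r: "r \<in> symbols S" and xs: "xs \<in> tuples ?U (arity S r)"
      then have "map ?g xs \<in> tuples ?U (arity S r)"
        using bij by (auto simp: tuples_def bij_betw_def inv_into_into)
      moreover have "map f (map ?g xs) = xs"
        using xs bij by (auto simp: tuples_def bij_betw_inv_into_right intro!: map_idI)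
      ultimately show "xs \<in> rels X r \<longleftrightarrow> map ?g xs \<in> rels X r"
        using f r by (auto simp: struct_iso_def)
    qed
    ultimately show "inv\<^bsub>BijGroup ?U\<^esub> f \<in> {f \<in> Bij ?U. struct_iso S X X f}"
      using g by simp
  next
    fix f g assume f: "f \<in> {f \<in> Bij ?U. struct_iso S X X f}"
      and g: "g \<in> {f \<in> Bij ?U. struct_iso S X X f}"
    have fg: "compose ?U f g \<in> Bij ?U" using f g by (simp add: compose_Bij)
    have "struct_iso S X X (compose ?U f g)"
      unfolding struct_iso_def
    proof (intro conjI ballI)
      show "bij_betw (compose ?U f g) ?U ?U" using fg by (simp add: Bij_def)
      fix r xs assume r: "r \<in> symbols S" and xs: "xs \<in> tuples ?U (arity S r)"
      then have "map g xs \<in> tuples ?U (arity S r)"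
        using g Bij_imp_funcset[of g ?U] by (auto simp: tuples_def)
      moreover have "map (compose ?U f g) xs = map f (map g xs)"
        using xs by (auto simp: tuples_def compose_def)
      ultimately show "xs \<in> rels X r \<longleftrightarrow> map (compose ?U f g) xs \<in> rels X r"
        using f g r xs unfolding struct_iso_def by (metis (mono_tags, lifting) mem_Collect_eq)
    qed
    with f g fg show "f \<otimes>\<^bsub>BijGroup ?U\<^esub> g \<in> {f \<in> Bij ?U. struct_iso S X X f}"
      by (simp add: BijGroup_def)
  qed
  then show ?thesis
    unfolding aut_group_def by (rule subgroup.subgroup_is_group) (rule B.group_axioms)
qed

lemma topspace_aut_topology: "topspace (aut_topology S X) = carrier (aut_group S X)"
  by (auto simp: aut_topology_def aut_group_def topspace_subtopology Bij_def PiE_def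
      bij_betw_def extensional_def)


section \<open>First-order logic\<close>

datatype 'r formula =
    Eq nat nat
  | Rel 'r "nat list"
  | Neg "'r formula"
  | Conj "'r formula" "'r formula"
  | Exists nat "'r formula"

primrec formula_over :: "'r signature \<Rightarrow> 'r formula \<Rightarrow> bool" where
  "formula_over S (Eq i j) \<longleftrightarrow> True"
| "formula_over S (Rel r is) \<longleftrightarrow> r \<in> symbols S \<and> length is = arity S r"
| "formula_over S (Neg \<phi>) \<longleftrightarrow> formula_over S \<phi>"
| "formula_over S (Conj \<phi> \<psi>) \<longleftrightarrow> formula_over S \<phi> \<and> formula_over S \<psi>"
| "formula_over S (Exists i \<phi>) \<longleftrightarrow> formula_over S \<phi>"

primrec free_vars :: "'r formula \<Rightarrow> nat set" where
  "free_vars (Eq i j) = {i, j}"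
| "free_vars (Rel r is) = set is"
| "free_vars (Neg \<phi>) = free_vars \<phi>"
| "free_vars (Conj \<phi> \<psi>) = free_vars \<phi> \<union> free_vars \<psi>"
| "free_vars (Exists i \<phi>) = free_vars \<phi> - {i}"

primrec sat :: "('r, 'a) rel_structure \<Rightarrow> (nat \<Rightarrow> 'a) \<Rightarrow> 'r formula \<Rightarrow> bool" where
  "sat X v (Eq i j) \<longleftrightarrow> v i = v j"
| "sat X v (Rel r is) \<longleftrightarrow> map v is \<in> rels X r"
| "sat X v (Neg \<phi>) \<longleftrightarrow> \<not> sat X v \<phi>"
| "sat X v (Conj \<phi> \<psi>) \<longleftrightarrow> sat X v \<phi> \<and> sat X v \<psi>"
| "sat X v (Exists i \<phi>) \<longleftrightarrow> (\<exists>a\<in>universe X. sat X (v(i := a)) \<phi>)"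

definition sentence :: "'r signature \<Rightarrow> 'r formula \<Rightarrow> bool" where
  "sentence S \<phi> \<longleftrightarrow> formula_over S \<phi> \<and> free_vars \<phi> = {}"

definition holds :: "('r, 'a) rel_structure \<Rightarrow> 'r formula \<Rightarrow> bool" where
  "holds X \<phi> \<longleftrightarrow> (\<forall>v. range v \<subseteq> universe X \<longrightarrow> sat X v \<phi>)"

definition first_order_theory :: "'r signature \<Rightarrow> ('r, 'a) rel_structure \<Rightarrow> 'r formula set" where
  "first_order_theory S X = {\<phi>. sentence S \<phi> \<and> holds X \<phi>}"

text \<open>
  The condition that the free variables of a formula are below \<open>m\<close> expresses that it is a formula
  in the variables \<open>x\<^sub>0, \<dots>, x\<^bsub>m - 1\<^esub>\<close>, which are interpreted by the entries of a list of
  length \<open>m\<close>.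
\<close>

definition formula_in :: "'r signature \<Rightarrow> nat \<Rightarrow> 'r formula \<Rightarrow> bool" where
  "formula_in S m \<phi> \<longleftrightarrow> formula_over S \<phi> \<and> free_vars \<phi> \<subseteq> {..<m}"

definition sat_tuple :: "('r, 'a) rel_structure \<Rightarrow> 'r formula \<Rightarrow> 'a list \<Rightarrow> bool" where
  "sat_tuple X \<phi> xs \<longleftrightarrow> sat X (\<lambda>i. xs ! i) \<phi>"

definition definable_set ::
  "'r signature \<Rightarrow> ('r, 'a) rel_structure \<Rightarrow> nat \<Rightarrow> 'a list set \<Rightarrow> bool" where
  "definable_set S X m D \<longleftrightarrow>
     (\<exists>\<phi>. formula_in S m \<phi> \<and> D = {xs \<in> tuples (universe X) m. sat_tuple X \<phi> xs})"

definition definable_equivalence :: "'r signature \<Rightarrow> ('r, 'a) rel_structure \<Rightarrow> nat \<Rightarrow>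
    'a list set \<Rightarrow> ('a list \<times> 'a list) set \<Rightarrow> bool" where
  "definable_equivalence S X m D E \<longleftrightarrow> definable_set S X m D \<and> equiv D E \<and>
     definable_set S X (m + m) {xs @ ys | xs ys. (xs, ys) \<in> E}"

definition imaginary :: "'r signature \<Rightarrow> ('r, 'a) rel_structure \<Rightarrow> nat \<Rightarrow> 'a list set \<Rightarrow> bool" where
  "imaginary S X m \<alpha> \<longleftrightarrow> (\<exists>D E. definable_equivalence S X m D E \<and> \<alpha> \<in> D // E)"


section \<open>The model-theoretic hypotheses\<close>

text \<open>
  Up to isomorphism, a countable structure lives on a set of natural numbers; countable includes
  finite.
\<close>

definition omega_categorical :: "'r signature \<Rightarrow> ('r, 'a) rel_structure \<Rightarrow> bool" where
  "omega_categorical S X \<longleftrightarrow> countable (universe X) \<and>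
     (\<forall>Y :: ('r, nat) rel_structure.
        relational_structure S Y \<and> (\<forall>\<phi>\<in>first_order_theory S X. holds Y \<phi>) \<longrightarrow>
        (\<exists>f. struct_iso S X Y f))"

definition homogeneous :: "'r signature \<Rightarrow> ('r, 'a) rel_structure \<Rightarrow> bool" where
  "homogeneous S X \<longleftrightarrow>
     (\<forall>A B f. finite A \<and> finite B \<and> A \<subseteq> universe X \<and> B \<subseteq> universe X \<and>
        struct_iso S (substructure X A) (substructure X B) f \<longrightarrow>
        (\<exists>g\<in>carrier (aut_group S X). \<forall>a\<in>A. g a = f a))"

definition stabilizer_orbit ::
  "'r signature \<Rightarrow> ('r, 'a) rel_structure \<Rightarrow> 'a set \<Rightarrow> 'a \<Rightarrow> 'a set" where
  "stabilizer_orbit S X A b = {g b | g. g \<in> carrier (aut_group S X) \<and> (\<forall>a\<in>A. g a = a)}"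

definition algebraic_closure ::
  "'r signature \<Rightarrow> ('r, 'a) rel_structure \<Rightarrow> 'a set \<Rightarrow> 'a set" where
  "algebraic_closure S X A = {b \<in> universe X. finite (stabilizer_orbit S X A b)}"

definition no_algebraicity :: "'r signature \<Rightarrow> ('r, 'a) rel_structure \<Rightarrow> bool" where
  "no_algebraicity S X \<longleftrightarrow>
     (\<forall>A. finite A \<and> A \<subseteq> universe X \<longrightarrow> algebraic_closure S X A = A)"

definition weak_elimination_of_imaginaries ::
  "'r signature \<Rightarrow> ('r, 'a) rel_structure \<Rightarrow> bool" where
  "weak_elimination_of_imaginaries S X \<longleftrightarrow>
     (\<forall>m \<alpha>. imaginary S X m \<alpha> \<longrightarrow>
        (\<exists>n \<phi>. formula_in S (m + n) \<phi> \<and>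
           (let C = {cs \<in> tuples (universe X) n.
                       \<alpha> = {xs \<in> tuples (universe X) m. sat_tuple X \<phi> (xs @ cs)}}
            in finite C \<and> C \<noteq> {})))"


section \<open>Unitary representations\<close>

definition complex_ring :: "complex ring" where
  "complex_ring = \<lparr>carrier = UNIV, mult = (*), one = 1, zero = 0, add = (+)\<rparr>"

text \<open>
  Hilbert spaces have an explicit carrier, so that one can quantify over them inside a formula.
  The fields \<open>mult\<close> and \<open>one\<close> inherited from the record of modules play no role.
  The inner product is linear in its first argument.
\<close>

record 'h hilbert_space = "(complex, 'h) module" +
  ip :: "'h \<Rightarrow> 'h \<Rightarrow> complex"

definition hnorm :: "'h hilbert_space \<Rightarrow> 'h \<Rightarrow> real" where
  "hnorm H x = sqrt (Re (ip H x x))"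

text \<open>
  The library's notion of a metric on a carrier set requires symmetry and non-negativity also
  outside the carrier, hence the case distinction.
\<close>

definition hdist :: "'h hilbert_space \<Rightarrow> 'h \<Rightarrow> 'h \<Rightarrow> real" where
  "hdist H x y = (if x \<in> carrier H \<and> y \<in> carrier H then hnorm H (x \<ominus>\<^bsub>H\<^esub> y) else 0)"

abbreviation hilbert_topology :: "'h hilbert_space \<Rightarrow> 'h topology" where
  "hilbert_topology H \<equiv> Metric_space.mtopology (carrier H) (hdist H)"

locale complex_inner_product_space = Module.module complex_ring H
  for H :: "'h hilbert_space" (structure) +
  assumes ip_add: "\<lbrakk>x \<in> carrier H; y \<in> carrier H; z \<in> carrier H\<rbrakk> \<Longrightarrow>
      ip H (x \<oplus> y) z = ip H x z + ip H y z"
    and ip_smult: "\<lbrakk>x \<in> carrier H; y \<in> carrier H\<rbrakk> \<Longrightarrow> ip H (a \<odot>\<^bsub>H\<^esub> x) y = a * ip H x y"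
    and ip_commute: "\<lbrakk>x \<in> carrier H; y \<in> carrier H\<rbrakk> \<Longrightarrow> ip H x y = cnj (ip H y x)"
    and ip_pos: "\<lbrakk>x \<in> carrier H; x \<noteq> \<zero>\<^bsub>H\<^esub>\<rbrakk> \<Longrightarrow> 0 < Re (ip H x x)"

lemma cring_complex_ring: "cring complex_ring"
proof -
  have "\<exists>y. y + x = 0" for x :: complex
    using add.left_inverse by blast
  then show ?thesis
    by (intro cringI abelian_groupI comm_monoidI) (auto simp: complex_ring_def algebra_simps)
qed

context complex_inner_product_space
begin

lemma smult_simps [simp]:
  "x \<in> carrier H \<Longrightarrow> a \<odot> x \<in> carrier H"
  "x \<in> carrier H \<Longrightarrow> 1 \<odot> x = x"
  using smult_closed[of a x] smult_one[of x] by (simp_all add: complex_ring_def)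

lemma minus_eq_smult: "\<lbrakk>x \<in> carrier H; y \<in> carrier H\<rbrakk> \<Longrightarrow> x \<ominus> y = x \<oplus> (-1) \<odot> y"
proof -
  assume x: "x \<in> carrier H" and y: "y \<in> carrier H"
  have "(-1) \<odot> y \<oplus> y = ((-1) + 1) \<odot> y"
    using smult_l_distr[of "-1" 1 y] y by (simp add: complex_ring_def)
  also have "\<dots> = \<zero>"
    using smult_l_null[OF y] by (simp add: complex_ring_def)
  finally have "(-1) \<odot> y = \<ominus> y"
    using y M.minus_equality by simp
  then show ?thesis by (simp add: a_minus_def)
qed

lemma ip_add_right:
  "\<lbrakk>x \<in> carrier H; y \<in> carrier H; z \<in> carrier H\<rbrakk> \<Longrightarrow> ip H z (x \<oplus> y) = ip H z x + ip H z y"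
  by (metis M.a_closed complex_cnj_add ip_add ip_commute)

lemma ip_smult_right:
  "\<lbrakk>x \<in> carrier H; y \<in> carrier H\<rbrakk> \<Longrightarrow> ip H y (a \<odot> x) = cnj a * ip H y x"
  by (metis complex_cnj_mult ip_commute ip_smult smult_simps(1))

lemma Re_ip_commute: "\<lbrakk>x \<in> carrier H; y \<in> carrier H\<rbrakk> \<Longrightarrow> Re (ip H x y) = Re (ip H y x)"
  by (metis complex_cnj cnj.simps(1) ip_commute)

lemma ip_zero: "ip H \<zero> \<zero> = 0"
  using ip_smult[of \<zero> \<zero> 0] smult_l_null[of \<zero>] by (simp add: complex_ring_def)

lemma Re_ip_nonneg: "x \<in> carrier H \<Longrightarrow> 0 \<le> Re (ip H x x)"
  by (metis ip_pos ip_zero less_eq_real_def zero_complex.simps(1))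

lemma Re_ip_combination:
  assumes "x \<in> carrier H" "y \<in> carrier H"
  shows "Re (ip H (x \<oplus> of_real t \<odot> y) (x \<oplus> of_real t \<odot> y)) =
    Re (ip H x x) + 2 * t * Re (ip H x y) + t\<^sup>2 * Re (ip H y y)"
  using assms Re_ip_commute[OF assms]
  by (simp add: ip_add ip_add_right ip_smult ip_smult_right algebra_simps power2_eq_square)

lemma Re_Cauchy_Schwarz:
  assumes x: "x \<in> carrier H" and y: "y \<in> carrier H"
  shows "Re (ip H x y) \<le> hnorm H x * hnorm H y"
proof (cases "y = \<zero>")
  case True
  have "ip H x \<zero> = 0"
    using ip_smult_right[of \<zero> x 0] smult_l_null[of \<zero>] x by (simp add: complex_ring_def)
  then show ?thesis using True by (simp add: hnorm_def ip_zero)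
next
  case False
  define a b c where "a = Re (ip H x x)" and "b = Re (ip H x y)" and "c = Re (ip H y y)"
  have c: "c > 0" using ip_pos[OF y False] by (simp add: c_def)
  have "0 \<le> a + 2 * (- b / c) * b + (- b / c)\<^sup>2 * c"
    using Re_ip_nonneg[of "x \<oplus> of_real (- b / c) \<odot> y"] Re_ip_combination[OF x y, of "- b / c"] x y
    by (simp add: a_def b_def c_def)
  also have "\<dots> = a - b\<^sup>2 / c"
    using c by (simp add: field_simps power2_eq_square)
  finally have "b\<^sup>2 \<le> a * c" using c by (simp add: field_simps)
  then have "b \<le> sqrt (a * c)" by (simp add: real_le_rsqrt)
  then show ?thesis by (simp add: hnorm_def a_def b_def c_def real_sqrt_mult)
qed

lemma hnorm_nonneg: "x \<in> carrier H \<Longrightarrow> 0 \<le> hnorm H x"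
  by (simp add: hnorm_def Re_ip_nonneg)

lemma hnorm_power2: "x \<in> carrier H \<Longrightarrow> (hnorm H x)\<^sup>2 = Re (ip H x x)"
  by (simp add: hnorm_def Re_ip_nonneg)

lemma hnorm_triangle:
  assumes x: "x \<in> carrier H" and y: "y \<in> carrier H"
  shows "hnorm H (x \<oplus> y) \<le> hnorm H x + hnorm H y"
proof (rule power2_le_imp_le)
  have "(hnorm H (x \<oplus> y))\<^sup>2 = (hnorm H x)\<^sup>2 + 2 * Re (ip H x y) + (hnorm H y)\<^sup>2"
    using Re_ip_combination[OF x y, of 1] x y by (simp add: hnorm_power2)
  also have "\<dots> \<le> (hnorm H x + hnorm H y)\<^sup>2"
    using Re_Cauchy_Schwarz[OF x y] by (simp add: power2_sum)
  finally show "(hnorm H (x \<oplus> y))\<^sup>2 \<le> (hnorm H x + hnorm H y)\<^sup>2" .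
qed (simp add: hnorm_nonneg x y)

lemma hnorm_smult: "x \<in> carrier H \<Longrightarrow> hnorm H (a \<odot> x) = cmod a * hnorm H x"
proof -
  assume x: "x \<in> carrier H"
  have "ip H (a \<odot> x) (a \<odot> x) = of_real ((cmod a)\<^sup>2) * ip H x x"
    using x complex_norm_square[of a] by (simp add: ip_smult ip_smult_right)
  then show ?thesis by (simp add: hnorm_def real_sqrt_mult)
qed

lemma hnorm_eq_0: "x \<in> carrier H \<Longrightarrow> hnorm H x = 0 \<longleftrightarrow> x = \<zero>"
  using ip_pos[of x] by (cases "x = \<zero>") (auto simp: hnorm_def ip_zero)

lemma minus_eq_0: "\<lbrakk>x \<in> carrier H; y \<in> carrier H\<rbrakk> \<Longrightarrow> x \<ominus> y = \<zero> \<longleftrightarrow> x = y"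
  using M.minus_equality[of x "\<ominus> y"] by (auto simp: a_minus_def M.r_neg)

lemma hdist_eq: "\<lbrakk>x \<in> carrier H; y \<in> carrier H\<rbrakk> \<Longrightarrow> hdist H x y = hnorm H (x \<ominus> y)"
  by (simp add: hdist_def)

sublocale metric: Metric_space "carrier H" "hdist H"
proof
  show "0 \<le> hdist H x y" for x y
    by (simp add: hdist_def hnorm_nonneg)
  show "hdist H x y = hdist H y x" for x y
  proof (cases "x \<in> carrier H \<and> y \<in> carrier H")
    case True
    then have "x \<ominus> y = (-1) \<odot> (y \<ominus> x)"
      using smult_r_distr[of "-1" y "(-1) \<odot> x"] smult_assoc1[of "-1" "-1" x]
      by (simp add: minus_eq_smult complex_ring_def M.a_comm)
    with True show ?thesis by (simp add: hdist_def hnorm_smult)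
  qed (auto simp: hdist_def)
  show "hdist H x y = 0 \<longleftrightarrow> x = y" if "x \<in> carrier H" "y \<in> carrier H" for x y
    using that by (simp add: hdist_def hnorm_eq_0 minus_eq_0)
  show "hdist H x z \<le> hdist H x y + hdist H y z"
    if "x \<in> carrier H" "y \<in> carrier H" "z \<in> carrier H" for x y z
  proof -
    have "x \<ominus> z = (x \<ominus> y) \<oplus> (y \<ominus> z)"
      using that by (simp add: a_minus_def M.a_ac M.r_neg2 M.r_neg1)
    then show ?thesis
      using that hnorm_triangle[of "x \<ominus> y" "y \<ominus> z"] by (simp add: hdist_def)
  qed
qed

end

locale complex_hilbert_space = complex_inner_product_space +
  assumes complete: "Metric_space.mcomplete (carrier H) (hdist H)"

definition unitary_group :: "'h hilbert_space \<Rightarrow> ('h \<Rightarrow> 'h) monoid" where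
  "unitary_group H = (BijGroup (carrier H))
     \<lparr>carrier := {u \<in> Bij (carrier H).
        (\<forall>x\<in>carrier H. \<forall>y\<in>carrier H. u (x \<oplus>\<^bsub>H\<^esub> y) = u x \<oplus>\<^bsub>H\<^esub> u y) \<and>
        (\<forall>a. \<forall>x\<in>carrier H. u (a \<odot>\<^bsub>H\<^esub> x) = a \<odot>\<^bsub>H\<^esub> u x) \<and>
        (\<forall>x\<in>carrier H. \<forall>y\<in>carrier H. ip H (u x) (u y) = ip H x y)}\<rparr>"

definition unitary_representation ::
  "('g, 'b) monoid_scheme \<Rightarrow> 'g topology \<Rightarrow> 'h hilbert_space \<Rightarrow> ('g \<Rightarrow> 'h \<Rightarrow> 'h) \<Rightarrow> bool" where
  "unitary_representation G T H \<pi> \<longleftrightarrow> complex_hilbert_space H \<and> \<pi> \<in> hom G (unitary_group H) \<and>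
     (\<forall>x\<in>carrier H. continuous_map T (hilbert_topology H) (\<lambda>g. \<pi> g x))"

definition almost_invariant ::
  "'h hilbert_space \<Rightarrow> ('g \<Rightarrow> 'h \<Rightarrow> 'h) \<Rightarrow> 'g set \<Rightarrow> real \<Rightarrow> 'h \<Rightarrow> bool" where
  "almost_invariant H \<pi> Q \<epsilon> \<xi> \<longleftrightarrow> \<xi> \<in> carrier H \<and> \<xi> \<noteq> \<zero>\<^bsub>H\<^esub> \<and>
     (\<forall>g\<in>Q. hnorm H (\<pi> g \<xi> \<ominus>\<^bsub>H\<^esub> \<xi>) \<le> \<epsilon> * hnorm H \<xi>)"

definition has_invariant_vector ::
  "('g, 'b) monoid_scheme \<Rightarrow> 'h hilbert_space \<Rightarrow> ('g \<Rightarrow> 'h \<Rightarrow> 'h) \<Rightarrow> bool" where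
  "has_invariant_vector G H \<pi> \<longleftrightarrow>
     (\<exists>\<eta>\<in>carrier H. \<eta> \<noteq> \<zero>\<^bsub>H\<^esub> \<and> (\<forall>g\<in>carrier G. \<pi> g \<eta> = \<eta>))"

definition kazhdan_pair ::
  "'h itself \<Rightarrow> ('g, 'b) monoid_scheme \<Rightarrow> 'g topology \<Rightarrow> 'g set \<Rightarrow> real \<Rightarrow> bool" where
  "kazhdan_pair _ G T Q \<epsilon> \<longleftrightarrow>
     (\<forall>(H :: 'h hilbert_space) \<pi>. unitary_representation G T H \<pi> \<and>
        (\<exists>\<xi>. almost_invariant H \<pi> Q \<epsilon> \<xi>) \<longrightarrow> has_invariant_vector G H \<pi>)"

text \<open>
  A quantifier inside a formula cannot range over the Hilbert spaces on all types at once. The type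
  of sequences of formal linear combinations of group elements is large enough: it can host every
  cyclic representation of \<open>G\<close>. The theorem \<open>kazhdan_pair_all_types\<close> below shows that a pair
  \<open>(Q, \<epsilon>)\<close> which works for this type works for the Hilbert spaces on every type.
\<close>

type_synonym 'g hilbert_universe = "nat \<Rightarrow> (complex \<times> 'g) list"

definition property_T :: "('g, 'b) monoid_scheme \<Rightarrow> 'g topology \<Rightarrow> bool" where
  "property_T G T \<longleftrightarrow>
     (\<exists>Q \<epsilon>. compactin T Q \<and> 0 < \<epsilon> \<and> kazhdan_pair TYPE('g hilbert_universe) G T Q \<epsilon>)"

subsection \<open>Independence of the type of vectors\<close>

lemma unitary_representationD:
  assumes "unitary_representation G T H \<pi>" and "group G"
  shows "complex_hilbert_space H"
    and "\<And>g. g \<in> carrier G \<Longrightarrow> \<pi> g \<in> Bij (carrier H)"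
    and "\<And>g x. \<lbrakk>g \<in> carrier G; x \<in> carrier H\<rbrakk> \<Longrightarrow> \<pi> g x \<in> carrier H"
    and "\<And>g x y. \<lbrakk>g \<in> carrier G; x \<in> carrier H; y \<in> carrier H\<rbrakk> \<Longrightarrow>
      \<pi> g (x \<oplus>\<^bsub>H\<^esub> y) = \<pi> g x \<oplus>\<^bsub>H\<^esub> \<pi> g y"
    and "\<And>g a x. \<lbrakk>g \<in> carrier G; x \<in> carrier H\<rbrakk> \<Longrightarrow> \<pi> g (a \<odot>\<^bsub>H\<^esub> x) = a \<odot>\<^bsub>H\<^esub> \<pi> g x"
    and "\<And>g x y. \<lbrakk>g \<in> carrier G; x \<in> carrier H; y \<in> carrier H\<rbrakk> \<Longrightarrow>
      ip H (\<pi> g x) (\<pi> g y) = ip H x y"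
    and "\<And>g h x. \<lbrakk>g \<in> carrier G; h \<in> carrier G; x \<in> carrier H\<rbrakk> \<Longrightarrow>
      \<pi> (g \<otimes>\<^bsub>G\<^esub> h) x = \<pi> g (\<pi> h x)"
    and "\<And>x. x \<in> carrier H \<Longrightarrow> \<pi> \<one>\<^bsub>G\<^esub> x = x"
    and "\<And>x. x \<in> carrier H \<Longrightarrow> continuous_map T (hilbert_topology H) (\<lambda>g. \<pi> g x)"
proof -
  interpret group G by fact
  show "complex_hilbert_space H"
    and "\<And>x. x \<in> carrier H \<Longrightarrow> continuous_map T (hilbert_topology H) (\<lambda>g. \<pi> g x)"
    using assms by (auto simp: unitary_representation_def)
  have hom: "\<pi> \<in> hom G (unitary_group H)"
    using assms by (auto simp: unitary_representation_def)
  then have U: "\<pi> g \<in> carrier (unitary_group H)" if "g \<in> carrier G" for g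
    using that by (auto simp: hom_def)
  show bij: "\<pi> g \<in> Bij (carrier H)" if "g \<in> carrier G" for g
    using U[OF that] by (simp add: unitary_group_def)
  show "\<pi> g (x \<oplus>\<^bsub>H\<^esub> y) = \<pi> g x \<oplus>\<^bsub>H\<^esub> \<pi> g y"
    if "g \<in> carrier G" "x \<in> carrier H" "y \<in> carrier H" for g x y
    using U that by (simp add: unitary_group_def)
  show "\<pi> g (a \<odot>\<^bsub>H\<^esub> x) = a \<odot>\<^bsub>H\<^esub> \<pi> g x" if "g \<in> carrier G" "x \<in> carrier H" for g a x
    using U that by (simp add: unitary_group_def)
  show "ip H (\<pi> g x) (\<pi> g y) = ip H x y"
    if "g \<in> carrier G" "x \<in> carrier H" "y \<in> carrier H" for g x y
    using U that by (simp add: unitary_group_def)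
  show mem: "\<pi> g x \<in> carrier H" if "g \<in> carrier G" "x \<in> carrier H" for g x
    using Bij_imp_funcset[OF bij[OF that(1)]] that by auto
  show mult: "\<pi> (g \<otimes>\<^bsub>G\<^esub> h) x = \<pi> g (\<pi> h x)"
    if "g \<in> carrier G" "h \<in> carrier G" "x \<in> carrier H" for g h x
  proof -
    have "\<pi> (g \<otimes>\<^bsub>G\<^esub> h) = \<pi> g \<otimes>\<^bsub>unitary_group H\<^esub> \<pi> h"
      using hom that by (simp add: hom_def)
    then show ?thesis
      using bij that by (simp add: unitary_group_def BijGroup_def compose_def)
  qed
  show "\<pi> \<one>\<^bsub>G\<^esub> x = x" if x: "x \<in> carrier H" for x
  proof -
    have "inj_on (\<pi> \<one>\<^bsub>G\<^esub>) (carrier H)"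
      using bij[OF one_closed] by (simp add: Bij_def bij_betw_def)
    moreover have "\<pi> \<one>\<^bsub>G\<^esub> (\<pi> \<one>\<^bsub>G\<^esub> x) = \<pi> \<one>\<^bsub>G\<^esub> x"
      using mult[OF one_closed one_closed x] by simp
    ultimately show ?thesis
      using x mem[OF one_closed] by (meson inj_onD)
  qed
qed

definition transported :: "('h \<Rightarrow> 'u) \<Rightarrow> 'h set \<Rightarrow> 'h hilbert_space \<Rightarrow> 'u hilbert_space" where
  "transported c K H = (let d = inv_into K c in
     \<lparr>carrier = c ` K, mult = (\<lambda>_ _. undefined), one = undefined, zero = c \<zero>\<^bsub>H\<^esub>,
      add = (\<lambda>x y. c (d x \<oplus>\<^bsub>H\<^esub> d y)), smult = (\<lambda>a x. c (a \<odot>\<^bsub>H\<^esub> d x)),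
      ip = (\<lambda>x y. ip H (d x) (d y))\<rparr>)"

lemma unitary_representation_transported:
  fixes H :: "'h hilbert_space" and c :: "'h \<Rightarrow> 'u"
  assumes rep: "unitary_representation G T H \<pi>" and G: "group G" and T: "topspace T = carrier G"
    and closed: "closedin (hilbert_topology H) K"
    and zero: "\<zero>\<^bsub>H\<^esub> \<in> K"
    and add: "\<And>x y. \<lbrakk>x \<in> K; y \<in> K\<rbrakk> \<Longrightarrow> x \<oplus>\<^bsub>H\<^esub> y \<in> K"
    and smult: "\<And>a x. x \<in> K \<Longrightarrow> a \<odot>\<^bsub>H\<^esub> x \<in> K"
    and inv: "\<And>g x. \<lbrakk>g \<in> carrier G; x \<in> K\<rbrakk> \<Longrightarrow> \<pi> g x \<in> K"
    and inj: "inj_on c K"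
  shows "unitary_representation G T (transported c K H)
      (\<lambda>g. \<lambda>x\<in>c ` K. c (\<pi> g (inv_into K c x)))" (is "unitary_representation G T ?H ?\<pi>")
    and "\<And>x. x \<in> K \<Longrightarrow> hnorm (transported c K H) (c x) = hnorm H x"
    and "\<And>x y. \<lbrakk>x \<in> K; y \<in> K\<rbrakk> \<Longrightarrow> c x \<ominus>\<^bsub>transported c K H\<^esub> c y = c (x \<ominus>\<^bsub>H\<^esub> y)"
proof -
  note repD = unitary_representationD[OF rep G]
  interpret G: group G by fact
  interpret complex_hilbert_space H by (rule repD)
  have K: "K \<subseteq> carrier H"
    using closedin_subset[OF closed] by simp
  then have K': "x \<in> carrier H" if "x \<in> K" for x
    using that by blast
  have [simp]: "inv_into K c (c x) = x" if "x \<in> K" for x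
    using inj that by simp
  have [simp]: "c x = c y \<longleftrightarrow> x = y" if "x \<in> K" "y \<in> K" for x y
    using inj that by (simp add: inj_on_eq_iff)
  have car [simp]: "carrier ?H = c ` K"
    and Hzero [simp]: "\<zero>\<^bsub>?H\<^esub> = c \<zero>\<^bsub>H\<^esub>"
    by (simp_all add: transported_def Let_def)
  have Hadd [simp]: "c x \<oplus>\<^bsub>?H\<^esub> c y = c (x \<oplus>\<^bsub>H\<^esub> y)" if "x \<in> K" "y \<in> K" for x y
    using that by (simp add: transported_def Let_def)
  have Hsmult [simp]: "a \<odot>\<^bsub>?H\<^esub> c x = c (a \<odot>\<^bsub>H\<^esub> x)" if "x \<in> K" for a x
    using that by (simp add: transported_def Let_def)
  have Hip [simp]: "ip ?H (c x) (c y) = ip H x y" if "x \<in> K" "y \<in> K" for x y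
    using that by (simp add: transported_def Let_def)
  have neg: "(-1) \<odot>\<^bsub>H\<^esub> x \<oplus>\<^bsub>H\<^esub> x = \<zero>\<^bsub>H\<^esub>" if "x \<in> K" for x
    using minus_eq_smult[of x x] minus_eq_0[of x x] K'[OF that] M.a_comm[of x "(-1) \<odot>\<^bsub>H\<^esub> x"]
    by simp
  have grp: "abelian_group ?H"
  proof (rule abelian_groupI)
    fix x assume "x \<in> carrier ?H"
    then obtain x' where "x' \<in> K" "x = c x'" by auto
    then show "\<exists>y\<in>carrier ?H. y \<oplus>\<^bsub>?H\<^esub> x = \<zero>\<^bsub>?H\<^esub>"
      using neg smult by (intro bexI[of _ "c ((-1) \<odot>\<^bsub>H\<^esub> x')"]) auto
  qed (use zero add K' in \<open>auto simp: M.a_ac\<close>)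
  have mod: "Module.module complex_ring ?H"
  proof (rule moduleI[OF cring_complex_ring grp])
    have distr: "(a + b) \<odot>\<^bsub>H\<^esub> x = a \<odot>\<^bsub>H\<^esub> x \<oplus>\<^bsub>H\<^esub> b \<odot>\<^bsub>H\<^esub> x"
      "(a * b) \<odot>\<^bsub>H\<^esub> x = a \<odot>\<^bsub>H\<^esub> (b \<odot>\<^bsub>H\<^esub> x)"
      "a \<odot>\<^bsub>H\<^esub> (x \<oplus>\<^bsub>H\<^esub> y) = a \<odot>\<^bsub>H\<^esub> x \<oplus>\<^bsub>H\<^esub> a \<odot>\<^bsub>H\<^esub> y"
      if "x \<in> K" "y \<in> K" for a b x y
      using smult_l_distr[of a b x] smult_assoc1[of a b x] smult_r_distr[of a x y] K' that
      by (simp_all add: complex_ring_def)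
    show "a \<odot>\<^bsub>?H\<^esub> x \<in> carrier ?H" if "x \<in> carrier ?H" for a x
      using that smult by auto
    show "(a \<oplus>\<^bsub>complex_ring\<^esub> b) \<odot>\<^bsub>?H\<^esub> x = a \<odot>\<^bsub>?H\<^esub> x \<oplus>\<^bsub>?H\<^esub> b \<odot>\<^bsub>?H\<^esub> x"
      if "x \<in> carrier ?H" for a b x
      using that smult distr(1) by (auto simp: complex_ring_def)
    show "a \<odot>\<^bsub>?H\<^esub> (x \<oplus>\<^bsub>?H\<^esub> y) = a \<odot>\<^bsub>?H\<^esub> x \<oplus>\<^bsub>?H\<^esub> a \<odot>\<^bsub>?H\<^esub> y"
      if "x \<in> carrier ?H" "y \<in> carrier ?H" for a x y
      using that smult add distr(3) by auto
    show "(a \<otimes>\<^bsub>complex_ring\<^esub> b) \<odot>\<^bsub>?H\<^esub> x = a \<odot>\<^bsub>?H\<^esub> (b \<odot>\<^bsub>?H\<^esub> x)"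
      if "x \<in> carrier ?H" for a b x
      using that smult distr(2) by (auto simp: complex_ring_def)
    show "\<one>\<^bsub>complex_ring\<^esub> \<odot>\<^bsub>?H\<^esub> x = x" if "x \<in> carrier ?H" for x
      using that K' by (auto simp: complex_ring_def)
  qed
  interpret H': complex_inner_product_space ?H
  proof (intro complex_inner_product_space.intro mod complex_inner_product_space_axioms.intro)
    show "ip ?H x y = cnj (ip ?H y x)" if xy: "x \<in> carrier ?H" "y \<in> carrier ?H" for x y
    proof -
      obtain x' y' where "x' \<in> K" "x = c x'" "y' \<in> K" "y = c y'"
        using xy by auto
      then show ?thesis using K' ip_commute[of x' y'] by simp
    qed
  qed (use zero add smult K' ip_add ip_smult ip_pos in \<open>auto\<close>)
  show norm: "hnorm ?H (c x) = hnorm H x" if "x \<in> K" for x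
    using that by (simp add: hnorm_def)
  show minus: "c x \<ominus>\<^bsub>?H\<^esub> c y = c (x \<ominus>\<^bsub>H\<^esub> y)" if "x \<in> K" "y \<in> K" for x y
    using that K' smult add by (simp add: minus_eq_smult H'.minus_eq_smult)
  have dist: "hdist ?H (c x) (c y) = hdist H x y" if "x \<in> K" "y \<in> K" for x y
  proof -
    have "x \<ominus>\<^bsub>H\<^esub> y \<in> K"
      using that K' smult add by (simp add: minus_eq_smult)
    then show ?thesis
      using that K' by (simp add: hdist_def minus norm)
  qed
  have complete': "H'.metric.mcomplete"
    unfolding H'.metric.mcomplete_def
  proof (intro allI impI)
    fix \<sigma> assume \<sigma>: "H'.metric.MCauchy \<sigma>"
    then have "range \<sigma> \<subseteq> carrier ?H"
      unfolding H'.metric.MCauchy_def by simp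
    then have "\<forall>n. \<exists>x\<in>K. \<sigma> n = c x"
      unfolding car by blast
    then obtain \<tau> where \<tau>: "\<And>n. \<tau> n \<in> K" "\<And>n. \<sigma> n = c (\<tau> n)"
      by metis
    have "metric.MCauchy \<tau>"
      using \<sigma> \<tau> K' unfolding H'.metric.MCauchy_def metric.MCauchy_def by (auto simp: dist)
    then obtain l where l: "limitin (hilbert_topology H) \<tau> l sequentially"
      using complete by (auto simp: metric.mcomplete_def)
    then have "l \<in> K"
      using closed \<tau>(1) unfolding metric.metric_closedin_iff_sequentially_closed by blast
    then have "limitin (hilbert_topology ?H) \<sigma> (c l) sequentially"
      using l \<tau> unfolding metric.limit_metric_sequentially H'.metric.limit_metric_sequentially
      by (auto simp: dist K')
    then show "\<exists>x. limitin (hilbert_topology ?H) \<sigma> x sequentially" by blast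
  qed
  have hil: "complex_hilbert_space ?H"
    by unfold_locales (rule complete')
  have \<pi>: "?\<pi> g (c x) = c (\<pi> g x)" if "x \<in> K" for g x
    using that by simp
  have cancel: "\<pi> g (\<pi> (inv\<^bsub>G\<^esub> g) x) = x" if "g \<in> carrier G" "x \<in> K" for g x
    using that K' repD(7)[of g "inv\<^bsub>G\<^esub> g" x] repD(8)[of x] by simp
  have bij: "?\<pi> g \<in> Bij (carrier ?H)" if g: "g \<in> carrier G" for g
  proof -
    have "inj_on (\<pi> g) (carrier H)"
      using repD(2)[OF g] by (simp add: Bij_def bij_betw_def)
    then have "inj_on (?\<pi> g) (c ` K)"
      using K' inv[OF g] by (auto simp: inj_on_def)
    moreover have "?\<pi> g ` (c ` K) = c ` K"
    proof (intro equalityI subsetI)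
      fix y assume "y \<in> c ` K"
      then obtain x where x: "x \<in> K" "y = c x" by auto
      then have "y = ?\<pi> g (c (\<pi> (inv\<^bsub>G\<^esub> g) x))"
        using inv g cancel by simp
      then show "y \<in> ?\<pi> g ` (c ` K)"
        using x inv g by blast
    qed (use inv[OF g] in auto)
    ultimately show ?thesis by (simp add: Bij_def bij_betw_def)
  qed
  have "?\<pi> \<in> hom G (unitary_group ?H)"
  proof (rule homI)
    show "?\<pi> g \<in> carrier (unitary_group ?H)" if g: "g \<in> carrier G" for g
      using bij[OF g] g inv add smult K' repD(4-6)
      by (auto simp: unitary_group_def simp del: restrict_apply simp add: \<pi>)
    show "?\<pi> (g \<otimes>\<^bsub>G\<^esub> h) = ?\<pi> g \<otimes>\<^bsub>unitary_group ?H\<^esub> ?\<pi> h"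
      if g: "g \<in> carrier G" and h: "h \<in> carrier G" for g h
    proof -
      have "?\<pi> (g \<otimes>\<^bsub>G\<^esub> h) = compose (c ` K) (?\<pi> g) (?\<pi> h)"
        using g h inv K' repD(7) by (auto simp: compose_def fun_eq_iff)
      then show ?thesis
        using bij[OF g] bij[OF h] by (simp add: unitary_group_def BijGroup_def)
    qed
  qed
  moreover have "continuous_map T (hilbert_topology ?H) (\<lambda>g. ?\<pi> g x)" if "x \<in> carrier ?H" for x
  proof -
    obtain x' where x': "x' \<in> K" "x = c x'" using \<open>x \<in> carrier ?H\<close> by auto
    show ?thesis
      unfolding H'.metric.continuous_map_to_metric
    proof (intro ballI allI impI)
      fix g and e :: real assume g: "g \<in> topspace T" and "0 < e"
      then obtain U where U: "openin T U" "g \<in> U" "\<And>h. h \<in> U \<Longrightarrow> \<pi> h x' \<in> metric.mball (\<pi> g x') e"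
        using repD(9)[of x'] K' x' unfolding metric.continuous_map_to_metric by meson
      have "U \<subseteq> carrier G" using openin_subset[OF U(1)] T by simp
      then have "\<forall>h\<in>U. ?\<pi> h x \<in> H'.metric.mball (?\<pi> g x) e"
        using U x' inv g T unfolding H'.metric.in_mball by (auto simp: dist)
      with U show "\<exists>U. openin T U \<and> g \<in> U \<and> (\<forall>h\<in>U. ?\<pi> h x \<in> H'.metric.mball (?\<pi> g x) e)"
        by blast
    qed
  qed
  ultimately show "unitary_representation G T ?H ?\<pi>"
    using hil by (simp add: unitary_representation_def)
qed

primrec formal_sum :: "'h hilbert_space \<Rightarrow> ('g \<Rightarrow> 'h \<Rightarrow> 'h) \<Rightarrow> 'h \<Rightarrow> (complex \<times> 'g) list \<Rightarrow> 'h" where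
  "formal_sum H \<pi> \<xi> [] = \<zero>\<^bsub>H\<^esub>"
| "formal_sum H \<pi> \<xi> (p # ps) = (fst p \<odot>\<^bsub>H\<^esub> \<pi> (snd p) \<xi>) \<oplus>\<^bsub>H\<^esub> formal_sum H \<pi> \<xi> ps"

theorem kazhdan_pair_all_types:
  fixes G :: "('g, 'b) monoid_scheme"
  assumes G: "group G" and T: "topspace T = carrier G" and Q: "Q \<subseteq> carrier G"
    and univ: "kazhdan_pair TYPE('g hilbert_universe) G T Q \<epsilon>"
  shows "kazhdan_pair TYPE('h) G T Q \<epsilon>"
  unfolding kazhdan_pair_def
proof (intro allI impI, elim conjE exE)
  fix H :: "'h hilbert_space" and \<pi> \<xi>
  assume rep: "unitary_representation G T H \<pi>" and \<xi>: "almost_invariant H \<pi> Q \<epsilon> \<xi>"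
  note repD = unitary_representationD[OF rep G]
  interpret G: group G by fact
  interpret complex_hilbert_space H by (rule repD)
  have \<xi>H: "\<xi> \<in> carrier H"
    using \<xi> by (simp add: almost_invariant_def)
  let ?L = "lists (UNIV \<times> carrier G)" and ?s = "formal_sum H \<pi> \<xi>"
  have sum_closed: "?s ps \<in> carrier H" if "ps \<in> ?L" for ps
    using that by (induction ps) (auto simp: repD(3) \<xi>H)
  have sum_append: "?s (ps @ qs) = ?s ps \<oplus>\<^bsub>H\<^esub> ?s qs" if "ps \<in> ?L" "qs \<in> ?L" for ps qs
    using that(1)
  proof (induction ps)
    case (Cons p ps)
    then have "?s ps \<in> carrier H" "?s qs \<in> carrier H"
      using sum_closed that(2) by auto
    with Cons show ?case by (auto simp: repD(3) \<xi>H M.a_assoc)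
  qed (simp add: sum_closed that(2))
  have sum_smult: "?s (map (\<lambda>p. (a * fst p, snd p)) ps) = a \<odot>\<^bsub>H\<^esub> ?s ps" if "ps \<in> ?L" for a ps
    using that
  proof (induction ps)
    case Nil
    show ?case using smult_r_null[of a] by (simp add: complex_ring_def)
  next
    case (Cons p ps)
    then have "?s ps \<in> carrier H"
      using sum_closed by auto
    with Cons show ?case
      using smult_r_distr[of a] smult_assoc1[of a "fst p"]
      by (auto simp: repD(3) \<xi>H complex_ring_def)
  qed
  have sum_\<pi>: "?s (map (\<lambda>p. (fst p, g \<otimes>\<^bsub>G\<^esub> snd p)) ps) = \<pi> g (?s ps)"
    if "ps \<in> ?L" and g: "g \<in> carrier G" for g ps
    using that(1)
  proof (induction ps)
    case Nil
    have "\<pi> g \<zero>\<^bsub>H\<^esub> = \<pi> g (0 \<odot>\<^bsub>H\<^esub> \<zero>\<^bsub>H\<^esub>)"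
      using smult_l_null[of "\<zero>\<^bsub>H\<^esub>"] by (simp add: complex_ring_def)
    also have "\<dots> = \<zero>\<^bsub>H\<^esub>"
      using repD(5)[OF g, of "\<zero>\<^bsub>H\<^esub>" 0] smult_l_null[of "\<pi> g \<zero>\<^bsub>H\<^esub>"] repD(3)[OF g]
      by (simp add: complex_ring_def)
    finally show ?case by simp
  next
    case (Cons p ps)
    then have "?s ps \<in> carrier H"
      using sum_closed by auto
    with Cons show ?case using g by (auto simp: repD(3,4,5,7) \<xi>H)
  qed
  define lim where "lim \<sigma> x \<longleftrightarrow>
    range \<sigma> \<subseteq> ?L \<and> limitin (hilbert_topology H) (\<lambda>n. ?s (\<sigma> n)) x sequentially" for \<sigma> x
  define K where "K = (hilbert_topology H) closure_of (?s ` ?L)"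
  have K_iff: "x \<in> K \<longleftrightarrow> (\<exists>\<sigma>. lim \<sigma> x)" for x
  proof
    assume "x \<in> K"
    then obtain \<tau> where \<tau>: "range \<tau> \<subseteq> ?s ` ?L" "limitin (hilbert_topology H) \<tau> x sequentially"
      by (auto simp: K_def metric.closure_of_sequentially)
    then have "\<forall>n. \<exists>ps\<in>?L. \<tau> n = ?s ps" by (auto simp: image_subset_iff)
    then obtain \<sigma> where "\<And>n. \<sigma> n \<in> ?L" "\<And>n. \<tau> n = ?s (\<sigma> n)" by metis
    moreover from this have "\<tau> = (\<lambda>n. ?s (\<sigma> n))" by auto
    ultimately have "lim \<sigma> x" using \<tau> by (auto simp: lim_def)
    then show "\<exists>\<sigma>. lim \<sigma> x" by blast
  next
    assume "\<exists>\<sigma>. lim \<sigma> x"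
    then obtain \<sigma> where \<sigma>: "\<And>n. \<sigma> n \<in> ?L"
      "limitin (hilbert_topology H) (\<lambda>n. ?s (\<sigma> n)) x sequentially"
      by (auto simp: lim_def)
    moreover have "x \<in> carrier H" using \<sigma>(2) metric.limitin_mspace by blast
    ultimately show "x \<in> K"
      unfolding K_def metric.closure_of_sequentially
      by (intro CollectI conjI exI[of _ "\<lambda>n. ?s (\<sigma> n)"]) (auto simp: sum_closed)
  qed
  have limI: "lim \<sigma> x"
    if "\<And>n. \<sigma> n \<in> ?L" "x \<in> carrier H" "(\<lambda>n. hdist H (?s (\<sigma> n)) x) \<longlonglongrightarrow> 0" for \<sigma> x
    using that sum_closed by (auto simp: lim_def metric.limitin_metric_dist_null)
  have limD: "\<sigma> n \<in> ?L" "x \<in> carrier H" "(\<lambda>n. hdist H (?s (\<sigma> n)) x) \<longlonglongrightarrow> 0"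
    if "lim \<sigma> x" for \<sigma> x n
    using that by (auto simp: lim_def metric.limitin_metric_dist_null)
  have KI: "?s ps \<in> K" if "ps \<in> ?L" for ps
    unfolding K_iff using that sum_closed by (intro exI[of _ "\<lambda>_. ps"] limI) auto
  have K0: "\<zero>\<^bsub>H\<^esub> \<in> K"
    using KI[of "[]"] by simp
  have K\<xi>: "\<xi> \<in> K"
    using KI[of "[(1, \<one>\<^bsub>G\<^esub>)]"] \<xi>H by (simp add: repD(8))
  have hdist_add: "hdist H (x \<oplus>\<^bsub>H\<^esub> y) (x' \<oplus>\<^bsub>H\<^esub> y') \<le> hdist H x x' + hdist H y y'"
    if "x \<in> carrier H" "y \<in> carrier H" "x' \<in> carrier H" "y' \<in> carrier H" for x y x' y'
  proof -
    have "(x \<oplus>\<^bsub>H\<^esub> y) \<ominus>\<^bsub>H\<^esub> (x' \<oplus>\<^bsub>H\<^esub> y') = (x \<ominus>\<^bsub>H\<^esub> x') \<oplus>\<^bsub>H\<^esub> (y \<ominus>\<^bsub>H\<^esub> y')"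
      using that by (simp add: a_minus_def M.minus_add M.a_ac)
    then show ?thesis
      using that hnorm_triangle[of "x \<ominus>\<^bsub>H\<^esub> x'" "y \<ominus>\<^bsub>H\<^esub> y'"] by (simp add: hdist_eq)
  qed
  have hdist_smult: "hdist H (a \<odot>\<^bsub>H\<^esub> x) (a \<odot>\<^bsub>H\<^esub> y) = cmod a * hdist H x y"
    if "x \<in> carrier H" "y \<in> carrier H" for a x y
  proof -
    have "a \<odot>\<^bsub>H\<^esub> x \<ominus>\<^bsub>H\<^esub> a \<odot>\<^bsub>H\<^esub> y = a \<odot>\<^bsub>H\<^esub> (x \<ominus>\<^bsub>H\<^esub> y)"
      using that smult_r_distr[of a x "(-1) \<odot>\<^bsub>H\<^esub> y"] smult_assoc1[of a "-1" y]
        smult_assoc1[of "-1" a y]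
      by (simp add: minus_eq_smult complex_ring_def)
    then show ?thesis using that by (simp add: hdist_eq hnorm_smult)
  qed
  have hdist_\<pi>: "hdist H (\<pi> g x) (\<pi> g y) = hdist H x y"
    if "g \<in> carrier G" "x \<in> carrier H" "y \<in> carrier H" for g x y
  proof -
    have "\<pi> g x \<ominus>\<^bsub>H\<^esub> \<pi> g y = \<pi> g (x \<ominus>\<^bsub>H\<^esub> y)"
      using that by (simp add: minus_eq_smult repD(3,4,5))
    then show ?thesis using that by (simp add: hdist_eq hnorm_def repD(3,6))
  qed
  have K_add: "x \<oplus>\<^bsub>H\<^esub> y \<in> K" if x: "x \<in> K" and y: "y \<in> K" for x y
  proof -
    obtain \<sigma> \<tau> where *: "lim \<sigma> x" "lim \<tau> y" using x y unfolding K_iff by blast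
    have "(\<lambda>n. hdist H (?s (\<sigma> n @ \<tau> n)) (x \<oplus>\<^bsub>H\<^esub> y)) \<longlonglongrightarrow> 0"
    proof (rule tendsto_sandwich[OF _ _ tendsto_const])
      show "(\<lambda>n. hdist H (?s (\<sigma> n)) x + hdist H (?s (\<tau> n)) y) \<longlonglongrightarrow> 0"
        using tendsto_add[OF limD(3)[OF *(1)] limD(3)[OF *(2)]] by simp
    qed (use limD(1,2)[OF *(1)] limD(1,2)[OF *(2)] sum_closed sum_append hdist_add
          in \<open>auto intro!: always_eventually\<close>)
    then have "lim (\<lambda>n. \<sigma> n @ \<tau> n) (x \<oplus>\<^bsub>H\<^esub> y)"
      using limD(1,2)[OF *(1)] limD(1,2)[OF *(2)] by (intro limI) auto
    then show ?thesis unfolding K_iff by blast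
  qed
  have K_smult: "a \<odot>\<^bsub>H\<^esub> x \<in> K" if x: "x \<in> K" for a x
  proof -
    obtain \<sigma> where *: "lim \<sigma> x" using x unfolding K_iff by blast
    let ?\<tau> = "\<lambda>n. map (\<lambda>p. (a * fst p, snd p)) (\<sigma> n)"
    have "(\<lambda>n. hdist H (?s (?\<tau> n)) (a \<odot>\<^bsub>H\<^esub> x)) \<longlonglongrightarrow> 0"
      using tendsto_mult_right_zero[OF limD(3)[OF *], of "cmod a"] limD(1,2)[OF *]
      by (simp add: sum_smult hdist_smult sum_closed)
    moreover have "?\<tau> n \<in> ?L" for n
      using limD(1)[OF *, of n] by fastforce
    ultimately have "lim ?\<tau> (a \<odot>\<^bsub>H\<^esub> x)"
      using limD(2)[OF *] by (intro limI) auto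
    then show ?thesis unfolding K_iff by blast
  qed
  have K_\<pi>: "\<pi> g x \<in> K" if x: "x \<in> K" and g: "g \<in> carrier G" for g x
  proof -
    obtain \<sigma> where *: "lim \<sigma> x" using x unfolding K_iff by blast
    let ?\<tau> = "\<lambda>n. map (\<lambda>p. (fst p, g \<otimes>\<^bsub>G\<^esub> snd p)) (\<sigma> n)"
    have "(\<lambda>n. hdist H (?s (?\<tau> n)) (\<pi> g x)) \<longlonglongrightarrow> 0"
      using limD[OF *] g by (simp add: sum_\<pi> hdist_\<pi> sum_closed)
    moreover have "?\<tau> n \<in> ?L" for n
      using limD(1)[OF *, of n] g by fastforce
    ultimately have "lim ?\<tau> (\<pi> g x)"
      using limD(2)[OF *] g repD(3) by (intro limI) auto
    then show ?thesis unfolding K_iff by blast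
  qed
  define c where "c x = (SOME \<sigma>. lim \<sigma> x)" for x
  have c: "lim (c x) x" if "x \<in> K" for x
    using that unfolding c_def K_iff by (rule someI_ex)
  have inj: "inj_on c K"
  proof (rule inj_onI)
    fix x y assume "x \<in> K" "y \<in> K" "c x = c y"
    then have "lim (c x) x" "lim (c x) y" using c by metis+
    then show "x = y"
      by (auto simp: lim_def intro: metric.limitin_metric_unique)
  qed
  have closed: "closedin (hilbert_topology H) K"
    by (simp add: K_def)
  have KH: "x \<in> carrier H" if "x \<in> K" for x
    using closedin_subset[OF closed] that by auto
  let ?H = "transported c K H"
  let ?\<pi> = "\<lambda>g. \<lambda>x\<in>c ` K. c (\<pi> g (inv_into K c x))"
  note transport = unitary_representation_transported[OF rep G T closed K0 K_add K_smult K_\<pi> inj]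
  have [simp]: "inv_into K c (c x) = x" if "x \<in> K" for x
    using inj that by simp
  have ceq: "c x = c y \<longleftrightarrow> x = y" if "x \<in> K" "y \<in> K" for x y
    using inj that by (simp add: inj_on_eq_iff)
  have car: "carrier ?H = c ` K" and z: "\<zero>\<^bsub>?H\<^esub> = c \<zero>\<^bsub>H\<^esub>"
    by (simp_all add: transported_def Let_def)
  have K_minus: "x \<ominus>\<^bsub>H\<^esub> y \<in> K" if "x \<in> K" "y \<in> K" for x y
    using that KH K_add K_smult by (simp add: minus_eq_smult)
  have "almost_invariant ?H ?\<pi> Q \<epsilon> (c \<xi>)"
    using \<xi> K\<xi> K0 K_\<pi> K_minus Q
    by (auto simp: almost_invariant_def car z ceq transport subset_iff)
  with univ transport(1) have "has_invariant_vector G ?H ?\<pi>"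
    unfolding kazhdan_pair_def by blast
  then obtain \<eta> where "\<eta> \<in> K" "c \<eta> \<noteq> c \<zero>\<^bsub>H\<^esub>" "\<forall>g\<in>carrier G. ?\<pi> g (c \<eta>) = c \<eta>"
    by (auto simp: has_invariant_vector_def car z)
  then show "has_invariant_vector G H \<pi>"
    unfolding has_invariant_vector_def
    using K_\<pi> KH ceq by (intro bexI[of _ \<eta>]) auto
qed

end

theory Submission
  imports Defs "HOL-Library.Diagonal_Subsequence" "HOL-Library.Ramsey"
begin

text \<open>
Let \<open>G\<close> be the automorphism group of \<open>X\<close> and let \<open>G\<^sub>A\<close> be the pointwise stabilizer of a finite
set \<open>A\<close> (\<open>fixer S X A\<close> below). In a unitary representation of \<open>G\<close> let \<open>H\<^sub>A\<close> be the space of the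
vectors fixed by \<open>G\<^sub>A\<close> (\<open>fixed A\<close> below). Suppose that there is no non-zero invariant vector,
that is, \<open>H\<^sub>A = 0\<close> for the empty set \<open>A\<close>. There are two automorphisms \<open>a\<close> and \<open>b\<close>, which do not
depend on the representation, one of which moves a given non-zero vector by a definite
proportion of its norm. Three facts carry the argument.

\<^item> The spaces \<open>H\<^sub>A\<close> have a dense union (\<open>fixed_dense\<close>), because the groups \<open>G\<^sub>A\<close> form a base of
  neighbourhoods of the identity: a vector which \<open>G\<^sub>A\<close> hardly moves is close to the circumcentre
  of its \<open>G\<^sub>A\<close>-orbit, which lies in \<open>H\<^sub>A\<close>.

\<^item> The orthogonal projection onto \<open>H\<^sub>B\<close> maps \<open>H\<^sub>A\<close> into \<open>H\<^bsub>A \<inter> B\<^esub>\<close> (\<open>fixed_orthogonal\<close>,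
  \<open>proj_Int\<close>).

\<^item> There are a colouring \<open>c\<close> of the elements of \<open>X\<close> by integers and automorphisms \<open>a\<close> and \<open>b\<close>
  such that \<open>b\<close> raises every colour by one, while \<open>a\<close> sends the colours \<open>3k + 1\<close> and \<open>3k + 2\<close> to
  \<open>3k\<close> and the colour \<open>3k\<close> to \<open>3k - 2\<close> or \<open>3k - 1\<close> (\<open>paradoxical_automorphisms\<close>). Both act
  monotonically on colours.

By the second fact, a vector of \<open>H\<^sub>A\<close> is the orthogonal sum of pieces indexed by the integers:
the \<open>j\<close>-th piece is the difference of its projections for the sets \<open>{x \<in> A. c x \<ge> j}\<close> and
\<open>{x \<in> A. c x \<ge> j + 1}\<close>. (The space is a sum of pieces indexed by finite non-empty sets, and
these sets are sorted by their least colour.) Let \<open>m\<^sub>0\<close>, \<open>m\<^sub>1\<close>, \<open>m\<^sub>2\<close> be the squared norms of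
the parts whose index is \<open>0\<close>, \<open>1\<close>, \<open>2\<close> modulo \<open>3\<close>. A map that acts monotonically on colours acts
in the same way on the least colours of finite sets. So \<open>b\<close> carries \<open>m\<^sub>0\<close> to \<open>m\<^sub>1\<close> and \<open>m\<^sub>1\<close> to
\<open>m\<^sub>2\<close>, and \<open>a\<close> carries \<open>m\<^sub>1 + m\<^sub>2\<close> to \<open>m\<^sub>0\<close>. For a vector which \<open>a\<close> and \<open>b\<close> hardly move the
three numbers are therefore nearly equal and \<open>m\<^sub>1 + m\<^sub>2\<close> is nearly \<open>m\<^sub>0\<close>, which is impossible
unless the vector is zero (\<open>no_almost_invariant_fixed\<close>).

The second fact is where the hypotheses meet. By \<open>\<omega>\<close>-categoricity \<open>G\<close> has finitely many orbits
on tuples of each length (\<open>finitely_many_orbits\<close>), so a vector \<open>\<xi>\<close> in some \<open>H\<^sub>A\<close> has only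
finitely many inner products with its translates, and the same finite set contains all inner
products of weak limits of translates. Among the weak limits of the \<open>G\<^sub>C\<close>-orbit of \<open>\<xi>\<close> there is
then one of least norm, and its \<open>G\<^sub>C\<close>-orbit must be finite (\<open>wlim_finite_orbit\<close>). Weak
elimination of imaginaries and the absence of algebraicity say that \<open>G\<^sub>C\<close> has no proper open
subgroup of finite index and that \<open>G\<^sub>A\<close> and \<open>G\<^sub>B\<close> generate \<open>G\<^bsub>A \<inter> B\<^esub>\<close> (\<open>fixer_no_finite_index\<close>,
\<open>fixer_Int_subset\<close>). The first of these makes the limit a vector of \<open>H\<^sub>C\<close>, so that it is the
projection of \<open>\<xi>\<close>. Projecting \<open>\<xi>\<close> to \<open>H\<^sub>B\<close>, \<open>H\<^sub>A\<close>, \<open>H\<^sub>B\<close>, \<dots> in turn therefore gives decreasing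
norms in a finite set, so the process becomes stationary at a vector of \<open>H\<^sub>A \<inter> H\<^sub>B\<close>, and the
second of them identifies this space with \<open>H\<^bsub>A \<inter> B\<^esub>\<close>.
\<close>


section \<open>Automorphisms, formulas and orbits\<close>

abbreviation Aut :: "'r signature \<Rightarrow> ('r, 'a) rel_structure \<Rightarrow> ('a \<Rightarrow> 'a) set" where
  "Aut S X \<equiv> carrier (aut_group S X)"

lemma Aut_iff: "g \<in> Aut S X \<longleftrightarrow> g \<in> Bij (universe X) \<and> struct_iso S X X g"
  by (simp add: aut_group_def)

lemma Aut_bij: "g \<in> Aut S X \<Longrightarrow> bij_betw g (universe X) (universe X)"
  by (simp add: Aut_iff Bij_def)

lemma Aut_closed [simp]: "\<lbrakk>g \<in> Aut S X; x \<in> universe X\<rbrakk> \<Longrightarrow> g x \<in> universe X"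
  using Aut_bij bij_betwE by metis

lemma Aut_inj: "\<lbrakk>g \<in> Aut S X; x \<in> universe X; y \<in> universe X\<rbrakk> \<Longrightarrow> g x = g y \<longleftrightarrow> x = y"
  using Aut_bij[of g S X] by (auto simp: bij_betw_def inj_on_def)

lemma Aut_mult [simp]:
  "\<lbrakk>g \<in> Aut S X; h \<in> Aut S X; x \<in> universe X\<rbrakk> \<Longrightarrow> (g \<otimes>\<^bsub>aut_group S X\<^esub> h) x = g (h x)"
  by (auto simp: aut_group_def BijGroup_def compose_def)

lemma Aut_one [simp]: "x \<in> universe X \<Longrightarrow> \<one>\<^bsub>aut_group S X\<^esub> x = x"
  by (simp add: aut_group_def BijGroup_def)

lemma Aut_one_closed [simp]: "\<one>\<^bsub>aut_group S X\<^esub> \<in> Aut S X"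
  using group.subgroup_self[OF group_aut_group] subgroup.one_closed by blast

lemma Aut_mult_closed [simp]:
  "\<lbrakk>g \<in> Aut S X; h \<in> Aut S X\<rbrakk> \<Longrightarrow> g \<otimes>\<^bsub>aut_group S X\<^esub> h \<in> Aut S X"
  using group.subgroup_self[OF group_aut_group] subgroup.m_closed by metis

lemma Aut_inv_closed [simp]: "g \<in> Aut S X \<Longrightarrow> inv\<^bsub>aut_group S X\<^esub> g \<in> Aut S X"
  using group.inv_closed[OF group_aut_group] by metis

lemma Aut_inv [simp]:
  assumes "g \<in> Aut S X" "x \<in> universe X"
  shows "(inv\<^bsub>aut_group S X\<^esub> g) (g x) = x" "g ((inv\<^bsub>aut_group S X\<^esub> g) x) = x"
  using group.l_inv[OF group_aut_group assms(1)] group.r_inv[OF group_aut_group assms(1)]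
    Aut_mult[of "inv\<^bsub>aut_group S X\<^esub> g" S X g x] Aut_mult[of g S X "inv\<^bsub>aut_group S X\<^esub> g" x] assms
  by auto

lemma Aut_mult_inv:
  assumes "g \<in> Aut S X" "h \<in> Aut S X" "y \<in> universe X"
  shows "(h \<otimes>\<^bsub>aut_group S X\<^esub> inv\<^bsub>aut_group S X\<^esub> g) (g y) = h y"
  using assms Aut_closed[OF assms(1,3)] by simp

lemma AutI:
  assumes "struct_iso S X X f"
  shows "restrict f (universe X) \<in> Aut S X"
proof -
  have "struct_iso S X X (restrict f (universe X))"
    unfolding struct_iso_def
  proof (intro conjI ballI)
    show "bij_betw (restrict f (universe X)) (universe X) (universe X)"
      using assms by (auto simp: struct_iso_def intro: bij_betw_cong[THEN iffD1, rotated])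
    fix r xs assume *: "r \<in> symbols S" "xs \<in> tuples (universe X) (arity S r)"
    then have "map (restrict f (universe X)) xs = map f xs"
      by (auto simp: tuples_def)
    then show "xs \<in> rels X r \<longleftrightarrow> map (restrict f (universe X)) xs \<in> rels X r"
      using assms * by (simp add: struct_iso_def del: map_eq_conv)
  qed
  then show ?thesis by (auto simp: Aut_iff Bij_def struct_iso_def)
qed

lemma map_tuples [simp]: "\<lbrakk>g \<in> Aut S X; xs \<in> tuples (universe X) n\<rbrakk> \<Longrightarrow> map g xs \<in> tuples (universe X) n"
  by (auto simp: tuples_def)

lemma sat_cong:
  "(\<And>i. i \<in> free_vars \<phi> \<Longrightarrow> v i = w i) \<Longrightarrow> sat X v \<phi> = sat X w \<phi>"
proof (induction \<phi> arbitrary: v w)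
  case (Rel r js)
  then have "map v js = map w js" by auto
  then show ?case by (simp del: map_eq_conv)
next
  case (Conj \<phi> \<psi>)
  from Conj.IH(1)[of v w] Conj.IH(2)[of v w] Conj.prems show ?case by simp
next
  case (Exists i \<phi>)
  have "sat X (v(i := a)) \<phi> = sat X (w(i := a)) \<phi>" for a
    by (rule Exists.IH) (use Exists.prems in auto)
  then show ?case by simp
next
  case (Neg \<phi>)
  from Neg.IH[of v w] Neg.prems show ?case by simp
qed simp

lemma finite_free_vars [simp]: "finite (free_vars \<phi>)"
  by (induction \<phi>) auto

lemma sat_struct_iso:
  assumes f: "struct_iso S X Y f"
  shows "\<lbrakk>formula_over S \<phi>; \<And>i. i \<in> free_vars \<phi> \<Longrightarrow> v i \<in> universe X\<rbrakk>
    \<Longrightarrow> sat Y (\<lambda>i. f (v i)) \<phi> = sat X v \<phi>"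
proof (induction \<phi> arbitrary: v)
  case (Eq i j)
  then show ?case using f by (auto simp: struct_iso_def bij_betw_def inj_on_def)
next
  case (Rel r js)
  then have "map v js \<in> tuples (universe X) (arity S r)" by (auto simp: tuples_def)
  then show ?case using f Rel by (auto simp: struct_iso_def comp_def)
next
  case (Exists i \<phi>)
  have *: "sat Y ((\<lambda>j. f (v j))(i := f a)) \<phi> = sat X (v(i := a)) \<phi>" if "a \<in> universe X" for a
  proof -
    have "(\<lambda>j. f (v j))(i := f a) = (\<lambda>j. f ((v(i := a)) j))" by auto
    moreover have "sat Y (\<lambda>j. f ((v(i := a)) j)) \<phi> = sat X (v(i := a)) \<phi>"
      by (rule Exists.IH) (use Exists.prems that in auto)
    ultimately show ?thesis by (simp only:)
  qed
  have "universe Y = f ` universe X" using f by (auto simp: struct_iso_def bij_betw_def)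
  then show ?case using * by auto
next
  case (Conj \<phi> \<psi>)
  from Conj.IH(1)[of v] Conj.IH(2)[of v] Conj.prems show ?case by simp
next
  case (Neg \<phi>)
  from Neg.IH[of v] Neg.prems show ?case by simp
qed

lemma sat_tuple_struct_iso:
  assumes f: "struct_iso S X Y f" and "formula_in S n \<phi>" "xs \<in> tuples (universe X) n"
  shows "sat_tuple Y \<phi> (map f xs) = sat_tuple X \<phi> xs"
proof -
  have lt: "i < length xs" if "i \<in> free_vars \<phi>" for i
    using assms that by (auto simp: formula_in_def tuples_def)
  have "sat Y (\<lambda>i. map f xs ! i) \<phi> = sat Y (\<lambda>i. f (xs ! i)) \<phi>"
    by (rule sat_cong) (simp add: lt)
  also have "\<dots> = sat X (\<lambda>i. xs ! i) \<phi>"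
    using assms lt by (intro sat_struct_iso[OF f]) (auto simp: formula_in_def tuples_def)
  finally show ?thesis by (simp add: sat_tuple_def)
qed

lemma sat_tuple_Aut:
  assumes "g \<in> Aut S X" and "formula_in S n \<phi>" "xs \<in> tuples (universe X) n"
  shows "sat_tuple X \<phi> (map g xs) = sat_tuple X \<phi> xs"
  using assms(1) unfolding Aut_iff by (intro sat_tuple_struct_iso[OF _ assms(2,3)]) simp

lemma sat_tuple_append:
  assumes "formula_in S n \<phi>" "length xs = n"
  shows "sat_tuple X \<phi> (xs @ ys) = sat_tuple X \<phi> xs"
  unfolding sat_tuple_def using assms by (intro sat_cong) (auto simp: formula_in_def nth_append)

text \<open>
Renaming the free variables by an arbitrary, possibly non-injective, map can capture bound
variables. The quantifier step therefore moves the bound variable to a fresh one, and only the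
existence of a suitable formula is stated.
\<close>

lemma substitution_exists:
  "formula_over S \<phi> \<Longrightarrow> \<exists>\<psi>. formula_over S \<psi> \<and> free_vars \<psi> \<subseteq> \<rho> ` free_vars \<phi> \<and>
     (\<forall>v. sat X v \<psi> = sat X (\<lambda>i. v (\<rho> i)) \<phi>)"
proof (induction \<phi> arbitrary: \<rho>)
  case (Eq i j)
  show ?case by (rule exI[of _ "Eq (\<rho> i) (\<rho> j)"]) auto
next
  case (Rel r js)
  then show ?case by (intro exI[of _ "Rel r (map \<rho> js)"]) (auto simp: comp_def)
next
  case (Neg \<phi>)
  then obtain \<psi> where "formula_over S \<psi>" "free_vars \<psi> \<subseteq> \<rho> ` free_vars \<phi>"
    "\<forall>v. sat X v \<psi> = sat X (\<lambda>i. v (\<rho> i)) \<phi>" by fastforce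
  then show ?case by (intro exI[of _ "Neg \<psi>"]) auto
next
  case (Conj \<phi>1 \<phi>2)
  then obtain \<psi>1 \<psi>2 where "formula_over S \<psi>1" "free_vars \<psi>1 \<subseteq> \<rho> ` free_vars \<phi>1"
    "\<forall>v. sat X v \<psi>1 = sat X (\<lambda>i. v (\<rho> i)) \<phi>1" "formula_over S \<psi>2" "free_vars \<psi>2 \<subseteq> \<rho> ` free_vars \<phi>2"
    "\<forall>v. sat X v \<psi>2 = sat X (\<lambda>i. v (\<rho> i)) \<phi>2" by (metis formula_over.simps(4))
  then show ?case by (intro exI[of _ "Conj \<psi>1 \<psi>2"]) auto
next
  case (Exists i \<phi>)
  obtain m where m: "m \<notin> \<rho> ` (free_vars \<phi> - {i})"
    using ex_new_if_finite[of "\<rho> ` (free_vars \<phi> - {i})"] by auto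
  obtain \<psi> where \<psi>: "formula_over S \<psi>" "free_vars \<psi> \<subseteq> (\<rho>(i := m)) ` free_vars \<phi>"
    "\<And>v. sat X v \<psi> = sat X (\<lambda>j. v ((\<rho>(i := m)) j)) \<phi>"
    using Exists.IH[of "\<rho>(i := m)"] Exists.prems by auto
  have "sat X (v(m := a)) \<psi> = sat X ((\<lambda>j. v (\<rho> j))(i := a)) \<phi>" for v a
    unfolding \<psi>(3) using m by (intro sat_cong) auto
  moreover have "free_vars \<psi> - {m} \<subseteq> \<rho> ` (free_vars \<phi> - {i})"
    using \<psi>(2) by (auto split: if_splits)
  ultimately show ?case using \<psi>(1) by (intro exI[of _ "Exists m \<psi>"]) auto
qed

instance formula :: (countable) countable
  by countable_datatype

lemma countable_formulas:
  assumes "countable (symbols S)"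
  shows "countable {\<phi>. formula_over S \<phi>}"
proof -
  let ?c = "to_nat_on (symbols S)"
  have sub: "set_formula \<phi> \<subseteq> symbols S" if "formula_over S \<phi>" for \<phi>
    using that by (induction \<phi>) auto
  have "inj_on (map_formula ?c) {\<phi>. formula_over S \<phi>}"
  proof (rule inj_onI)
    fix \<phi> \<psi> assume *: "\<phi> \<in> {\<phi>. formula_over S \<phi>}" "\<psi> \<in> {\<phi>. formula_over S \<phi>}"
      "map_formula ?c \<phi> = map_formula ?c \<psi>"
    show "\<phi> = \<psi>"
    proof (rule formula.inj_map_strong[OF _ *(3)])
      fix z w assume "z \<in> set_formula \<phi>" "w \<in> set_formula \<psi>" "?c z = ?c w"
      moreover have "z \<in> symbols S" "w \<in> symbols S"
        using sub *(1,2) calculation by blast+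
      ultimately show "z = w" using inj_on_to_nat_on[OF assms] by (auto dest: inj_onD)
    qed
  qed
  then show ?thesis by (rule countable_image_inj_on[rotated]) simp
qed

definition conjs :: "'r formula list \<Rightarrow> 'r formula" where
  "conjs \<phi>s = foldr Conj \<phi>s (Exists 0 (Eq 0 0))"

lemma sat_conjs: "universe X \<noteq> {} \<Longrightarrow> sat X v (conjs \<phi>s) \<longleftrightarrow> (\<forall>\<phi>\<in>set \<phi>s. sat X v \<phi>)"
  by (induction \<phi>s) (auto simp: conjs_def)

lemma formula_over_conjs: "formula_over S (conjs \<phi>s) \<longleftrightarrow> (\<forall>\<phi>\<in>set \<phi>s. formula_over S \<phi>)"
  by (induction \<phi>s) (auto simp: conjs_def)

lemma free_vars_conjs: "free_vars (conjs \<phi>s) = (\<Union>\<phi>\<in>set \<phi>s. free_vars \<phi>)"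
  by (induction \<phi>s) (auto simp: conjs_def)

definition exs :: "nat list \<Rightarrow> 'r formula \<Rightarrow> 'r formula" where
  "exs is \<phi> = foldr Exists is \<phi>"

lemma sat_exs:
  "sat X v (exs is \<phi>) \<longleftrightarrow>
    (\<exists>w. (\<forall>i\<in>set is. w i \<in> universe X) \<and> (\<forall>i. i \<notin> set is \<longrightarrow> w i = v i) \<and> sat X w \<phi>)"
proof (induction "is" arbitrary: v)
  case Nil
  have "w = v" if "\<forall>i. w i = v i" for w
    using that by auto
  then show ?case by (auto simp: exs_def)
next
  case (Cons i "is")
  have "sat X v (exs (i # is) \<phi>) \<longleftrightarrow> (\<exists>a\<in>universe X. sat X (v(i := a)) (exs is \<phi>))"
    by (simp add: exs_def)
  also have "\<dots> \<longleftrightarrow> (\<exists>a\<in>universe X. \<exists>w. (\<forall>j\<in>set is. w j \<in> universe X) \<and>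
      (\<forall>j. j \<notin> set is \<longrightarrow> w j = (v(i := a)) j) \<and> sat X w \<phi>)"
    unfolding Cons.IH ..
  also have "\<dots> \<longleftrightarrow> (\<exists>w. (\<forall>j\<in>set (i # is). w j \<in> universe X) \<and>
      (\<forall>j. j \<notin> set (i # is) \<longrightarrow> w j = v j) \<and> sat X w \<phi>)" (is "?L = ?R")
  proof
    assume ?L
    then obtain a w where *: "a \<in> universe X" "\<forall>j\<in>set is. w j \<in> universe X"
      "\<forall>j. j \<notin> set is \<longrightarrow> w j = (v(i := a)) j" "sat X w \<phi>" by blast
    then have "w i \<in> universe X" by (cases "i \<in> set is") auto
    with * show ?R by (intro exI[of _ w]) auto
  next
    assume ?R
    then obtain w where "\<forall>j\<in>set (i # is). w j \<in> universe X"
      "\<forall>j. j \<notin> set (i # is) \<longrightarrow> w j = v j" "sat X w \<phi>" by blast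
    then show ?L by (intro bexI[of _ "w i"] exI[of _ w]) auto
  qed
  finally show ?case .
qed

lemma formula_over_exs [simp]: "formula_over S (exs is \<phi>) = formula_over S \<phi>"
  by (induction "is") (auto simp: exs_def)

lemma free_vars_exs [simp]: "free_vars (exs is \<phi>) = free_vars \<phi> - set is"
  by (induction "is") (auto simp: exs_def)

text \<open>
In a homogeneous relational structure the orbit of a tuple is determined by the formulas that it
satisfies; the proof uses only atomic ones, which make the obvious map between the two tuples an
isomorphism of finite substructures.
\<close>

lemma same_orbit:
  assumes hom: "homogeneous S X" and xs: "xs \<in> tuples (universe X) n" and ys: "ys \<in> tuples (universe X) n"
    and eq: "\<And>\<phi>. formula_in S n \<phi> \<Longrightarrow> sat_tuple X \<phi> xs = sat_tuple X \<phi> ys"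
  shows "\<exists>g\<in>Aut S X. ys = map g xs"
proof -
  have len: "length xs = n" "length ys = n" and sub: "set xs \<subseteq> universe X" "set ys \<subseteq> universe X"
    using xs ys by (auto simp: tuples_def)
  have E: "xs ! i = xs ! j \<longleftrightarrow> ys ! i = ys ! j" if "i < n" "j < n" for i j
    using eq[of "Eq i j"] that by (auto simp: formula_in_def sat_tuple_def)
  \<comment> \<open>The map sending each entry of \<open>xs\<close> to the entry of \<open>ys\<close> at the same position. It does not
    depend on the chosen position, because the two tuples have the same equalities.\<close>
  define f where "f x = ys ! (SOME i. i < n \<and> xs ! i = x)" for x
  have f: "f (xs ! i) = ys ! i" if "i < n" for i
  proof -
    have "(SOME j. j < n \<and> xs ! j = xs ! i) < n \<and> xs ! (SOME j. j < n \<and> xs ! j = xs ! i) = xs ! i"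
      by (rule someI[of _ i]) (simp add: that)
    then show ?thesis using E that by (auto simp: f_def)
  qed
  have map_f: "map f xs = ys"
    using f len by (auto intro: nth_equalityI)
  have "struct_iso S (substructure X (set xs)) (substructure X (set ys)) f"
    unfolding struct_iso_def
  proof (intro conjI ballI)
    have "inj_on f (set xs)"
      using f E len by (auto simp: inj_on_def in_set_conv_nth)
    moreover have "f ` set xs = set ys" using map_f by auto
    ultimately show "bij_betw f (universe (substructure X (set xs))) (universe (substructure X (set ys)))"
      by (simp add: bij_betw_def substructure_def)
    fix r zs assume r: "r \<in> symbols S"
      and "zs \<in> tuples (universe (substructure X (set xs))) (arity S r)"
    then have zs: "length zs = arity S r" "set zs \<subseteq> set xs"
      by (auto simp: tuples_def substructure_def)
    then have "\<exists>i<n. z = xs ! i" if "z \<in> set zs" for z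
      using that len by (metis in_set_conv_nth subsetD)
    then obtain k where k: "\<And>z. z \<in> set zs \<Longrightarrow> k z < n \<and> z = xs ! k z" by metis
    let ?is = "map k zs"
    have "map ((!) xs) ?is = zs" using k by (auto intro!: map_idI)
    moreover have "map ((!) ys) ?is = map f zs" using k f by force
    moreover have "formula_in S n (Rel r ?is)"
      using r zs k by (auto simp: formula_in_def)
    ultimately have "zs \<in> rels X r \<longleftrightarrow> map f zs \<in> rels X r"
      using eq[of "Rel r ?is"] by (simp add: sat_tuple_def del: map_eq_conv map_map)
    moreover have "set (map f zs) \<subseteq> set ys" using map_f zs by auto
    ultimately show "zs \<in> rels (substructure X (set xs)) r \<longleftrightarrow> map f zs \<in> rels (substructure X (set ys)) r"
      using zs by (auto simp: substructure_def)
  qed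
  then obtain g where "g \<in> Aut S X" "\<forall>a\<in>set xs. g a = f a"
    using hom sub unfolding homogeneous_def by (metis List.finite_set)
  then show ?thesis using map_f by (auto intro!: bexI[of _ g])
qed


section \<open>Compactness from \<open>\<omega>\<close>-categoricity\<close>

lemma struct_iso_comp:
  assumes f: "struct_iso S X Y f" and g: "struct_iso S Y Z g"
  shows "struct_iso S X Z (g \<circ> f)"
  unfolding struct_iso_def
proof (intro conjI ballI)
  show "bij_betw (g \<circ> f) (universe X) (universe Z)"
    using assms by (auto simp: struct_iso_def intro: bij_betw_trans)
  fix r xs assume r: "r \<in> symbols S" and xs: "xs \<in> tuples (universe X) (arity S r)"
  then have "map f xs \<in> tuples (universe Y) (arity S r)"
    using f by (auto simp: tuples_def struct_iso_def bij_betw_def)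
  then have "map f xs \<in> rels Y r \<longleftrightarrow> map g (map f xs) \<in> rels Z r"
    using g r unfolding struct_iso_def by blast
  moreover have "xs \<in> rels X r \<longleftrightarrow> map f xs \<in> rels Y r"
    using f r xs unfolding struct_iso_def by blast
  ultimately show "xs \<in> rels X r \<longleftrightarrow> map (g \<circ> f) xs \<in> rels Z r" by simp
qed

lemma struct_iso_inv:
  assumes f: "struct_iso S X Y f"
  shows "struct_iso S Y X (inv_into (universe X) f)" (is "struct_iso S Y X ?g")
  unfolding struct_iso_def
proof (intro conjI ballI)
  have bij: "bij_betw f (universe X) (universe Y)" using f by (simp add: struct_iso_def)
  show "bij_betw ?g (universe Y) (universe X)"
    using bij by (rule bij_betw_inv_into)
  fix r xs assume r: "r \<in> symbols S" and xs: "xs \<in> tuples (universe Y) (arity S r)"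
  then have "map ?g xs \<in> tuples (universe X) (arity S r)"
    using bij by (auto simp: tuples_def bij_betw_def inv_into_into)
  moreover have "map f (map ?g xs) = xs"
    using xs bij by (auto simp: tuples_def bij_betw_inv_into_right intro!: map_idI)
  ultimately show "xs \<in> rels Y r \<longleftrightarrow> map ?g xs \<in> rels X r"
    using f r unfolding struct_iso_def by metis
qed

text \<open>
The definition of \<open>\<omega>\<close>-categoricity speaks of models on the natural numbers only; countable
models on any type are transported there.
\<close>

lemma omega_categorical_iso:
  fixes Y :: "('r, 'b) rel_structure"
  assumes X: "omega_categorical S X" and Y: "relational_structure S Y" "countable (universe Y)"
    and th: "\<And>\<phi>. \<phi> \<in> first_order_theory S X \<Longrightarrow> holds Y \<phi>"
  shows "\<exists>f. struct_iso S X Y f"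
proof -
  let ?c = "to_nat_on (universe Y)"
  define Z :: "('r, nat) rel_structure"
    where "Z = \<lparr>universe = ?c ` universe Y, rels = (\<lambda>r. map ?c ` rels Y r)\<rparr>"
  have inj: "inj_on ?c (universe Y)" using Y(2) by (rule inj_on_to_nat_on)
  have relY: "rels Y r \<subseteq> tuples (universe Y) (arity S r)" if "r \<in> symbols S" for r
    using Y(1) that by (auto simp: relational_structure_def)
  have iso: "struct_iso S Y Z ?c"
    unfolding struct_iso_def
  proof (intro conjI ballI)
    show "bij_betw ?c (universe Y) (universe Z)" using inj by (simp add: bij_betw_def Z_def)
    fix r xs assume r: "r \<in> symbols S" and xs: "xs \<in> tuples (universe Y) (arity S r)"
    have "xs = ys" if "map ?c xs = map ?c ys" "ys \<in> rels Y r" for ys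
    proof (rule map_inj_on[OF that(1)])
      have "set ys \<subseteq> universe Y" using relY[OF r] that(2) by (auto simp: tuples_def)
      then show "inj_on ?c (set xs \<union> set ys)"
        using xs inj by (auto simp: tuples_def intro: inj_on_subset)
    qed
    then show "xs \<in> rels Y r \<longleftrightarrow> map ?c xs \<in> rels Z r" by (auto simp: Z_def simp del: map_eq_conv)
  qed
  have "relational_structure S Z"
    using Y(1) relY by (fastforce simp: relational_structure_def Z_def tuples_def)
  moreover have "holds Z \<phi>" if \<phi>: "\<phi> \<in> first_order_theory S X" for \<phi>
    unfolding holds_def
  proof (intro allI impI)
    fix v :: "nat \<Rightarrow> nat" assume v: "range v \<subseteq> universe Z"
    define w where "w i = inv_into (universe Y) ?c (v i)" for i
    have w: "w i \<in> universe Y" "?c (w i) = v i" for i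
    proof -
      have "v i \<in> ?c ` universe Y" using v by (auto simp: Z_def)
      then show "w i \<in> universe Y" "?c (w i) = v i"
        unfolding w_def by (rule inv_into_into, rule f_inv_into_f)
    qed
    have "sat Z (\<lambda>i. ?c (w i)) \<phi> = sat Y w \<phi>"
      using \<phi> w(1) by (intro sat_struct_iso[OF iso]) (auto simp: first_order_theory_def sentence_def)
    moreover have "sat Y w \<phi>" using th[OF \<phi>] w(1) by (auto simp: holds_def)
    ultimately show "sat Z v \<phi>" by (simp add: w(2))
  qed
  ultimately obtain f where "struct_iso S X Z f"
    using X unfolding omega_categorical_def by blast
  then show ?thesis using struct_iso_comp struct_iso_inv[OF iso] by blast
qed

text \<open>
The closure of a countable set under countably many finitary operations; applied below to Skolem
functions.
\<close>

lemma countable_closure: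
  assumes C0: "countable C0" "C0 \<subseteq> A" and P: "countable P"
    and cl: "\<And>p xs. \<lbrakk>p \<in> P; xs \<in> lists A\<rbrakk> \<Longrightarrow> f p xs \<in> A"
  shows "\<exists>C. C0 \<subseteq> C \<and> C \<subseteq> A \<and> countable C \<and> (\<forall>p\<in>P. \<forall>xs\<in>lists C. f p xs \<in> C)"
proof -
  define F where "F = rec_nat C0 (\<lambda>_ C. C \<union> (\<lambda>(p, xs). f p xs) ` (P \<times> lists C))"
  have F0: "F 0 = C0" and FS: "F (Suc n) = F n \<union> (\<lambda>(p, xs). f p xs) ` (P \<times> lists (F n))" for n
    by (simp_all add: F_def)
  have mono: "F m \<subseteq> F n" if "m \<le> n" for m n
    using that by (rule lift_Suc_mono_le[rotated]) (simp add: FS)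
  have A: "F n \<subseteq> A" for n
  proof (induction n)
    case (Suc n)
    then have "f p xs \<in> A" if "p \<in> P" "xs \<in> lists (F n)" for p xs
      using that by (intro cl) auto
    then show ?case using Suc by (auto simp: FS)
  qed (simp add: F0 C0)
  have count: "countable (F n)" for n
    by (induction n) (auto simp: F0 FS C0 P intro!: countable_Un countable_image countable_SIGMA)
  have "f p xs \<in> \<Union>(range F)" if p: "p \<in> P" and xs: "xs \<in> lists (\<Union>(range F))" for p xs
  proof -
    have "\<exists>n. xs \<in> lists (F n)" using xs
    proof (induction xs)
      case (Cons x xs)
      then obtain m n where "x \<in> F m" "xs \<in> lists (F n)" by auto
      moreover have "F m \<subseteq> F (max m n)" "F n \<subseteq> F (max m n)" by (auto intro!: mono)
      ultimately have "x # xs \<in> lists (F (max m n))" by auto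
      then show ?case by blast
    qed auto
    then obtain n where "xs \<in> lists (F n)" ..
    then have "f p xs \<in> F (Suc n)" using p by (auto simp: FS)
    then show ?thesis by blast
  qed
  then show ?thesis
    using F0 A count by (intro exI[of _ "\<Union>(range F)"]) auto
qed

text \<open>
For countably many statements about natural numbers, a subsequence along which each of them is
eventually true or eventually false does the work of an ultrafilter.
\<close>

lemma eventually_decided_subsequence:
  fixes Q :: "'i \<Rightarrow> nat \<Rightarrow> bool"
  assumes "countable I"
  shows "\<exists>k. strict_mono k \<and>
    (\<forall>i\<in>I. (\<forall>\<^sub>F j in sequentially. Q i (k j)) \<or> (\<forall>\<^sub>F j in sequentially. \<not> Q i (k j)))"
proof -
  define R where "R n s \<longleftrightarrow> (\<forall>\<^sub>F j in sequentially. Q (from_nat_into I n) (s j)) \<or>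
      (\<forall>\<^sub>F j in sequentially. \<not> Q (from_nat_into I n) (s j))" for n and s :: "nat \<Rightarrow> nat"
  have sub: "R n (s \<circ> r)" if "strict_mono r" "R n s" for r s n
    using that eventually_subseq[OF that(1)] by (fastforce simp: R_def)
  interpret subseqs R
  proof
    fix n and s :: "nat \<Rightarrow> nat" assume "strict_mono s"
    let ?q = "\<lambda>j. Q (from_nat_into I n) (s j)"
    show "\<exists>r'. strict_mono r' \<and> R n (s \<circ> r')"
    proof (cases "infinite {j. ?q j}")
      case True
      then show ?thesis
        using enumerate_in_set[OF True] strict_mono_enumerate[OF True]
        by (intro exI[of _ "enumerate {j. ?q j}"]) (auto simp: R_def)
    next
      case False
      then have "infinite {j. \<not> ?q j}"
        using finite_Collect_not by auto
      then show ?thesis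
        using enumerate_in_set[of "{j. \<not> ?q j}"] strict_mono_enumerate[of "{j. \<not> ?q j}"]
        by (intro exI[of _ "enumerate {j. \<not> ?q j}"]) (auto simp: R_def)
    qed
  qed
  have shift: "R n (s \<circ> ((+) (Suc m))) \<longleftrightarrow> R n s" for n m s
    unfolding R_def comp_def
    using eventually_sequentially_seg[of "\<lambda>j. Q (from_nat_into I n) (s j)" "Suc m"]
      eventually_sequentially_seg[of "\<lambda>j. \<not> Q (from_nat_into I n) (s j)" "Suc m"]
    by (simp add: add.commute)
  have R: "R n diagseq" for n
  proof -
    have "R n (diagseq \<circ> ((+) (Suc n)))"
      by (rule diagseq_holds) (rule sub)
    then show ?thesis by (simp only: shift)
  qed
  show ?thesis
  proof (intro exI conjI ballI)
    show "strict_mono diagseq" by (rule subseq_diagseq)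
    fix i assume "i \<in> I"
    then obtain n where "from_nat_into I n = i"
      using from_nat_into_surj[OF assms] by blast
    then show "(\<forall>\<^sub>F j in sequentially. Q i (diagseq j)) \<or> (\<forall>\<^sub>F j in sequentially. \<not> Q i (diagseq j))"
      using R[of n] by (simp add: R_def)
  qed
qed


text \<open>
A compactness theorem inside \<open>X\<close> itself: formulas which are finitely satisfiable in \<open>X\<close> are
simultaneously satisfied by a tuple of \<open>X\<close>. The witnesses \<open>xs k\<close> of the finite parts define
sequences of elements of \<open>X\<close>. A countable set \<open>C\<close> of sequences which contains them and is closed
under pointwise Skolem functions, taken modulo eventual equality along a suitable subsequence,
is a countable model \<open>Y\<close> of the theory of \<open>X\<close> in which all the formulas hold (the analogue \<open>los\<close>
of the theorem of Los on ultraproducts). By \<open>\<omega>\<close>-categoricity \<open>Y\<close> is isomorphic to \<open>X\<close>.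
\<close>

lemma omega_categorical_compactness:
  fixes X :: "('r, 'a) rel_structure" and \<Phi> :: "nat \<Rightarrow> 'r formula"
  assumes S: "countable (symbols S)" and X: "relational_structure S X" "omega_categorical S X"
    and \<Phi>: "\<And>k. formula_in S n (\<Phi> k)"
    and fin: "\<And>k. \<exists>xs\<in>tuples (universe X) n. \<forall>i\<le>k. sat_tuple X (\<Phi> i) xs"
  shows "\<exists>xs\<in>tuples (universe X) n. \<forall>i. sat_tuple X (\<Phi> i) xs"
proof -
  let ?U = "universe X"
  obtain xs where xs: "\<And>k. xs k \<in> tuples ?U n" "\<And>k i. i \<le> k \<Longrightarrow> sat_tuple X (\<Phi> i) (xs k)"
    using fin by metis
  obtain a0 where a0: "a0 \<in> ?U" using X(1) by (auto simp: relational_structure_def)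
  define coord where "coord i k = xs k ! i" for i k
  \<comment> \<open>A value of the Skolem function for the formula \<open>fst p\<close> and the quantified variable \<open>snd p\<close> at
    the index \<open>k\<close>, where the list \<open>fs\<close> of sequences interprets the other variables.\<close>
  define good where "good p fs k a \<longleftrightarrow> a \<in> ?U \<and>
    ((\<exists>a\<in>?U. sat X ((\<lambda>j. (fs ! j) k)(snd p := a)) (fst p)) \<longrightarrow>
      sat X ((\<lambda>j. (fs ! j) k)(snd p := a)) (fst p))"
    for p :: "'r formula \<times> nat" and fs :: "(nat \<Rightarrow> 'a) list" and k a
  define sk where "sk p fs k = (SOME a. good p fs k a)" for p fs k
  have sk: "good p fs k (sk p fs k)" for p fs k
  proof -
    have "\<exists>a. good p fs k a" using a0 by (auto simp: good_def)
    then show ?thesis unfolding sk_def by (rule someI_ex)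
  qed
  \<comment> \<open>The constant sequence keeps the model non-empty when \<open>n = 0\<close>.\<close>
  let ?F = "{\<phi>. formula_over S \<phi>}" and ?C0 = "insert (\<lambda>_. a0) (coord ` {..<n})"
  have "countable ?C0" by simp
  moreover have "?C0 \<subseteq> {f. range f \<subseteq> ?U}"
  proof -
    have "coord i k \<in> ?U" if "i < n" for i k
      using xs(1)[of k] that nth_mem[of i "xs k"] by (auto simp: coord_def tuples_def)
    then show ?thesis using a0 by auto
  qed
  moreover have "countable (?F \<times> (UNIV :: nat set))"
    using countable_formulas[OF S] by auto
  moreover have "sk p fs \<in> {f. range f \<subseteq> ?U}" for p fs
    using sk[of p fs] unfolding good_def by blast
  ultimately have "\<exists>C. ?C0 \<subseteq> C \<and> C \<subseteq> {f. range f \<subseteq> ?U} \<and> countable C \<and>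
      (\<forall>p\<in>?F \<times> UNIV. \<forall>fs\<in>lists C. sk p fs \<in> C)"
    by (rule countable_closure)
  then obtain C where C: "?C0 \<subseteq> C" "C \<subseteq> {f. range f \<subseteq> ?U}" "countable C"
    "\<And>p fs. \<lbrakk>p \<in> ?F \<times> UNIV; fs \<in> lists C\<rbrakk> \<Longrightarrow> sk p fs \<in> C" by blast
  have CU: "f j \<in> ?U" if "f \<in> C" for f j using C(2) that by auto
  have "countable (?F \<times> lists C)"
    using countable_formulas[OF S] C(3) by auto
  from eventually_decided_subsequence[OF this, of "\<lambda>(\<phi>, fs) j. sat X (\<lambda>i. (fs ! i) j) \<phi>"]
  obtain k where k: "strict_mono k" and dec: "\<And>\<phi> fs. \<lbrakk>formula_over S \<phi>; fs \<in> lists C\<rbrakk> \<Longrightarrow>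
      (\<forall>\<^sub>F j in sequentially. sat X (\<lambda>i. (fs ! i) (k j)) \<phi>) \<or>
      (\<forall>\<^sub>F j in sequentially. \<not> sat X (\<lambda>i. (fs ! i) (k j)) \<phi>)"
    by fastforce
  have listed: "\<exists>fs\<in>lists C. \<forall>i\<in>free_vars \<phi>. fs ! i = v i"
    if "\<And>i. v i \<in> C" for v and \<phi> :: "'r formula"
  proof -
    obtain N where N: "\<And>i. i \<in> free_vars \<phi> \<Longrightarrow> i < N"
      using finite_free_vars[of \<phi>] unfolding finite_nat_set_iff_bounded by blast
    show ?thesis using N that by (intro bexI[of _ "map v [0..<N]"]) auto
  qed
  have decided: "(\<forall>\<^sub>F j in sequentially. \<not> sat X (\<lambda>i. v i (k j)) \<phi>) \<longleftrightarrow>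
      \<not> (\<forall>\<^sub>F j in sequentially. sat X (\<lambda>i. v i (k j)) \<phi>)"
    if \<phi>: "formula_over S \<phi>" and v: "\<And>i. v i \<in> C" for \<phi> v
  proof -
    obtain fs where fs: "fs \<in> lists C" "\<forall>i\<in>free_vars \<phi>. fs ! i = v i" using listed v by blast
    have "sat X (\<lambda>i. (fs ! i) (k j)) \<phi> = sat X (\<lambda>i. v i (k j)) \<phi>" for j
      using fs(2) by (intro sat_cong) auto
    then have "(\<forall>\<^sub>F j in sequentially. sat X (\<lambda>i. v i (k j)) \<phi>) \<or>
      (\<forall>\<^sub>F j in sequentially. \<not> sat X (\<lambda>i. v i (k j)) \<phi>)"
      using dec[OF \<phi> fs(1)] by simp
    moreover have False if "\<forall>\<^sub>F j in sequentially. sat X (\<lambda>i. v i (k j)) \<phi>"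
      "\<forall>\<^sub>F j in sequentially. \<not> sat X (\<lambda>i. v i (k j)) \<phi>"
      using eventually_conj[OF that] by simp
    ultimately show ?thesis by blast
  qed
  have skolem: "\<exists>f\<in>C. \<forall>j. (\<exists>a\<in>?U. sat X ((\<lambda>l. v l j)(i := a)) \<phi>) \<longrightarrow>
      sat X ((\<lambda>l. v l j)(i := f j)) \<phi>"
    if \<phi>: "formula_over S \<phi>" and v: "\<And>i. v i \<in> C" for \<phi> v i
  proof -
    obtain fs where fs: "fs \<in> lists C" "\<forall>i\<in>free_vars \<phi>. fs ! i = v i" using listed v by blast
    have eq: "sat X ((\<lambda>l. (fs ! l) j)(i := a)) \<phi> = sat X ((\<lambda>l. v l j)(i := a)) \<phi>" for j a
      using fs(2) by (intro sat_cong) auto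
    have "sk (\<phi>, i) fs \<in> C" using C(4) \<phi> fs(1) by auto
    then show ?thesis
      using sk[of "(\<phi>, i)" fs] unfolding good_def fst_conv snd_conv eq by blast
  qed
  define sim where "sim f g \<longleftrightarrow> (\<forall>\<^sub>F j in sequentially. f (k j) = g (k j))" for f g :: "nat \<Rightarrow> 'a"
  have sim_refl: "sim f f" for f by (simp add: sim_def)
  have sim_sym: "sim f g \<longleftrightarrow> sim g f" for f g by (simp add: sim_def eq_commute)
  have sim_trans: "sim f h" if "sim f g" "sim g h" for f g h
    using that unfolding sim_def by eventually_elim simp
  define rep where "rep f = (SOME g. g \<in> C \<and> sim f g)" for f
  have rep: "rep f \<in> C" "sim f (rep f)" if "f \<in> C" for f
  proof -
    have "rep f \<in> C \<and> sim f (rep f)"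
      unfolding rep_def by (rule someI[of _ f]) (simp add: that sim_refl)
    then show "rep f \<in> C" "sim f (rep f)" by auto
  qed
  have rep_eq: "rep f = rep g" if "sim f g" for f g
  proof -
    have "sim f h \<longleftrightarrow> sim g h" for h
      using that sim_sym sim_trans by blast
    then show ?thesis by (simp add: rep_def)
  qed
  define Y :: "('r, nat \<Rightarrow> 'a) rel_structure" where
    "Y = \<lparr>universe = rep ` C,
      rels = (\<lambda>r. {fs \<in> tuples (rep ` C) (arity S r).
        \<forall>\<^sub>F j in sequentially. map (\<lambda>f. f (k j)) fs \<in> rels X r})\<rparr>"
  have univ: "universe Y = rep ` C" by (simp add: Y_def)
  have repC: "a \<in> C" if "a \<in> rep ` C" for a using that rep(1) by auto
  have los: "sat Y v \<phi> \<longleftrightarrow> (\<forall>\<^sub>F j in sequentially. sat X (\<lambda>i. v i (k j)) \<phi>)"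
    if "formula_over S \<phi>" "\<And>i. v i \<in> rep ` C" for \<phi> v
    using that
  proof (induction \<phi> arbitrary: v)
    case (Eq i j)
    obtain f g where fg: "f \<in> C" "v i = rep f" "g \<in> C" "v j = rep g"
      using Eq.prems(2) by (metis imageE)
    have "sim (v i) (v j) \<longleftrightarrow> v i = v j"
      using fg rep(2) rep_eq sim_refl sim_sym sim_trans by metis
    then show ?case by (simp add: sim_def)
  next
    case (Rel r js)
    then have "map v js \<in> tuples (rep ` C) (arity S r)" by (auto simp: tuples_def)
    then show ?case by (simp add: Y_def comp_def)
  next
    case (Neg \<phi>)
    then have IH: "sat Y v \<phi> \<longleftrightarrow> (\<forall>\<^sub>F j in sequentially. sat X (\<lambda>i. v i (k j)) \<phi>)" by simp
    show ?case unfolding sat.simps IH using Neg.prems repC by (intro decided[symmetric]) auto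
  next
    case (Conj \<phi> \<psi>)
    from Conj.IH(1)[of v] Conj.IH(2)[of v] Conj.prems show ?case by (simp add: eventually_conj_iff)
  next
    case (Exists i \<phi>)
    have upd: "(\<lambda>l. (v(i := a)) l (k j)) = (\<lambda>l. v l (k j))(i := a (k j))" for a j by auto
    have IH: "sat Y (v(i := a)) \<phi> \<longleftrightarrow>
        (\<forall>\<^sub>F j in sequentially. sat X ((\<lambda>l. v l (k j))(i := a (k j))) \<phi>)" if "a \<in> rep ` C" for a
    proof -
      have "sat Y (v(i := a)) \<phi> \<longleftrightarrow> (\<forall>\<^sub>F j in sequentially. sat X (\<lambda>l. (v(i := a)) l (k j)) \<phi>)"
        by (rule Exists.IH) (use Exists.prems that in auto)
      then show ?thesis unfolding upd .
    qed
    show ?case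
    proof
      assume "sat Y v (Exists i \<phi>)"
      then obtain a where a: "a \<in> rep ` C" "sat Y (v(i := a)) \<phi>" by (auto simp: univ)
      then have "\<forall>\<^sub>F j in sequentially. sat X ((\<lambda>l. v l (k j))(i := a (k j))) \<phi>"
        using IH by simp
      then show "\<forall>\<^sub>F j in sequentially. sat X (\<lambda>l. v l (k j)) (Exists i \<phi>)"
        using CU[OF repC[OF a(1)]] by (auto elim!: eventually_mono)
    next
      assume ev: "\<forall>\<^sub>F j in sequentially. sat X (\<lambda>l. v l (k j)) (Exists i \<phi>)"
      have "\<exists>f\<in>C. \<forall>j. (\<exists>a\<in>?U. sat X ((\<lambda>l. v l j)(i := a)) \<phi>) \<longrightarrow> sat X ((\<lambda>l. v l j)(i := f j)) \<phi>"
        using Exists.prems repC by (intro skolem) auto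
      then obtain f where f: "f \<in> C"
        "\<forall>j. (\<exists>a\<in>?U. sat X ((\<lambda>l. v l j)(i := a)) \<phi>) \<longrightarrow> sat X ((\<lambda>l. v l j)(i := f j)) \<phi>"
        by blast
      from ev have "\<forall>\<^sub>F j in sequentially. sat X ((\<lambda>l. v l (k j))(i := f (k j))) \<phi>"
        using f(2) by (auto elim!: eventually_mono)
      moreover have "\<forall>\<^sub>F j in sequentially. f (k j) = rep f (k j)"
        using rep(2)[OF f(1)] by (simp add: sim_def)
      ultimately have "\<forall>\<^sub>F j in sequentially. sat X ((\<lambda>l. v l (k j))(i := rep f (k j))) \<phi>"
        by eventually_elim simp
      then have "sat Y (v(i := rep f)) \<phi>" using IH f(1) by simp
      then show "sat Y v (Exists i \<phi>)" using f(1) by (auto simp: univ)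
    qed
  qed
  have "rep (\<lambda>_. a0) \<in> rep ` C" using C(1) by auto
  then have relY: "relational_structure S Y" by (auto simp: relational_structure_def Y_def)
  have countY: "countable (universe Y)" using C(3) by (simp add: univ)
  have thY: "holds Y \<phi>" if \<phi>: "\<phi> \<in> first_order_theory S X" for \<phi>
    unfolding holds_def
  proof (intro allI impI)
    fix v :: "nat \<Rightarrow> nat \<Rightarrow> 'a" assume "range v \<subseteq> universe Y"
    then have v: "v i \<in> rep ` C" for i by (auto simp: univ)
    have "range (\<lambda>i. v i j) \<subseteq> ?U" for j using CU repC v by auto
    then have "sat X (\<lambda>i. v i (k j)) \<phi>" for j
      using \<phi> by (simp add: first_order_theory_def holds_def)
    then show "sat Y v \<phi>" using los \<phi> v by (simp add: first_order_theory_def sentence_def)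
  qed
  obtain f where "struct_iso S X Y f"
    using omega_categorical_iso[OF X(2) relY countY thY] by blast
  then obtain g where g: "struct_iso S Y X g" using struct_iso_inv by blast
  define ys where "ys = map (\<lambda>i. rep (coord i)) [0..<n]"
  have coordC: "coord i \<in> C" if "i < n" for i using C(1) that by auto
  then have ys: "ys \<in> tuples (universe Y) n" by (auto simp: ys_def tuples_def univ)
  have "sat_tuple Y (\<Phi> m) ys" for m
  proof -
    \<comment> \<open>Truth of formulas in \<open>Y\<close> was computed for total assignments, so the tuple \<open>ys\<close> is extended.\<close>
    define v where "v i = (if i < n then rep (coord i) else rep (\<lambda>_. a0))" for i
    have v: "v i \<in> rep ` C" for i using C(1) by (auto simp: v_def)
    have fv: "i < n" if "i \<in> free_vars (\<Phi> m)" for i using \<Phi>[of m] that by (auto simp: formula_in_def)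
    have "\<forall>\<^sub>F j in sequentially. \<forall>i\<in>{..<n}. coord i (k j) = rep (coord i) (k j)"
      using rep(2) C(1) by (intro eventually_ball_finite) (auto simp: sim_def)
    moreover have "\<forall>\<^sub>F j in sequentially. m \<le> k j"
      using filterlim_subseq[OF k] by (simp add: filterlim_at_top)
    ultimately have "\<forall>\<^sub>F j in sequentially. sat X (\<lambda>i. v i (k j)) (\<Phi> m)"
    proof eventually_elim
      case (elim j)
      have "sat X (\<lambda>i. xs (k j) ! i) (\<Phi> m)" using xs(2)[OF elim(2)] by (simp add: sat_tuple_def)
      also have "?this \<longleftrightarrow> ?case"
        using elim(1) fv by (intro sat_cong) (auto simp: v_def coord_def)
      finally show ?case .
    qed
    then have "sat Y v (\<Phi> m)" using los \<Phi>[of m] v by (simp add: formula_in_def)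
    also have "?this \<longleftrightarrow> sat Y (\<lambda>i. ys ! i) (\<Phi> m)"
      using fv by (intro sat_cong) (simp add: v_def ys_def)
    finally show ?thesis by (simp add: sat_tuple_def)
  qed
  then have "sat_tuple X (\<Phi> m) (map g ys)" for m
    using sat_tuple_struct_iso[OF g \<Phi> ys] by simp
  moreover have "map g ys \<in> tuples ?U n"
    using ys g by (auto simp: tuples_def struct_iso_def bij_betw_def)
  ultimately show ?thesis by blast
qed


section \<open>Finitely many orbits\<close>

text \<open>
In a homogeneous structure two tuples of the same type lie in one orbit, so this is the usual
notion of a formula isolating the type of a tuple.
\<close>

definition isolates :: "'r signature \<Rightarrow> ('r, 'a) rel_structure \<Rightarrow> 'r formula \<Rightarrow> 'a list \<Rightarrow> bool" where
  "isolates S X \<theta> xs \<longleftrightarrow> xs \<in> tuples (universe X) (length xs) \<and> formula_in S (length xs) \<theta> \<and>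
     sat_tuple X \<theta> xs \<and>
     (\<forall>ys\<in>tuples (universe X) (length xs). sat_tuple X \<theta> ys \<longrightarrow> (\<exists>g\<in>Aut S X. ys = map g xs))"

definition isolated :: "'r signature \<Rightarrow> ('r, 'a) rel_structure \<Rightarrow> 'a list \<Rightarrow> bool" where
  "isolated S X xs \<longleftrightarrow> (\<exists>\<theta>. isolates S X \<theta> xs)"

text \<open>
The orbit of a tuple of entries of \<open>zs\<close> is a projection of the orbit of \<open>zs\<close>, so it is defined
by quantifying existentially over \<open>zs\<close>.
\<close>

lemma isolated_subtuple:
  assumes iso: "isolated S X zs" and sub: "set ds \<subseteq> set zs" and ne: "universe X \<noteq> {}"
  shows "isolated S X ds"
proof -
  let ?N = "length zs" and ?m = "length ds"
  obtain \<theta> where \<theta>: "isolates S X \<theta> zs" using iso by (auto simp: isolated_def)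
  then have zs: "zs \<in> tuples (universe X) ?N" and \<theta>1: "formula_over S \<theta>" "free_vars \<theta> \<subseteq> {..<?N}"
    by (auto simp: isolates_def formula_in_def)
  have "\<exists>i<?N. ds ! j = zs ! i" if "j < ?m" for j
    using that sub by (metis in_set_conv_nth nth_mem subsetD)
  then obtain \<rho> where \<rho>: "\<And>j. j < ?m \<Longrightarrow> \<rho> j < ?N \<and> ds ! j = zs ! \<rho> j" by metis
  obtain \<psi> where \<psi>: "formula_over S \<psi>" "free_vars \<psi> \<subseteq> (\<lambda>i. ?m + i) ` free_vars \<theta>"
    "\<And>v. sat X v \<psi> = sat X (\<lambda>i. v (?m + i)) \<theta>"
    using substitution_exists[OF \<theta>1(1)] by metis
  \<comment> \<open>The variables from \<open>?m\<close> on stand for a conjugate of \<open>zs\<close>, the first \<open>?m\<close> ones for the entries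
    of it which are selected by \<open>\<rho>\<close>.\<close>
  define \<kappa> where "\<kappa> = exs [?m..<?m + ?N] (conjs (\<psi> # map (\<lambda>j. Eq j (?m + \<rho> j)) [0..<?m]))"
  have form: "formula_in S ?m \<kappa>"
  proof -
    have "free_vars \<psi> \<subseteq> {?m..<?m + ?N}" using \<psi>(2) \<theta>1(2) by (auto dest!: subsetD)
    then have "free_vars \<kappa> \<subseteq> {..<?m}"
      using \<rho> by (auto simp: \<kappa>_def free_vars_conjs dest!: subsetD)
    then show ?thesis
      using \<psi>(1) by (auto simp: formula_in_def \<kappa>_def formula_over_conjs)
  qed
  have sat: "sat_tuple X \<kappa> ys \<longleftrightarrow> (\<exists>ws\<in>tuples (universe X) ?N. sat_tuple X \<theta> ws \<and> (\<forall>j<?m. ys ! j = ws ! \<rho> j))"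
    for ys
  proof
    assume "sat_tuple X \<kappa> ys"
    then obtain w where w: "\<forall>i\<in>{?m..<?m + ?N}. w i \<in> universe X"
      "\<forall>i. i \<notin> {?m..<?m + ?N} \<longrightarrow> w i = ys ! i" "sat X w \<psi>" "\<forall>j<?m. w j = w (?m + \<rho> j)"
      unfolding sat_tuple_def \<kappa>_def sat_exs sat_conjs[OF ne] by auto
    let ?ws = "map (\<lambda>i. w (?m + i)) [0..<?N]"
    have "sat X (\<lambda>i. ?ws ! i) \<theta> = sat X (\<lambda>i. w (?m + i)) \<theta>"
      using \<theta>1(2) by (intro sat_cong) auto
    then have "sat_tuple X \<theta> ?ws" using w(3) by (simp add: \<psi>(3) sat_tuple_def)
    moreover have "?ws \<in> tuples (universe X) ?N" using w(1) by (auto simp: tuples_def)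
    moreover have "ys ! j = ?ws ! \<rho> j" if "j < ?m" for j
      using w(2)[rule_format, of j] w(4) \<rho>[OF that] that by auto
    ultimately show "\<exists>ws\<in>tuples (universe X) ?N. sat_tuple X \<theta> ws \<and> (\<forall>j<?m. ys ! j = ws ! \<rho> j)"
      by blast
  next
    assume "\<exists>ws\<in>tuples (universe X) ?N. sat_tuple X \<theta> ws \<and> (\<forall>j<?m. ys ! j = ws ! \<rho> j)"
    then obtain ws where ws: "ws \<in> tuples (universe X) ?N" "sat_tuple X \<theta> ws" "\<forall>j<?m. ys ! j = ws ! \<rho> j"
      by blast
    define w where "w i = (if ?m \<le> i \<and> i < ?m + ?N then ws ! (i - ?m) else ys ! i)" for i
    have "sat X (\<lambda>i. w (?m + i)) \<theta> = sat X (\<lambda>i. ws ! i) \<theta>"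
      using \<theta>1(2) by (intro sat_cong) (auto simp: w_def)
    then have "sat X w \<psi>" using ws(2) by (simp add: \<psi>(3) sat_tuple_def)
    moreover have "w i \<in> universe X" if "i \<in> {?m..<?m + ?N}" for i
      using that ws(1) by (auto simp: w_def tuples_def subset_iff)
    moreover have "w j = w (?m + \<rho> j)" if "j < ?m" for j
      using that ws(3) \<rho>[OF that] by (simp add: w_def)
    moreover have "w i = ys ! i" if "i \<notin> set [?m..<?m + ?N]" for i
      using that by (auto simp: w_def)
    ultimately show "sat_tuple X \<kappa> ys"
      unfolding sat_tuple_def \<kappa>_def sat_exs sat_conjs[OF ne]
      by (intro exI[of _ w] conjI) (simp_all del: upt_Suc)
  qed
  have "isolates S X \<kappa> ds"
    unfolding isolates_def
  proof (intro conjI ballI impI form)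
    show "ds \<in> tuples (universe X) ?m" using sub zs by (auto simp: tuples_def)
    show "sat_tuple X \<kappa> ds" unfolding sat using \<theta> zs \<rho> by (auto simp: isolates_def)
    fix ys assume ys: "ys \<in> tuples (universe X) ?m" "sat_tuple X \<kappa> ys"
    then obtain ws where ws: "ws \<in> tuples (universe X) ?N" "sat_tuple X \<theta> ws" "\<forall>j<?m. ys ! j = ws ! \<rho> j"
      unfolding sat by blast
    then obtain g where g: "g \<in> Aut S X" "ws = map g zs" using \<theta> by (auto simp: isolates_def)
    have "ys = map g ds"
      using ys(1) ws(3) g(2) \<rho> by (intro nth_equalityI) (auto simp: tuples_def)
    then show "\<exists>g\<in>Aut S X. ys = map g ds" using g(1) by blast
  qed
  then show ?thesis by (auto simp: isolated_def)
qed

locale countably_categorical =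
  fixes S :: "'r signature" and X :: "('r, 'a) rel_structure"
  assumes S: "countable (symbols S)" and U: "countable (universe X)"
    and rel: "relational_structure S X" and cat: "omega_categorical S X" and hom: "homogeneous S X"
begin

lemma ne: "universe X \<noteq> {}"
  using rel by (simp add: relational_structure_def)

lemma countable_tuples: "countable (tuples (universe X) n)"
proof -
  have "tuples (universe X) n \<subseteq> lists (universe X)" by (auto simp: tuples_def)
  then show ?thesis using U countable_lists countable_subset by blast
qed

text \<open>
If no tuple satisfying \<open>\<phi>\<close> were isolated, then every satisfiable formula implying \<open>\<phi>\<close> would be
satisfied on two different orbits, which a formula separates; one of the two halves avoids a
prescribed tuple. Going through all tuples, which are countably many, produces finitely
satisfiable formulas that no tuple satisfies together, against compactness.
\<close>

lemma isolated_dense: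
  assumes \<phi>: "formula_in S n \<phi>" and sat: "xs \<in> tuples (universe X) n" "sat_tuple X \<phi> xs"
  shows "\<exists>ys\<in>tuples (universe X) n. sat_tuple X \<phi> ys \<and> isolated S X ys"
proof (rule ccontr)
  assume no: "\<not> ?thesis"
  define good where "good \<psi> \<longleftrightarrow> formula_in S n \<psi> \<and>
    (\<exists>ys\<in>tuples (universe X) n. sat_tuple X \<psi> ys) \<and>
    (\<forall>ys\<in>tuples (universe X) n. sat_tuple X \<psi> ys \<longrightarrow> sat_tuple X \<phi> ys)" for \<psi>
  define step where "step zs \<psi> \<psi>' \<longleftrightarrow> (\<forall>ys\<in>tuples (universe X) n. sat_tuple X \<psi>' ys \<longrightarrow> sat_tuple X \<psi> ys) \<and>
      \<not> sat_tuple X \<psi>' zs" for zs \<psi> \<psi>'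
  have refine: "\<exists>\<psi>'. good \<psi>' \<and> step zs \<psi> \<psi>'"
    if g: "good \<psi>" and zs: "zs \<in> tuples (universe X) n" for \<psi> zs
  proof -
    obtain ys where ys: "ys \<in> tuples (universe X) n" "sat_tuple X \<psi> ys"
      using g by (auto simp: good_def)
    have "\<not> isolates S X \<psi> ys"
      using no ys g by (auto simp: isolated_def good_def)
    then obtain ys' where ys': "ys' \<in> tuples (universe X) n" "sat_tuple X \<psi> ys'"
      "\<And>g. g \<in> Aut S X \<Longrightarrow> ys' \<noteq> map g ys"
      using ys g unfolding isolates_def good_def tuples_def by auto
    then obtain \<kappa> where \<kappa>: "formula_in S n \<kappa>" "sat_tuple X \<kappa> ys \<noteq> sat_tuple X \<kappa> ys'"
      using same_orbit[OF hom ys(1) ys'(1)] by blast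
    define \<psi>' where "\<psi>' = Conj \<psi> (if sat_tuple X \<kappa> zs then Neg \<kappa> else \<kappa>)"
    have "formula_in S n \<psi>'"
      using \<kappa>(1) g by (auto simp: formula_in_def \<psi>'_def good_def)
    moreover have "sat_tuple X \<psi>' ys \<or> sat_tuple X \<psi>' ys'"
      using \<kappa>(2) ys ys' by (auto simp: \<psi>'_def sat_tuple_def)
    moreover have "step zs \<psi> \<psi>'"
      by (auto simp: step_def \<psi>'_def sat_tuple_def)
    ultimately show ?thesis
      using g ys ys' by (intro exI[of _ \<psi>']) (auto simp: good_def step_def)
  qed
  define e where "e = from_nat_into (tuples (universe X) n)"
  have e: "e k \<in> tuples (universe X) n" for k
    using from_nat_into[of "tuples (universe X) n"] sat(1) by (auto simp: e_def)
  have "\<exists>f. \<forall>k. good (f k) \<and> step (e k) (f k) (f (Suc k))"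
  proof (rule dependent_nat_choice)
    show "\<exists>\<psi>. good \<psi>" using \<phi> sat by (auto simp: good_def)
    show "\<exists>\<psi>'. good \<psi>' \<and> step (e k) \<psi> \<psi>'" if "good \<psi>" for \<psi> k
      using refine that e by blast
  qed
  then obtain f where f: "\<And>k. good (f k)" "\<And>k. step (e k) (f k) (f (Suc k))" by blast
  have "\<exists>ys\<in>tuples (universe X) n. \<forall>i. sat_tuple X (f i) ys"
  proof (rule omega_categorical_compactness[OF S rel cat])
    show "formula_in S n (f k)" for k using f(1)[of k] by (simp add: good_def)
    fix k
    obtain ys where ys: "ys \<in> tuples (universe X) n" "sat_tuple X (f k) ys"
      using f(1)[of k] by (auto simp: good_def)
    have "sat_tuple X (f i) ys" if "i \<le> k" for i
      using that
    proof (induction i rule: inc_induct)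
      case (step i)
      then show ?case using f(2)[of i] ys(1) by (auto simp: step_def)
    qed (rule ys)
    then show "\<exists>ys\<in>tuples (universe X) n. \<forall>i\<le>k. sat_tuple X (f i) ys" using ys(1) by blast
  qed
  then obtain ys where ys: "ys \<in> tuples (universe X) n" "\<And>i. sat_tuple X (f i) ys" by blast
  obtain k where "e k = ys"
    using from_nat_into_surj[OF countable_tuples ys(1)] by (auto simp: e_def)
  then show False using f(2)[of k] ys(2)[of "Suc k"] by (auto simp: step_def)
qed

text \<open>
Isolated tuples can be prolonged by a witness of a given existential statement such that the
result is isolated again. A solution exists up to an automorphism by density; the automorphism
is undone at the end.
\<close>

lemma isolated_extension:
  assumes iso: "isolated S X cs" and \<phi>: "formula_over S \<phi>" and v: "\<And>j. j \<in> free_vars \<phi> - {i} \<Longrightarrow> v j \<in> set cs"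
    and sat: "a \<in> universe X" "sat X (v(i := a)) \<phi>"
  shows "\<exists>b\<in>universe X. sat X (v(i := b)) \<phi> \<and> isolated S X (cs @ [b])"
proof -
  let ?n = "length cs"
  obtain \<theta> where \<theta>: "isolates S X \<theta> cs" using iso by (auto simp: isolated_def)
  then have cs: "cs \<in> tuples (universe X) ?n" and \<theta>1: "formula_in S ?n \<theta>"
    by (auto simp: isolates_def)
  have "\<exists>k<?n. v j = cs ! k" if "j \<in> free_vars \<phi> - {i}" for j
    using v[OF that] by (metis in_set_conv_nth)
  then obtain \<rho> where \<rho>: "\<And>j. j \<in> free_vars \<phi> - {i} \<Longrightarrow> \<rho> j < ?n \<and> v j = cs ! \<rho> j" by metis
  obtain \<psi> where \<psi>: "formula_over S \<psi>" "free_vars \<psi> \<subseteq> (\<rho>(i := ?n)) ` free_vars \<phi>"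
    "\<And>v. sat X v \<psi> = sat X (\<lambda>j. v ((\<rho>(i := ?n)) j)) \<phi>"
    using substitution_exists[OF \<phi>] by metis
  have *: "sat_tuple X \<psi> (cs @ [b]) = sat X (v(i := b)) \<phi>" for b
    unfolding sat_tuple_def \<psi>(3) using \<rho> by (intro sat_cong) (auto simp: nth_append)
  have "free_vars \<psi> \<subseteq> {..<Suc ?n}"
  proof
    fix k assume "k \<in> free_vars \<psi>"
    then obtain j where "j \<in> free_vars \<phi>" "k = (\<rho>(i := ?n)) j" using \<psi>(2) by blast
    then show "k \<in> {..<Suc ?n}" using \<rho>[of j] by (cases "j = i") auto
  qed
  then have \<psi>1: "formula_in S (Suc ?n) (Conj \<theta> \<psi>)"
    using \<psi>(1) \<theta>1 by (auto simp: formula_in_def)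
  have "sat_tuple X (Conj \<theta> \<psi>) (cs @ [a])"
    using sat(2) \<theta> *[of a] sat_tuple_append[OF \<theta>1, of cs X "[a]"]
    by (simp add: sat_tuple_def isolates_def)
  moreover have "cs @ [a] \<in> tuples (universe X) (Suc ?n)" using cs sat(1) by (auto simp: tuples_def)
  ultimately obtain ys where ys: "ys \<in> tuples (universe X) (Suc ?n)" "sat_tuple X (Conj \<theta> \<psi>) ys" "isolated S X ys"
    using isolated_dense[OF \<psi>1] by blast
  then obtain ds d where ds: "ys = ds @ [d]" "length ds = ?n" "ds \<in> tuples (universe X) ?n" "d \<in> universe X"
    by (cases ys rule: rev_cases) (auto simp: tuples_def)
  have "sat_tuple X \<theta> ds"
    using ys(2) sat_tuple_append[OF \<theta>1 ds(2), of X "[d]"] by (simp add: ds(1) sat_tuple_def)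
  then obtain g where g: "g \<in> Aut S X" "ds = map g cs" using \<theta> ds(3) by (auto simp: isolates_def)
  define h where "h = inv\<^bsub>aut_group S X\<^esub> g"
  have h: "h \<in> Aut S X" using g by (simp add: h_def)
  have "map h ds = cs" using g cs by (auto simp: h_def tuples_def subset_iff intro!: map_idI)
  then have eq: "map h ys = cs @ [h d]" by (simp add: ds(1))
  obtain \<eta> where \<eta>: "isolates S X \<eta> ys" using ys(3) by (auto simp: isolated_def)
  have len: "length (cs @ [h d]) = length ys" using ds by simp
  have ysl: "ys \<in> tuples (universe X) (length ys)" using ys(1) by (auto simp: tuples_def)
  have "isolates S X \<eta> (map h ys)"
    unfolding isolates_def length_map
  proof (intro conjI ballI impI)
    show "map h ys \<in> tuples (universe X) (length ys)" using h ysl by simp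
    show "formula_in S (length ys) \<eta>" using \<eta> by (simp add: isolates_def)
    then show "sat_tuple X \<eta> (map h ys)"
      using \<eta> sat_tuple_Aut[OF h _ ysl] by (simp add: isolates_def)
    fix zs assume "zs \<in> tuples (universe X) (length ys)" "sat_tuple X \<eta> zs"
    then obtain f where f: "f \<in> Aut S X" "zs = map f ys" using \<eta> by (auto simp: isolates_def)
    have "(f \<otimes>\<^bsub>aut_group S X\<^esub> g) (h y) = f y" if "y \<in> set ys" for y
    proof -
      have y: "y \<in> universe X" using ysl that by (auto simp: tuples_def)
      have "(f \<otimes>\<^bsub>aut_group S X\<^esub> g) (h y) = f (g (h y))"
        using f(1) g(1) Aut_closed[OF h y] by simp
      also have "g (h y) = y" using g(1) y by (simp add: h_def)
      finally show ?thesis .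
    qed
    then have "zs = map (f \<otimes>\<^bsub>aut_group S X\<^esub> g) (map h ys)"
      using f(2) by simp
    then show "\<exists>f\<in>Aut S X. zs = map f (map h ys)"
      using Aut_mult_closed[OF f(1) g(1)] by (rule bexI)
  qed
  moreover have "sat_tuple X (Conj \<theta> \<psi>) (map h ys)"
    using sat_tuple_Aut[OF h \<psi>1 ys(1)] ys(2) by simp
  then have "sat_tuple X \<psi> (cs @ [h d])" by (simp add: eq sat_tuple_def)
  ultimately show ?thesis
    using * h ds(4) eq by (intro bexI[of _ "h d"]) (auto simp only: isolated_def Aut_closed)
qed

lemma isolated_Nil: "isolated S X []"
proof -
  have "sat_tuple X (conjs []) xs" for xs :: "'a list"
    by (simp add: sat_tuple_def sat_conjs[OF ne])
  moreover have "formula_in S 0 (conjs [])"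
    by (simp add: formula_in_def formula_over_conjs free_vars_conjs)
  ultimately have "isolates S X (conjs []) []"
    using Aut_one_closed[of S X] by (auto simp: isolates_def tuples_def simp del: Aut_one_closed)
  then show ?thesis by (auto simp: isolated_def)
qed

text \<open>
The tasks are the existential statements with parameters among the entries chosen so far. The
range of the resulting sequence passes the Tarski-Vaught test, so it will be an elementary
substructure, and it consists of isolated tuples only.
\<close>

lemma isolated_sequence:
  "\<exists>c. (\<forall>n. isolated S X (map c [0..<n])) \<and>
    (\<forall>\<phi> i v. formula_over S \<phi> \<longrightarrow> (\<forall>j\<in>free_vars \<phi> - {i}. v j \<in> range c) \<longrightarrow>
      (\<exists>a\<in>universe X. sat X (v(i := a)) \<phi>) \<longrightarrow> (\<exists>a\<in>range c. sat X (v(i := a)) \<phi>))"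
proof -
  define P where "P = {\<phi>. formula_over S \<phi>} \<times> (UNIV :: nat set) \<times> (UNIV :: nat list set)"
  have "countable P" using countable_formulas[OF S] by (auto simp: P_def)
  \<comment> \<open>Every task returns at infinitely many stages, so at a stage at which its parameters, whose
    indices are listed in \<open>ks\<close>, have been chosen already.\<close>
  define task where "task n = from_nat_into P (fst (prod_decode n))" for n
  define val where "val cs ks j = cs ! (ks ! j)" for cs :: "'a list" and ks j
  define apt where "apt n t \<longleftrightarrow> (case t of (\<phi>, i, ks) \<Rightarrow>
    formula_over S \<phi> \<and> (\<forall>j\<in>free_vars \<phi> - {i}. j < length ks \<and> ks ! j < n))"
    for n and t :: "'r formula \<times> nat \<times> nat list"
  define does where "does cs t b \<longleftrightarrow> (case t of (\<phi>, i, ks) \<Rightarrow>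
    (\<exists>a\<in>universe X. sat X ((val cs ks)(i := a)) \<phi>) \<longrightarrow> sat X ((val cs ks)(i := b)) \<phi>)" for cs t b
  have "\<exists>cs. \<forall>n. (length (cs n) = n \<and> isolated S X (cs n)) \<and>
      (\<exists>b. cs (Suc n) = cs n @ [b] \<and> (apt n (task n) \<longrightarrow> does (cs n) (task n) b))"
  proof -
    have "\<exists>f. \<forall>n. (length (f n) = n \<and> isolated S X (f n)) \<and>
      (\<exists>b. f (Suc n) = f n @ [b] \<and> (apt n (task n) \<longrightarrow> does (f n) (task n) b))"
    proof (rule dependent_nat_choice)
      show "\<exists>cs :: 'a list. length cs = 0 \<and> isolated S X cs" using isolated_Nil by auto
      fix cs :: "'a list" and n assume cs: "length cs = n \<and> isolated S X cs"
      have triv: "\<exists>b. isolated S X (cs @ [b])"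
      proof -
        obtain a where "a \<in> universe X" using ne by blast
        then show ?thesis
          using isolated_extension[of cs "Eq 0 0" 0 "\<lambda>_. a" a] cs by auto
      qed
      obtain \<phi> i ks where t: "task n = (\<phi>, i, ks)" by (cases "task n")
      have "\<exists>b. isolated S X (cs @ [b]) \<and> (apt n (task n) \<longrightarrow> does cs (task n) b)"
      proof (cases "apt n (task n) \<and> (\<exists>a\<in>universe X. sat X ((val cs ks)(i := a)) \<phi>)")
        case True
        then have \<phi>: "formula_over S \<phi>" and v: "\<And>j. j \<in> free_vars \<phi> - {i} \<Longrightarrow> val cs ks j \<in> set cs"
          using cs by (auto simp: apt_def t val_def)
        obtain a where a: "a \<in> universe X" "sat X ((val cs ks)(i := a)) \<phi>" using True by blast
        have "\<exists>b\<in>universe X. sat X ((val cs ks)(i := b)) \<phi> \<and> isolated S X (cs @ [b])"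
          using cs by (intro isolated_extension[OF _ \<phi> v a]) auto
        then obtain b where "sat X ((val cs ks)(i := b)) \<phi>" "isolated S X (cs @ [b])" by blast
        then show ?thesis by (auto simp: t does_def)
      next
        case False
        then show ?thesis using triv by (auto simp: does_def t)
      qed
      then obtain b where "isolated S X (cs @ [b])" "apt n (task n) \<longrightarrow> does cs (task n) b" by blast
      then show "\<exists>cs'. (length cs' = Suc n \<and> isolated S X cs') \<and>
          (\<exists>b. cs' = cs @ [b] \<and> (apt n (task n) \<longrightarrow> does cs (task n) b))"
        using cs by (intro exI[of _ "cs @ [b]"]) auto
    qed
    then show ?thesis by blast
  qed
  then obtain cs where cs: "\<And>n. length (cs n) = n" "\<And>n. isolated S X (cs n)"
    "\<And>n. \<exists>b. cs (Suc n) = cs n @ [b] \<and> (apt n (task n) \<longrightarrow> does (cs n) (task n) b)" by blast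
  then obtain c where c: "\<And>n. cs (Suc n) = cs n @ [c n]"
    "\<And>n. apt n (task n) \<Longrightarrow> does (cs n) (task n) (c n)" by metis
  have cs_eq: "cs n = map c [0..<n]" for n
    by (induction n) (use cs(1)[of 0] c(1) in auto)
  show ?thesis
  proof (intro exI[of _ c] conjI allI impI)
    show "isolated S X (map c [0..<n])" for n using cs(2) by (simp add: cs_eq[symmetric])
    fix \<phi> i v assume \<phi>: "formula_over S \<phi>" and v: "\<forall>j\<in>free_vars \<phi> - {i}. v j \<in> range c"
      and ex: "\<exists>a\<in>universe X. sat X (v(i := a)) \<phi>"
    have "\<exists>k. j \<in> free_vars \<phi> - {i} \<longrightarrow> v j = c k" for j using v by auto
    then obtain k where k: "\<And>j. j \<in> free_vars \<phi> - {i} \<Longrightarrow> v j = c (k j)" by metis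
    obtain N where N: "\<And>j. j \<in> free_vars \<phi> \<Longrightarrow> j < N"
      using finite_free_vars[of \<phi>] unfolding finite_nat_set_iff_bounded by blast
    define ks where "ks = map k [0..<N]"
    \<comment> \<open>A stage of index at least \<open>q\<close> comes after the parameters.\<close>
    obtain q where q: "\<And>j. j \<in> set ks \<Longrightarrow> j < q"
      using List.finite_set[of ks] unfolding finite_nat_set_iff_bounded by blast
    have "(\<phi>, i, ks) \<in> P" using \<phi> by (simp add: P_def)
    then obtain p where p: "from_nat_into P p = (\<phi>, i, ks)"
      using from_nat_into_surj[OF \<open>countable P\<close>] by blast
    define n where "n = prod_encode (p, q)"
    have task: "task n = (\<phi>, i, ks)" by (simp add: task_def n_def p)
    have lt: "k j < n" if "j \<in> free_vars \<phi> - {i}" for j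
    proof -
      have "k j \<in> set ks" using N that by (auto simp: ks_def)
      then show ?thesis using q le_prod_encode_2[of q p] by (fastforce simp: n_def)
    qed
    have "apt n (task n)" using \<phi> N lt by (auto simp: task apt_def ks_def)
    then have does: "does (cs n) (\<phi>, i, ks) (c n)" using c(2) task by metis
    have "sat X ((val (cs n) ks)(i := a)) \<phi> = sat X (v(i := a)) \<phi>" for a
      using N lt k by (intro sat_cong) (auto simp: val_def ks_def cs_eq)
    then show "\<exists>a\<in>range c. sat X (v(i := a)) \<phi>"
      using does ex by (auto simp: does_def)
  qed
qed

text \<open>
The atomic elementary substructure on the range of the sequence is isomorphic to \<open>X\<close> by
\<open>\<omega>\<close>-categoricity, and a tuple satisfies the same formulas as its image under the isomorphism.
\<close>

lemma isolated:
  assumes xs: "xs \<in> tuples (universe X) n"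
  shows "isolated S X xs"
proof -
  obtain c where c: "\<And>n. isolated S X (map c [0..<n])"
    and witness: "\<And>\<phi> i v. \<lbrakk>formula_over S \<phi>; \<forall>j\<in>free_vars \<phi> - {i}. v j \<in> range c;
      \<exists>a\<in>universe X. sat X (v(i := a)) \<phi>\<rbrakk> \<Longrightarrow> \<exists>a\<in>range c. sat X (v(i := a)) \<phi>"
    using isolated_sequence by blast
  have cU: "c k \<in> universe X" for k
    using c[of "Suc k"] by (auto simp: isolated_def isolates_def tuples_def)
  define Y where "Y = substructure X (range c)"
  have univ: "universe Y = range c" by (simp add: Y_def substructure_def)
  have elem: "sat Y v \<phi> = sat X v \<phi>"
    if "formula_over S \<phi>" "\<And>i. i \<in> free_vars \<phi> \<Longrightarrow> v i \<in> range c" for \<phi> v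
    using that
  proof (induction \<phi> arbitrary: v)
    case (Rel r js)
    then have "set (map v js) \<subseteq> range c" by auto
    then show ?case by (simp add: Y_def substructure_def)
  next
    case (Neg \<phi>)
    from Neg.IH[of v] Neg.prems show ?case by simp
  next
    case (Conj \<phi> \<psi>)
    from Conj.IH(1)[of v] Conj.IH(2)[of v] Conj.prems show ?case by simp
  next
    case (Exists i \<phi>)
    have "sat Y (v(i := a)) \<phi> = sat X (v(i := a)) \<phi>" if "a \<in> range c" for a
      by (rule Exists.IH) (use Exists.prems that in auto)
    then have "sat Y v (Exists i \<phi>) \<longleftrightarrow> (\<exists>a\<in>range c. sat X (v(i := a)) \<phi>)"
      by (auto simp: univ)
    also have "\<dots> \<longleftrightarrow> (\<exists>a\<in>universe X. sat X (v(i := a)) \<phi>)"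
      using witness[of \<phi> i v] Exists.prems cU by fastforce
    finally show ?case by simp
  qed simp
  have "relational_structure S Y"
    using rel by (auto simp: relational_structure_def Y_def substructure_def tuples_def)
  moreover have "holds Y \<phi>" if "\<phi> \<in> first_order_theory S X" for \<phi>
  proof -
    have "sat X v \<phi>" if "range v \<subseteq> range c" for v
    proof -
      have "range v \<subseteq> universe X"
        by (rule subset_trans[OF that]) (use cU in \<open>rule image_subsetI\<close>)
      then show ?thesis
        using \<open>\<phi> \<in> first_order_theory S X\<close> by (simp add: first_order_theory_def holds_def)
    qed
    moreover have "sat Y v \<phi> = sat X v \<phi>" for v
      using that by (intro elem) (auto simp: first_order_theory_def sentence_def)
    ultimately show ?thesis by (simp add: holds_def univ)
  qed
  ultimately obtain f where f: "struct_iso S X Y f"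
    using omega_categorical_iso[OF cat, of Y] by (auto simp: univ)
  let ?ys = "map f xs"
  have "set ?ys \<subseteq> range c"
    using xs f by (auto simp: tuples_def struct_iso_def bij_betw_def univ)
  then obtain J where J: "finite J" "set ?ys = c ` J"
    using finite_subset_image[of "set ?ys" c UNIV] by auto
  then obtain N where "J \<subseteq> {..<N}"
    using finite_nat_iff_bounded by blast
  then have "set ?ys \<subseteq> set (map c [0..<N])" using J by auto
  then have "isolated S X ?ys" using isolated_subtuple[OF c _ ne] by blast
  then obtain \<theta> where \<theta>: "isolates S X \<theta> ?ys" by (auto simp: isolated_def)
  have len: "length xs = n" using xs by (simp add: tuples_def)
  have \<theta>1: "formula_in S n \<theta>" using \<theta> len by (simp add: isolates_def)
  have "sat_tuple X \<theta> xs = sat_tuple Y \<theta> ?ys"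
    using sat_tuple_struct_iso[OF f \<theta>1 xs] by simp
  also have "\<dots> = sat_tuple X \<theta> ?ys"
    unfolding sat_tuple_def using \<theta>1 \<open>set ?ys \<subseteq> range c\<close> len
    by (intro elem) (auto simp: formula_in_def subset_iff)
  also have "\<dots>" using \<theta> by (simp add: isolates_def)
  finally have sat: "sat_tuple X \<theta> xs" .
  then obtain g where g: "g \<in> Aut S X" "xs = map g ?ys"
    using \<theta> xs len unfolding isolates_def by auto
  have ysU: "y \<in> universe X" if "y \<in> set ?ys" for y
    using \<theta> that unfolding isolates_def tuples_def by blast
  have "isolates S X \<theta> xs"
    unfolding isolates_def len
  proof (intro conjI ballI impI xs \<theta>1 sat)
    fix zs assume "zs \<in> tuples (universe X) n" "sat_tuple X \<theta> zs"
    then obtain h where h: "h \<in> Aut S X" "zs = map h ?ys"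
      using \<theta> len unfolding isolates_def by auto
    have "(h \<otimes>\<^bsub>aut_group S X\<^esub> inv\<^bsub>aut_group S X\<^esub> g) (g y) = h y" if "y \<in> set ?ys" for y
      using g(1) h(1) ysU[OF that] by (rule Aut_mult_inv)
    then have "zs = map (h \<otimes>\<^bsub>aut_group S X\<^esub> inv\<^bsub>aut_group S X\<^esub> g) (map g ?ys)"
      by (simp add: h(2))
    then show "\<exists>h\<in>Aut S X. zs = map h xs" using g h by (metis Aut_inv_closed Aut_mult_closed)
  qed
  then show ?thesis by (auto simp: isolated_def)
qed

text \<open>
This is the implication of the Ryll-Nardzewski theorem that is needed. Otherwise the negations
of the countably many formulas which isolate a tuple would be finitely satisfiable, and by
compactness some tuple would not be isolated.
\<close>

theorem finitely_many_orbits: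
  "\<exists>R. finite R \<and> R \<subseteq> tuples (universe X) n \<and>
    (\<forall>xs\<in>tuples (universe X) n. \<exists>ys\<in>R. \<exists>g\<in>Aut S X. xs = map g ys)"
proof (rule ccontr)
  assume no: "\<not> ?thesis"
  define I where "I = {\<theta>. \<exists>ys\<in>tuples (universe X) n. isolates S X \<theta> ys}"
  have in_I: "formula_in S n \<theta>" if "\<theta> \<in> I" for \<theta>
    using that by (auto simp: I_def isolates_def tuples_def)
  then have "I \<subseteq> {\<phi>. formula_over S \<phi>}" by (auto simp: formula_in_def)
  then have "countable I" using countable_formulas[OF S] countable_subset by blast
  obtain a where a: "a \<in> universe X" using ne by blast
  have "replicate n a \<in> tuples (universe X) n" using a by (auto simp: tuples_def)
  then have "I \<noteq> {}" using isolated unfolding isolated_def I_def by blast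
  define e where "e = from_nat_into I"
  have e: "e k \<in> I" for k using \<open>I \<noteq> {}\<close> by (simp add: e_def from_nat_into)
  then have "\<exists>ys. ys \<in> tuples (universe X) n \<and> isolates S X (e k) ys" for k
    unfolding I_def by blast
  then obtain r where r: "\<And>k. r k \<in> tuples (universe X) n" "\<And>k. isolates S X (e k) (r k)" by metis
  have "\<exists>xs\<in>tuples (universe X) n. \<forall>i. sat_tuple X (Neg (e i)) xs"
  proof (rule omega_categorical_compactness[OF S rel cat])
    show "formula_in S n (Neg (e k))" for k using in_I[OF e[of k]] by (simp add: formula_in_def)
    fix k
    show "\<exists>xs\<in>tuples (universe X) n. \<forall>i\<le>k. sat_tuple X (Neg (e i)) xs"
    proof (rule ccontr)
      assume *: "\<not> ?thesis"
      have "\<exists>ys\<in>r ` {..k}. \<exists>g\<in>Aut S X. xs = map g ys" if xs: "xs \<in> tuples (universe X) n" for xs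
      proof -
        obtain i where "i \<le> k" "sat_tuple X (e i) xs"
          using * xs by (auto simp: sat_tuple_def)
        moreover have "length (r i) = n" using r(1)[of i] by (simp add: tuples_def)
        ultimately show ?thesis using r(2)[of i] xs unfolding isolates_def by blast
      qed
      moreover have "finite (r ` {..k})" "r ` {..k} \<subseteq> tuples (universe X) n" using r(1) by auto
      ultimately show False using no by blast
    qed
  qed
  then obtain xs where xs: "xs \<in> tuples (universe X) n" "\<And>i. \<not> sat_tuple X (e i) xs"
    by (auto simp: sat_tuple_def)
  obtain \<theta> where "isolates S X \<theta> xs" using isolated[OF xs(1)] by (auto simp: isolated_def)
  then have "\<theta> \<in> I" "sat_tuple X \<theta> xs" using xs(1) by (auto simp: I_def isolates_def)
  moreover obtain k where "e k = \<theta>"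
    using from_nat_into_surj[OF \<open>countable I\<close> \<open>\<theta> \<in> I\<close>] by (auto simp: e_def)
  ultimately show False using xs(2)[of k] by simp
qed

text \<open>
An invariant set is a finite union of orbits, and each orbit is definable.
\<close>

theorem invariant_definable:
  assumes D: "D \<subseteq> tuples (universe X) n"
    and inv: "\<And>g xs. \<lbrakk>g \<in> Aut S X; xs \<in> D\<rbrakk> \<Longrightarrow> map g xs \<in> D"
  shows "definable_set S X n D"
proof -
  obtain R where R: "finite R" "R \<subseteq> tuples (universe X) n"
    "\<forall>xs\<in>tuples (universe X) n. \<exists>ys\<in>R. \<exists>g\<in>Aut S X. xs = map g ys"
    using finitely_many_orbits[of n] by metis
  have "finite (R \<inter> D)" using R(1) by simp
  then obtain rs where rs: "set rs = R \<inter> D" using finite_list by blast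
  have "\<exists>\<theta>. isolates S X \<theta> ys" if "ys \<in> R" for ys
    using isolated R(2) that by (auto simp: isolated_def)
  then obtain \<theta> where \<theta>: "\<And>ys. ys \<in> R \<Longrightarrow> isolates S X (\<theta> ys) ys" by metis
  have len: "length ys = n" if "ys \<in> R" for ys using R(2) that by (auto simp: tuples_def)
  define \<phi> where "\<phi> = Neg (conjs (map (\<lambda>ys. Neg (\<theta> ys)) rs))"
  have "formula_in S n \<phi>"
    using \<theta> rs len by (fastforce simp: \<phi>_def formula_in_def formula_over_conjs free_vars_conjs isolates_def)
  moreover have sat: "sat_tuple X \<phi> xs \<longleftrightarrow> (\<exists>ys\<in>R \<inter> D. sat_tuple X (\<theta> ys) xs)" for xs
    by (auto simp: \<phi>_def sat_tuple_def sat_conjs[OF ne] rs)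
  moreover have "D = {xs \<in> tuples (universe X) n. sat_tuple X \<phi> xs}"
  proof (intro equalityI subsetI CollectI conjI)
    fix xs assume xs: "xs \<in> D"
    then show "xs \<in> tuples (universe X) n" using D by blast
    then obtain ys g where ys: "ys \<in> R" "g \<in> Aut S X" "xs = map g ys" using R(3) by blast
    have ysU: "ys \<in> tuples (universe X) n" using ys R(2) by blast
    have "(inv\<^bsub>aut_group S X\<^esub> g) (g y) = y" if "y \<in> set ys" for y
      using that ys(2) ysU by (intro Aut_inv) (auto simp: tuples_def)
    then have "ys = map (inv\<^bsub>aut_group S X\<^esub> g) xs"
      unfolding ys(3) map_map by (intro map_idI[symmetric]) simp
    then have "ys \<in> D" using inv[OF Aut_inv_closed[OF ys(2)] xs] by simp
    moreover have "sat_tuple X (\<theta> ys) xs"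
      using \<theta>[OF ys(1)] sat_tuple_Aut[OF ys(2) _ ysU] len[OF ys(1)] by (simp add: isolates_def ys(3))
    ultimately show "sat_tuple X \<phi> xs" unfolding sat using ys(1) by blast
  next
    fix xs assume "xs \<in> {xs \<in> tuples (universe X) n. sat_tuple X \<phi> xs}"
    then obtain ys where ys: "ys \<in> R" "ys \<in> D" "sat_tuple X (\<theta> ys) xs" "xs \<in> tuples (universe X) n"
      by (auto simp: sat)
    then obtain g where g: "g \<in> Aut S X" "xs = map g ys"
      using \<theta>[OF ys(1)] len[OF ys(1)] unfolding isolates_def by auto
    then show "xs \<in> D" using inv[OF g(1) ys(2)] by simp
  qed
  ultimately show ?thesis unfolding definable_set_def by blast
qed

end


section \<open>Open subgroups of the automorphism group\<close>

definition fixer :: "'r signature \<Rightarrow> ('r, 'a) rel_structure \<Rightarrow> 'a set \<Rightarrow> ('a \<Rightarrow> 'a) set" where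
  "fixer S X A = {g \<in> Aut S X. \<forall>a\<in>A. g a = a}"

lemma fixer_Aut: "g \<in> fixer S X A \<Longrightarrow> g \<in> Aut S X"
  by (simp add: fixer_def)

lemma fixer_antimono: "A \<subseteq> B \<Longrightarrow> fixer S X B \<subseteq> fixer S X A"
  by (auto simp: fixer_def)

text \<open>
Tuples in the orbit of \<open>es\<close> correspond to cosets of the stabilizer of \<open>es\<close>.
\<close>

lemma map_eq_iff_fixer:
  assumes "g \<in> Aut S X" "h \<in> Aut S X" "set es \<subseteq> universe X"
  shows "map g es = map h es \<longleftrightarrow> inv\<^bsub>aut_group S X\<^esub> g \<otimes>\<^bsub>aut_group S X\<^esub> h \<in> fixer S X (set es)"
proof -
  have "g x = h x \<longleftrightarrow> (inv\<^bsub>aut_group S X\<^esub> g \<otimes>\<^bsub>aut_group S X\<^esub> h) x = x" if "x \<in> set es" for x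
  proof -
    have x: "x \<in> universe X" using that assms(3) by blast
    have "(inv\<^bsub>aut_group S X\<^esub> g \<otimes>\<^bsub>aut_group S X\<^esub> h) x = x \<longleftrightarrow> (inv\<^bsub>aut_group S X\<^esub> g) (h x) = x"
      using assms x by simp
    also have "\<dots> \<longleftrightarrow> g x = h x"
      using Aut_inv[OF assms(1) x] Aut_inv[OF assms(1) Aut_closed[OF assms(2) x]] by metis
    finally show ?thesis by simp
  qed
  then show ?thesis using assms by (auto simp: fixer_def)
qed

locale weakly_eliminates_imaginaries = countably_categorical S X
  for S :: "'r signature" and X :: "('r, 'a) rel_structure" +
  assumes no_alg: "no_algebraicity S X" and wei: "weak_elimination_of_imaginaries S X"
begin

abbreviation G where "G \<equiv> aut_group S X"

sublocale G: group G
  by (rule group_aut_group)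

lemma subgroup_fixer: "A \<subseteq> universe X \<Longrightarrow> subgroup (fixer S X A) G"
proof (rule G.subgroupI)
  assume A: "A \<subseteq> universe X"
  show "fixer S X A \<subseteq> Aut S X" by (auto simp: fixer_def)
  show "fixer S X A \<noteq> {}" using A by (auto simp: fixer_def intro!: exI[of _ "\<one>\<^bsub>G\<^esub>"])
  fix g assume g: "g \<in> fixer S X A"
  have "(inv\<^bsub>G\<^esub> g) a = a" if "a \<in> A" for a
  proof -
    have ga: "g \<in> Aut S X" "g a = a" "a \<in> universe X" using g A that by (auto simp: fixer_def)
    from Aut_inv(1)[OF ga(1,3)] show ?thesis unfolding ga(2) .
  qed
  then show "inv\<^bsub>G\<^esub> g \<in> fixer S X A" using g by (simp add: fixer_def)
  fix h assume "h \<in> fixer S X A"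
  then show "g \<otimes>\<^bsub>G\<^esub> h \<in> fixer S X A" using g A by (auto simp: fixer_def subset_iff)
qed

lemma infinite_orbit:
  assumes "finite A" "A \<subseteq> universe X" "b \<in> universe X" "b \<notin> A"
  shows "infinite {g b |g. g \<in> fixer S X A}"
  using assms no_alg
  by (auto simp: no_algebraicity_def algebraic_closure_def stabilizer_orbit_def fixer_def)

text \<open>
This is the only use of weak elimination of imaginaries. Let the tuple \<open>es\<close> enumerate \<open>E\<close>. As
\<open>K\<close> contains the stabilizer of \<open>es\<close>, the sets \<open>g K es\<close> partition the orbit of \<open>es\<close>; being
invariant, this partition is definable, so \<open>\<alpha> = K es\<close> is an imaginary, and \<open>K\<close> is its setwise
stabilizer. If \<open>\<alpha>\<close> is defined by one of the finitely many parameter tuples in \<open>C\<close>, then \<open>K\<close>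
permutes \<open>C\<close> and contains the stabilizer of each tuple in \<open>C\<close>.
\<close>

lemma open_subgroup_support:
  assumes K: "subgroup K G" and E: "finite E" "E \<subseteq> universe X" "fixer S X E \<subseteq> K"
  shows "\<exists>F. finite F \<and> F \<subseteq> universe X \<and> fixer S X F \<subseteq> K \<and> (\<forall>f\<in>F. finite {k f |k. k \<in> K})"
proof -
  obtain es where es: "set es = E" using finite_list[OF E(1)] by blast
  let ?m = "length es" and ?U = "universe X"
  have KA: "k \<in> Aut S X" if "k \<in> K" for k using subgroup.subset[OF K] that by blast
  note Kcl = subgroup.m_closed[OF K] subgroup.m_inv_closed[OF K] subgroup.one_closed[OF K]
  have esU: "set es \<subseteq> ?U" using es E by simp
  then have est: "es \<in> tuples ?U ?m" by (simp add: tuples_def)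
  have map_mult: "map (g \<otimes>\<^bsub>G\<^esub> h) es = map g (map h es)" if "g \<in> Aut S X" "h \<in> Aut S X" for g h
    using that esU by (auto simp: subset_iff)
  have sameK: "inv\<^bsub>G\<^esub> g \<otimes>\<^bsub>G\<^esub> h \<in> K" if "map g es = map h es" "g \<in> Aut S X" "h \<in> Aut S X" for g h
    using map_eq_iff_fixer[OF that(2,3) esU] that(1) E(3) es by auto
  define \<alpha> where "\<alpha> = {map k es |k. k \<in> K}"
  define D where "D = {map g es |g. g \<in> Aut S X}"
  define R where "R = {(map g es, map (g \<otimes>\<^bsub>G\<^esub> k) es) |g k. g \<in> Aut S X \<and> k \<in> K}"
  have D_sub: "D \<subseteq> tuples ?U ?m" using est by (auto simp: D_def)
  have D_inv: "map g xs \<in> D" if "g \<in> Aut S X" "xs \<in> D" for g xs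
    using that map_mult unfolding D_def by (auto simp del: map_map simp flip: map_mult)
  have R_sub: "R \<subseteq> D \<times> D" using KA by (auto simp: R_def D_def)
  have R_inv: "(map g xs, map g ys) \<in> R" if g: "g \<in> Aut S X" and xy: "(xs, ys) \<in> R" for g xs ys
  proof -
    obtain h k where *: "h \<in> Aut S X" "k \<in> K" "xs = map h es" "ys = map (h \<otimes>\<^bsub>G\<^esub> k) es"
      using xy by (auto simp: R_def)
    then have "map g xs = map (g \<otimes>\<^bsub>G\<^esub> h) es" "map g ys = map (g \<otimes>\<^bsub>G\<^esub> h \<otimes>\<^bsub>G\<^esub> k) es"
      using g KA map_mult[of g h] map_mult[of g "h \<otimes>\<^bsub>G\<^esub> k"] G.m_assoc[of g h k] by simp_all
    then show ?thesis using * g unfolding R_def by blast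
  qed
  have "equiv D R"
  proof (rule equivI)
    show "R \<subseteq> D \<times> D" by (rule R_sub)
    show "refl_on D R"
    proof (rule refl_onI)
      fix xs assume "xs \<in> D"
      then obtain g where g: "g \<in> Aut S X" "xs = map g es" by (auto simp: D_def)
      then have "(map g es, map (g \<otimes>\<^bsub>G\<^esub> \<one>\<^bsub>G\<^esub>) es) \<in> R"
        using Kcl(3) unfolding R_def by blast
      then show "(xs, xs) \<in> R" using g by simp
    qed
    show "sym R"
    proof (rule symI)
      fix xs ys assume "(xs, ys) \<in> R"
      then obtain g k where *: "g \<in> Aut S X" "k \<in> K" "xs = map g es" "ys = map (g \<otimes>\<^bsub>G\<^esub> k) es"
        by (auto simp: R_def)
      then have "(map (g \<otimes>\<^bsub>G\<^esub> k) es, map (g \<otimes>\<^bsub>G\<^esub> k \<otimes>\<^bsub>G\<^esub> inv\<^bsub>G\<^esub> k) es) \<in> R"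
        using Kcl KA unfolding R_def by blast
      then show "(ys, xs) \<in> R" using * KA G.m_assoc[of g k "inv\<^bsub>G\<^esub> k"] by simp
    qed
    show "trans R"
    proof (rule transI)
      fix xs ys zs assume "(xs, ys) \<in> R" "(ys, zs) \<in> R"
      then obtain g k h l where *: "g \<in> Aut S X" "k \<in> K" "xs = map g es" "ys = map (g \<otimes>\<^bsub>G\<^esub> k) es"
        "h \<in> Aut S X" "l \<in> K" "ys = map h es" "zs = map (h \<otimes>\<^bsub>G\<^esub> l) es"
        by (auto simp: R_def)
      define u where "u = inv\<^bsub>G\<^esub> (g \<otimes>\<^bsub>G\<^esub> k) \<otimes>\<^bsub>G\<^esub> h"
      have u: "u \<in> K" unfolding u_def using * KA by (intro sameK) auto
      have "g \<otimes>\<^bsub>G\<^esub> k \<otimes>\<^bsub>G\<^esub> u = h"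
        using * KA unfolding u_def by (simp flip: G.m_assoc)
      then have "h \<otimes>\<^bsub>G\<^esub> l = g \<otimes>\<^bsub>G\<^esub> (k \<otimes>\<^bsub>G\<^esub> u \<otimes>\<^bsub>G\<^esub> l)"
        using * KA u by (metis G.m_assoc G.m_closed)
      then have "zs = map (g \<otimes>\<^bsub>G\<^esub> (k \<otimes>\<^bsub>G\<^esub> u \<otimes>\<^bsub>G\<^esub> l)) es" using *(8) by simp
      moreover have "k \<otimes>\<^bsub>G\<^esub> u \<otimes>\<^bsub>G\<^esub> l \<in> K" using * u Kcl by simp
      ultimately show "(xs, zs) \<in> R" using * unfolding R_def by blast
    qed
  qed
  moreover have "definable_set S X ?m D"
    using D_sub D_inv by (rule invariant_definable)
  moreover have "definable_set S X (?m + ?m) {xs @ ys |xs ys. (xs, ys) \<in> R}"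
  proof (rule invariant_definable)
    show "{xs @ ys |xs ys. (xs, ys) \<in> R} \<subseteq> tuples ?U (?m + ?m)"
    proof
      fix zs assume "zs \<in> {xs @ ys |xs ys. (xs, ys) \<in> R}"
      then obtain xs ys where "zs = xs @ ys" "xs \<in> tuples ?U ?m" "ys \<in> tuples ?U ?m"
        using R_sub D_sub by blast
      then show "zs \<in> tuples ?U (?m + ?m)" by (auto simp: tuples_def)
    qed
    show "map g zs \<in> {xs @ ys |xs ys. (xs, ys) \<in> R}"
      if "g \<in> Aut S X" "zs \<in> {xs @ ys |xs ys. (xs, ys) \<in> R}" for g zs
      using that R_inv[OF that(1)] by fastforce
  qed
  moreover have "\<alpha> \<in> D // R"
  proof -
    have "map \<one>\<^bsub>G\<^esub> es = es" using esU by (auto intro!: map_idI)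
    then have "es \<in> D" unfolding D_def using Aut_one_closed by (metis (mono_tags, lifting) mem_Collect_eq)
    then have "R `` {es} \<in> D // R" by (rule quotientI)
    moreover have "R `` {es} = \<alpha>"
    proof (intro equalityI subsetI)
      fix ys assume "ys \<in> R `` {es}"
      then obtain g k where *: "g \<in> Aut S X" "k \<in> K" "es = map g es" "ys = map (g \<otimes>\<^bsub>G\<^esub> k) es"
        by (auto simp: R_def)
      have "map \<one>\<^bsub>G\<^esub> es = map g es" using * \<open>map \<one>\<^bsub>G\<^esub> es = es\<close> by simp
      from sameK[OF this] have "g \<in> K" using * by simp
      then show "ys \<in> \<alpha>" using * Kcl unfolding \<alpha>_def by blast
    next
      fix ys assume "ys \<in> \<alpha>"
      then obtain k where "k \<in> K" "ys = map k es" by (auto simp: \<alpha>_def)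
      then have "(map \<one>\<^bsub>G\<^esub> es, map (\<one>\<^bsub>G\<^esub> \<otimes>\<^bsub>G\<^esub> k) es) \<in> R" unfolding R_def by blast
      then show "ys \<in> R `` {es}"
        using \<open>map \<one>\<^bsub>G\<^esub> es = es\<close> KA[OF \<open>k \<in> K\<close>] \<open>ys = map k es\<close> by simp
    qed
    ultimately show ?thesis by simp
  qed
  ultimately have "imaginary S X ?m \<alpha>" unfolding imaginary_def definable_equivalence_def by blast
  then obtain n \<phi> where \<phi>: "formula_in S (?m + n) \<phi>"
    and C: "finite {cs \<in> tuples ?U n. \<alpha> = {xs \<in> tuples ?U ?m. sat_tuple X \<phi> (xs @ cs)}}"
      "{cs \<in> tuples ?U n. \<alpha> = {xs \<in> tuples ?U ?m. sat_tuple X \<phi> (xs @ cs)}} \<noteq> {}"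
    using wei unfolding weak_elimination_of_imaginaries_def Let_def by blast
  define C where "C = {cs \<in> tuples ?U n. \<alpha> = {xs \<in> tuples ?U ?m. sat_tuple X \<phi> (xs @ cs)}}"
  obtain cs where cs: "cs \<in> C" using C(2) by (auto simp: C_def)
  then have csU: "cs \<in> tuples ?U n" by (simp add: C_def)
  have shift: "sat_tuple X \<phi> (map g xs @ map g ds) = sat_tuple X \<phi> (xs @ ds)"
    if "g \<in> Aut S X" "xs \<in> tuples ?U ?m" "ds \<in> tuples ?U n" for g xs ds
    using sat_tuple_Aut[OF that(1) \<phi>, of "xs @ ds"] that(2,3) by (simp add: tuples_def)
  have \<alpha>_iff: "xs \<in> \<alpha> \<longleftrightarrow> xs \<in> tuples ?U ?m \<and> sat_tuple X \<phi> (xs @ ds)" if "ds \<in> C" for xs ds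
    using that unfolding C_def by blast
  have es\<alpha>: "es \<in> \<alpha>"
  proof -
    have "map \<one>\<^bsub>G\<^esub> es = es" using esU by (auto intro!: map_idI)
    then show ?thesis using Kcl(3) unfolding \<alpha>_def by (metis (mono_tags, lifting) mem_Collect_eq)
  qed
  have \<alpha>_inv: "map k xs \<in> \<alpha>" if k: "k \<in> K" and xs: "xs \<in> \<alpha>" for k xs
  proof -
    obtain l where "l \<in> K" "xs = map l es" using xs by (auto simp: \<alpha>_def)
    then have "map k xs = map (k \<otimes>\<^bsub>G\<^esub> l) es" using k KA map_mult by simp
    then show ?thesis using k \<open>l \<in> K\<close> Kcl unfolding \<alpha>_def by blast
  qed
  have inv_map: "map g (map (inv\<^bsub>G\<^esub> g) xs) = xs" if "g \<in> Aut S X" "xs \<in> tuples ?U n'" for g xs n'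
    using that by (auto simp: tuples_def subset_iff intro!: map_idI)
  have C_inv: "map k cs \<in> C" if k: "k \<in> K" for k
  proof -
    have kA: "k \<in> Aut S X" using KA k by simp
    have kcs: "map k cs \<in> tuples ?U n" using csU kA by simp
    have "xs \<in> \<alpha> \<longleftrightarrow> sat_tuple X \<phi> (xs @ map k cs)" if xs: "xs \<in> tuples ?U ?m" for xs
    proof -
      let ?ys = "map (inv\<^bsub>G\<^esub> k) xs"
      have ys: "?ys \<in> tuples ?U ?m" "map k ?ys = xs"
        using xs kA inv_map map_tuples[OF Aut_inv_closed[OF kA] xs] by (simp_all del: map_map)
      have "xs \<in> \<alpha> \<longleftrightarrow> ?ys \<in> \<alpha>"
        using \<alpha>_inv[OF k, of ?ys] \<alpha>_inv[of "inv\<^bsub>G\<^esub> k" xs] k Kcl ys(2) by metis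
      also have "\<dots> \<longleftrightarrow> sat_tuple X \<phi> (?ys @ cs)" using \<alpha>_iff[OF cs] ys(1) by blast
      also have "\<dots> \<longleftrightarrow> sat_tuple X \<phi> (xs @ map k cs)"
        using shift[OF kA ys(1) csU] ys(2) by simp
      finally show ?thesis .
    qed
    moreover have "\<alpha> \<subseteq> tuples ?U ?m" using \<alpha>_iff[OF cs] by blast
    ultimately show ?thesis using kcs unfolding C_def by blast
  qed
  have "fixer S X (set cs) \<subseteq> K"
  proof
    fix g assume "g \<in> fixer S X (set cs)"
    then have g: "g \<in> Aut S X" "map g cs = cs" by (auto simp: fixer_def intro!: map_idI)
    have "map g es \<in> \<alpha>"
      using es\<alpha> shift[OF g(1) est csU] g est unfolding \<alpha>_iff[OF cs] by simp
    then obtain k where k: "k \<in> K" "map g es = map k es" by (auto simp: \<alpha>_def)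
    have "inv\<^bsub>G\<^esub> k \<otimes>\<^bsub>G\<^esub> g \<in> K" using k KA g by (intro sameK) auto
    then have "k \<otimes>\<^bsub>G\<^esub> (inv\<^bsub>G\<^esub> k \<otimes>\<^bsub>G\<^esub> g) \<in> K" using k Kcl by blast
    then show "g \<in> K" using k KA g by (simp flip: G.m_assoc)
  qed
  moreover have "finite {k f |k. k \<in> K}" if f: "f \<in> set cs" for f
  proof -
    obtain i where i: "i < length cs" "f = cs ! i" using f by (metis in_set_conv_nth)
    have "{k f |k. k \<in> K} \<subseteq> (\<lambda>ds. ds ! i) ` C"
    proof
      fix y assume "y \<in> {k f |k. k \<in> K}"
      then obtain k where "k \<in> K" "y = map k cs ! i" using i by auto
      then show "y \<in> (\<lambda>ds. ds ! i) ` C" using C_inv by blast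
    qed
    moreover have "finite C" using C(1) by (simp add: C_def)
    ultimately show ?thesis using finite_surj by blast
  qed
  ultimately show ?thesis
    using csU by (intro exI[of _ "set cs"]) (auto simp: tuples_def)
qed

text \<open>
The stabilizers of \<open>A\<close> and \<open>B\<close> generate the stabilizer of \<open>A \<inter> B\<close>: an element of the support of
\<open>K\<close> has a finite orbit under both stabilizers, so it belongs to both sets, as there is no
algebraicity.
\<close>

theorem fixer_Int_subset:
  assumes K: "subgroup K G" and A: "finite A" "A \<subseteq> universe X" "fixer S X A \<subseteq> K"
    and B: "finite B" "B \<subseteq> universe X" "fixer S X B \<subseteq> K"
  shows "fixer S X (A \<inter> B) \<subseteq> K"
proof -
  obtain F where F: "finite F" "F \<subseteq> universe X" "fixer S X F \<subseteq> K" "\<And>f. f \<in> F \<Longrightarrow> finite {k f |k. k \<in> K}"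
    using open_subgroup_support[OF K A] by blast
  have sub: "f \<in> D" if f: "f \<in> F" and D: "finite D" "D \<subseteq> universe X" "fixer S X D \<subseteq> K" for f D
  proof (rule ccontr)
    assume "f \<notin> D"
    then have "infinite {g f |g. g \<in> fixer S X D}"
      using infinite_orbit[OF D(1,2)] f F(2) by blast
    moreover have "{g f |g. g \<in> fixer S X D} \<subseteq> {k f |k. k \<in> K}" using D(3) by blast
    ultimately show False using F(4)[OF f] finite_subset by blast
  qed
  have "F \<subseteq> A \<inter> B" using sub[OF _ A] sub[OF _ B] by blast
  then show ?thesis using fixer_antimono F(3) by blast
qed

text \<open>
If \<open>K\<close> has finite index in the stabilizer of \<open>C\<close>, as witnessed by the set \<open>T\<close> of coset
representatives, then an element of the support of \<open>K\<close> has a finite orbit under that stabilizer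
too, so it belongs to \<open>C\<close>.
\<close>

theorem fixer_no_finite_index:
  assumes K: "subgroup K G" and E: "finite E" "E \<subseteq> universe X" "fixer S X E \<subseteq> K"
    and C: "finite C" "C \<subseteq> universe X"
    and T: "finite T" "T \<subseteq> Aut S X" "\<And>g. g \<in> fixer S X C \<Longrightarrow> \<exists>t\<in>T. \<exists>k\<in>K. g = t \<otimes>\<^bsub>G\<^esub> k"
  shows "fixer S X C \<subseteq> K"
proof -
  obtain F where F: "finite F" "F \<subseteq> universe X" "fixer S X F \<subseteq> K" "\<And>f. f \<in> F \<Longrightarrow> finite {k f |k. k \<in> K}"
    using open_subgroup_support[OF K E] by blast
  have "F \<subseteq> C"
  proof (rule subsetI, rule ccontr)
    fix f assume f: "f \<in> F" "f \<notin> C"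
    then have "infinite {g f |g. g \<in> fixer S X C}"
      using infinite_orbit[OF C] F(2) by blast
    moreover have "{g f |g. g \<in> fixer S X C} \<subseteq> (\<Union>t\<in>T. t ` {k f |k. k \<in> K})"
    proof
      fix y assume "y \<in> {g f |g. g \<in> fixer S X C}"
      then obtain g where g: "g \<in> fixer S X C" "y = g f" by blast
      obtain t k where tk: "t \<in> T" "k \<in> K" "g = t \<otimes>\<^bsub>G\<^esub> k" using T(3)[OF g(1)] by blast
      then have "t \<in> Aut S X" "k \<in> Aut S X" "f \<in> universe X"
        using f F(2) T(2) subgroup.subset[OF K] by blast+
      then have "y = t (k f)" using g tk(3) by simp
      then show "y \<in> (\<Union>t\<in>T. t ` {k f |k. k \<in> K})" using tk by blast
    qed
    moreover have "finite (\<Union>t\<in>T. t ` {k f |k. k \<in> K})" using T(1) F(4)[OF f(1)] by simp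
    ultimately show False using finite_subset by blast
  qed
  then show ?thesis using fixer_antimono F(3) by blast
qed

end


section \<open>A paradoxical pair of automorphisms\<close>

text \<open>
Each of the countably many requirements "the set \<open>W\<close> has a \<open>k\<close>-th point of colour \<open>i\<close>" is met by
a point of \<open>W\<close> which no earlier requirement has used.
\<close>

lemma generic_colouring:
  fixes \<W> :: "'a set set"
  assumes count: "countable \<W>" and inf: "\<And>W. W \<in> \<W> \<Longrightarrow> infinite W"
  shows "\<exists>c :: 'a \<Rightarrow> int. \<forall>W\<in>\<W>. \<forall>i. infinite {x \<in> W. c x = i}"
proof (cases "\<W> = {}")
  case False
  define P where "P = \<W> \<times> (UNIV :: int set) \<times> (UNIV :: nat set)"
  have P: "countable P" "P \<noteq> {}" using count False by (auto simp: P_def)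
  define e where "e = from_nat_into P"
  have e: "fst (e n) \<in> \<W>" for n
    using from_nat_into[OF P(2), of n] by (auto simp: e_def P_def)
  have "\<exists>f. \<forall>n. f n \<in> fst (e n) - f ` {..<n}"
  proof (rule dependent_wellorder_choice)
    show "r \<in> fst (e n) - f ` {..<n} \<longleftrightarrow> r \<in> fst (e n) - g ` {..<n}"
      if "\<And>m. m < n \<Longrightarrow> f m = g m" for r and f g :: "nat \<Rightarrow> 'a" and n
      using that by auto
    show "\<exists>r. r \<in> fst (e n) - f ` {..<n}" for n and f :: "nat \<Rightarrow> 'a"
    proof -
      have "infinite (fst (e n) - f ` {..<n})" using inf[OF e] by (rule Diff_infinite_finite[rotated]) simp
      then show ?thesis using infinite_imp_nonempty by blast
    qed
  qed
  then obtain f where f': "\<And>n. f n \<in> fst (e n) - f ` {..<n}" by blast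
  have f: "f n \<in> fst (e n)" "m < n \<Longrightarrow> f m \<noteq> f n" for m n
    using f' by (blast, metis DiffD2 f' imageI lessThan_iff)
  have inj: "inj f" using f(2) by (auto simp: inj_on_def) (metis linorder_neqE_nat)
  define c where "c x = fst (snd (e (inv_into UNIV f x)))" for x
  have c: "c (f n) = fst (snd (e n))" for n using inj by (simp add: c_def)
  have "infinite {x \<in> W. c x = i}" if W: "W \<in> \<W>" for W i
  proof -
    have "\<exists>n. e n = (W, i, k)" for k
      using from_nat_into_surj[OF P(1), of "(W, i, k)"] W by (auto simp: e_def P_def)
    then obtain n where n: "\<And>k. e (n k) = (W, i, k)" by metis
    have "inj n" using n by (metis injI prod.inject)
    then have "infinite (range (f \<circ> n))" using inj inj_compose range_inj_infinite by blast
    moreover have "f (n k) \<in> {x \<in> W. c x = i}" for k using f(1)[of "n k"] by (simp add: c n)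
    then have "range (f \<circ> n) \<subseteq> {x \<in> W. c x = i}" by auto
    ultimately show ?thesis using finite_subset by blast
  qed
  then show ?thesis by blast
qed auto

context weakly_eliminates_imaginaries
begin

text \<open>
The orbits in question are infinite, as there is no algebraicity, and there are countably many
of them, so \<open>generic_colouring\<close> provides such a colouring.
\<close>

definition generic :: "('a \<Rightarrow> int) \<Rightarrow> bool" where
  "generic c \<longleftrightarrow> (\<forall>A x i. finite A \<and> A \<subseteq> universe X \<and> x \<in> universe X - A \<longrightarrow>
     infinite {y. (\<exists>g\<in>fixer S X A. y = g x) \<and> c y = i})"

lemma generic_exists: "\<exists>c. generic c"
proof -
  define \<W> where "\<W> = {{g x |g. g \<in> fixer S X A} |A x. finite A \<and> A \<subseteq> universe X \<and> x \<in> universe X - A}"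
  have "\<W> \<subseteq> (\<lambda>(A, x). {g x |g. g \<in> fixer S X A}) ` ({A. A \<subseteq> universe X \<and> finite A} \<times> universe X)"
    by (auto simp: \<W>_def image_iff)
  moreover have "countable ({A. A \<subseteq> universe X \<and> finite A} \<times> universe X)"
    using U by (intro countable_SIGMA) (auto simp: countable_Collect_finite_subset Int_commute conj_commute)
  ultimately have "countable \<W>" by (meson countable_image countable_subset)
  moreover have "infinite W" if "W \<in> \<W>" for W
    using that infinite_orbit by (auto simp: \<W>_def)
  ultimately obtain c :: "'a \<Rightarrow> int" where c: "\<And>W i. W \<in> \<W> \<Longrightarrow> infinite {x \<in> W. c x = i}"
    using generic_colouring[of \<W>] by blast
  have "generic c"
    unfolding generic_def
  proof (intro allI impI)
    fix A x i assume *: "finite A \<and> A \<subseteq> universe X \<and> x \<in> universe X - A"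
    then have "{g x |g. g \<in> fixer S X A} \<in> \<W>" unfolding \<W>_def by blast
    from c[OF this] have "infinite {y \<in> {g x |g. g \<in> fixer S X A}. c y = i}" .
    moreover have "{y \<in> {g x |g. g \<in> fixer S X A}. c y = i} = {y. (\<exists>g\<in>fixer S X A. y = g x) \<and> c y = i}"
      by blast
    ultimately show "infinite {y. (\<exists>g\<in>fixer S X A. y = g x) \<and> c y = i}" by simp
  qed
  then show ?thesis by blast
qed

lemma genericD:
  assumes "generic c" "finite A" "A \<subseteq> universe X" "x \<in> universe X" "x \<notin> A"
  obtains g where "g \<in> fixer S X A" "c (g x) = i"
proof -
  have "infinite {y. (\<exists>g\<in>fixer S X A. y = g x) \<and> c y = i}"
    using assms unfolding generic_def by blast
  then have "{y. (\<exists>g\<in>fixer S X A. y = g x) \<and> c y = i} \<noteq> {}" using infinite_imp_nonempty by blast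
  then show ?thesis using that by blast
qed

text \<open>
A back-and-forth construction. When an automorphism, fixed so far on a finite set, has to be
decided at a new point, the possible images form an orbit of a stabilizer, and genericity
provides an image of an admissible colour. The same holds for preimages.
\<close>

lemma generic_automorphism:
  fixes c :: "'a \<Rightarrow> int" and R :: "int \<Rightarrow> int \<Rightarrow> bool"
  assumes c: "generic c" and left: "\<And>i. \<exists>j. R i j" and right: "\<And>j. \<exists>i. R i j"
  shows "\<exists>g\<in>Aut S X. \<forall>x\<in>universe X. R (c x) (c (g x))"
proof -
  let ?U = "universe X"
  \<comment> \<open>A pair \<open>(g, A)\<close> stands for the restriction of the automorphism \<open>g\<close> to the finite set \<open>A\<close>.\<close>
  define good where "good = (\<lambda>(g, A). g \<in> Aut S X \<and> finite A \<and> A \<subseteq> ?U \<and> (\<forall>x\<in>A. R (c x) (c (g x))))"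
  define ext where "ext = (\<lambda>(g :: 'a \<Rightarrow> 'a, A) (g', A'). A \<subseteq> A' \<and> (\<forall>x\<in>A. g' x = g x))"
  have forward: "\<exists>g'. good (g', insert x A) \<and> ext (g, A) (g', insert x A)"
    if good: "good (g, A)" and x: "x \<in> ?U" for g A x
  proof (cases "x \<in> A")
    case True
    then show ?thesis using good by (intro exI[of _ g]) (auto simp: good_def ext_def insert_absorb)
  next
    case False
    have g: "g \<in> Aut S X" and A: "finite A" "A \<subseteq> ?U" using good by (auto simp: good_def)
    have "g x \<notin> g ` A" using False x A(2) Aut_inj[OF g] by blast
    obtain j where j: "R (c x) j" using left by blast
    obtain h where h: "h \<in> fixer S X (g ` A)" "c (h (g x)) = j"
    proof (rule genericD[OF c])
      show "finite (g ` A)" "g ` A \<subseteq> ?U" using A g by auto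
      show "g x \<in> ?U" using g x by simp
    qed (use \<open>g x \<notin> g ` A\<close> in blast)+
    have hA: "h \<in> Aut S X" using h fixer_Aut by blast
    have eq: "(h \<otimes>\<^bsub>G\<^esub> g) y = h (g y)" if "y \<in> ?U" for y using hA g that by simp
    have "(h \<otimes>\<^bsub>G\<^esub> g) y = g y" if "y \<in> A" for y
    proof -
      have "y \<in> ?U" using that A(2) by blast
      then show ?thesis using eq h(1) that by (auto simp: fixer_def)
    qed
    then show ?thesis
      using good hA x j h(2) eq[OF x] by (intro exI[of _ "h \<otimes>\<^bsub>G\<^esub> g"]) (auto simp: good_def ext_def)
  qed
  have backward: "\<exists>g' x. good (g', insert x A) \<and> ext (g, A) (g', insert x A) \<and> g' x = y"
    if good: "good (g, A)" and y: "y \<in> ?U" for g A y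
  proof -
    have g: "g \<in> Aut S X" and A: "finite A" "A \<subseteq> ?U" using good by (auto simp: good_def)
    define x where "x = (inv\<^bsub>G\<^esub> g) y"
    have x: "x \<in> ?U" "g x = y" using g y Aut_closed[OF Aut_inv_closed[OF g] y] by (simp_all add: x_def)
    show ?thesis
    proof (cases "x \<in> A")
      case True
      then show ?thesis
        using good x by (intro exI[of _ g] exI[of _ x]) (auto simp: good_def ext_def insert_absorb)
    next
      case False
      obtain i where i: "R i (c y)" using right by blast
      obtain h where h: "h \<in> fixer S X A" "c (h x) = i"
        using genericD[OF c A x(1) False] by metis
      have hA: "h \<in> Aut S X" using h fixer_Aut by blast
      have hx: "h x \<in> ?U" using hA x(1) by simp
      have eq: "(g \<otimes>\<^bsub>G\<^esub> inv\<^bsub>G\<^esub> h) (h z) = g z" if "z \<in> ?U" for z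
        using hA g that by (rule Aut_mult_inv)
      have "(g \<otimes>\<^bsub>G\<^esub> inv\<^bsub>G\<^esub> h) z = g z" if "z \<in> A" for z
      proof -
        have "z \<in> ?U" "h z = z" using that A(2) h(1) by (auto simp: fixer_def)
        then show ?thesis using eq[of z] by metis
      qed
      moreover have "(g \<otimes>\<^bsub>G\<^esub> inv\<^bsub>G\<^esub> h) (h x) = y" using eq[OF x(1)] x(2) by simp
      moreover have "g \<otimes>\<^bsub>G\<^esub> inv\<^bsub>G\<^esub> h \<in> Aut S X" using g hA by simp
      ultimately show ?thesis
        using good i h(2) hx
        by (intro exI[of _ "g \<otimes>\<^bsub>G\<^esub> inv\<^bsub>G\<^esub> h"] exI[of _ "h x"]) (auto simp: good_def ext_def)
    qed
  qed
  define e where "e = from_nat_into ?U"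
  have eU: "e n \<in> ?U" for n using from_nat_into[OF ne] by (simp add: e_def)
  have "\<exists>s. \<forall>n. good (s n) \<and> (ext (s n) (s (Suc n)) \<and> e n \<in> snd (s (Suc n)) \<and>
      e n \<in> fst (s (Suc n)) ` snd (s (Suc n)))"
  proof (rule dependent_nat_choice)
    show "\<exists>p. good p"
      by (rule exI[of _ "(\<one>\<^bsub>G\<^esub>, {})"]) (simp add: good_def)
    fix p n assume p: "good p"
    obtain g A where gA: "p = (g, A)" by (cases p)
    obtain g1 where g1: "good (g1, insert (e n) A)" "ext (g, A) (g1, insert (e n) A)"
      using forward[of g A "e n"] p eU gA by blast
    obtain g2 x where g2: "good (g2, insert x (insert (e n) A))"
      "ext (g1, insert (e n) A) (g2, insert x (insert (e n) A))" "g2 x = e n"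
      using backward[OF g1(1) eU] by blast
    have "ext p (g2, insert x (insert (e n) A))" using g1(2) g2(2) gA by (auto simp: ext_def)
    then show "\<exists>q. good q \<and> (ext p q \<and> e n \<in> snd q \<and> e n \<in> fst q ` snd q)"
      using g2(1,3) by (intro exI[of _ "(g2, insert x (insert (e n) A))"]) auto
  qed
  then obtain s where s: "\<And>n. good (s n)" "\<And>n. ext (s n) (s (Suc n))" "\<And>n. e n \<in> snd (s (Suc n))"
    "\<And>n. e n \<in> fst (s (Suc n)) ` snd (s (Suc n))" by blast
  define g A where "g n = fst (s n)" and "A n = snd (s n)" for n
  have gA: "g n \<in> Aut S X" "finite (A n)" "A n \<subseteq> ?U" "\<And>x. x \<in> A n \<Longrightarrow> R (c x) (c (g n x))" for n
    using s(1)[of n] by (auto simp: good_def g_def A_def case_prod_beta)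
  have ext: "A m \<subseteq> A n \<and> (\<forall>x\<in>A m. g n x = g m x)" if "m \<le> n" for m n
    using that
  proof (induction n rule: dec_induct)
    case (step n)
    then show ?case using s(2)[of n] by (auto simp: ext_def g_def A_def case_prod_beta)
  qed simp
  have enum: "\<exists>n. e n = x" if "x \<in> ?U" for x
    using from_nat_into_surj[OF U that] by (simp add: e_def)
  then obtain k where k: "\<And>x. x \<in> ?U \<Longrightarrow> e (k x) = x" by metis
  define f where "f x = g (Suc (k x)) x" for x
  have f: "f x = g n x" if "x \<in> A n" for x n
  proof -
    have "x \<in> ?U" using gA(3) that by blast
    then have "x \<in> A (Suc (k x))" using s(3)[of "k x"] k[of x] by (simp add: A_def)
    then show ?thesis
      using ext[of n "max n (Suc (k x))"] ext[of "Suc (k x)" "max n (Suc (k x))"] that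
      by (auto simp: f_def)
  qed
  have fin: "\<exists>n. B \<subseteq> A n" if "finite B" "B \<subseteq> ?U" for B
    using that
  proof (induction B rule: finite_induct)
    case (insert x B)
    then obtain n where "B \<subseteq> A n" by blast
    moreover have "x \<in> A (Suc (k x))" using s(3)[of "k x"] k[of x] insert.prems by (simp add: A_def)
    ultimately show ?case
      using ext[of n "max n (Suc (k x))"] ext[of "Suc (k x)" "max n (Suc (k x))"]
      by (intro exI[of _ "max n (Suc (k x))"]) auto
  qed simp
  have agree: "\<exists>n. B \<subseteq> A n \<and> (\<forall>x\<in>B. f x = g n x)" if "finite B" "B \<subseteq> ?U" for B
    using fin[OF that] f by blast
  have "struct_iso S X X f"
    unfolding struct_iso_def bij_betw_def
  proof (intro conjI ballI)
    show "inj_on f ?U"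
    proof (rule inj_onI)
      fix x y assume xy: "x \<in> ?U" "y \<in> ?U" "f x = f y"
      then obtain n where "f x = g n x" "f y = g n y" using agree[of "{x, y}"] by auto
      then show "x = y" using xy Aut_inj[OF gA(1)[of n]] by metis
    qed
    show "f ` ?U = ?U"
    proof (intro equalityI subsetI)
      fix y assume "y \<in> f ` ?U"
      then obtain x where x: "x \<in> ?U" "y = f x" by blast
      then obtain n where "f x = g n x" using agree[of "{x}"] by auto
      then show "y \<in> ?U" using x Aut_closed[OF gA(1)[of n]] by simp
    next
      fix y assume "y \<in> ?U"
      then obtain x where "x \<in> A (Suc (k y))" "g (Suc (k y)) x = y"
        using s(4)[of "k y"] k by (auto simp: A_def g_def)
      then show "y \<in> f ` ?U" using f gA(3) by (metis imageI subsetD)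
    qed
    fix r xs assume r: "r \<in> symbols S" and xs: "xs \<in> tuples ?U (arity S r)"
    then have "finite (set xs)" "set xs \<subseteq> ?U" by (auto simp: tuples_def)
    then obtain n where "\<forall>x\<in>set xs. f x = g n x" using agree by blast
    then have "map f xs = map (g n) xs" by simp
    then show "xs \<in> rels X r \<longleftrightarrow> map f xs \<in> rels X r"
      using gA(1)[of n] r xs unfolding Aut_iff struct_iso_def by metis
  qed
  then have "restrict f ?U \<in> Aut S X" by (rule AutI)
  moreover have "R (c x) (c (restrict f ?U x))" if x: "x \<in> ?U" for x
  proof -
    obtain n where "x \<in> A n" "f x = g n x" using agree[of "{x}"] x by auto
    then show ?thesis using gA(4) x by simp
  qed
  ultimately show ?thesis by blast
qed

text \<open>
The two equivalences say that \<open>a\<close> sends the colours \<open>3k + 1\<close> and \<open>3k + 2\<close> to \<open>3k\<close>, and \<open>3k\<close> to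
\<open>3k - 2\<close> or \<open>3k - 1\<close>. They are stated for upper sets of colours, because these index the
projections to which they will be applied. Every colour is allowed as a target, as it has to be
for an automorphism.
\<close>

theorem paradoxical_automorphisms:
  "\<exists>c :: 'a \<Rightarrow> int. \<exists>a\<in>Aut S X. \<exists>b\<in>Aut S X. \<forall>x\<in>universe X. c (b x) = c x + 1 \<and>
    (\<forall>k. (3 * k \<le> c (a x) \<longleftrightarrow> 3 * k + 1 \<le> c x) \<and> (3 * k + 1 \<le> c (a x) \<longleftrightarrow> 3 * k + 3 \<le> c x))"
proof -
  obtain c where c: "generic c" using generic_exists by blast
  define R where "R i j \<longleftrightarrow> (\<forall>k. (3 * k \<le> j \<longleftrightarrow> 3 * k + 1 \<le> i) \<and> (3 * k + 1 \<le> j \<longleftrightarrow> 3 * k + 3 \<le> i))"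
    for i j :: int
  have R: "R (3 * k) (3 * k - 1)" "R (3 * k) (3 * k - 2)" "R (3 * k + 1) (3 * k)" "R (3 * k + 2) (3 * k)" for k
    unfolding R_def by presburger+
  have cases: "\<exists>k. i = 3 * k \<or> i = 3 * k + 1 \<or> i = 3 * k + 2" for i :: int by presburger
  have "\<exists>j. R i j" for i using cases[of i] R by blast
  moreover have "\<exists>i. R i j" for j
  proof -
    obtain k where "j = 3 * k \<or> j = 3 * (k + 1) - 2 \<or> j = 3 * (k + 1) - 1"
      using cases[of j] by (auto simp: algebra_simps)
    then show ?thesis using R by blast
  qed
  ultimately obtain a where "a \<in> Aut S X" "\<forall>x\<in>universe X. R (c x) (c (a x))"
    using generic_automorphism[OF c, of R] by blast
  moreover obtain b where "b \<in> Aut S X" "\<forall>x\<in>universe X. c (b x) = c x + 1"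
    using generic_automorphism[OF c, of "\<lambda>i j. j = i + 1"] by (metis diff_add_cancel)
  ultimately show ?thesis unfolding R_def by blast
qed

end


section \<open>The real inner product of a Hilbert space\<close>

context complex_inner_product_space
begin

text \<open>
The real part of the inner product determines the norm and orthogonal projections, and spares
the discussion of complex values of Gram matrices.
\<close>

definition rip :: "'h \<Rightarrow> 'h \<Rightarrow> real" where
  "rip x y = Re (ip H x y)"

lemma rip_commute: "\<lbrakk>x \<in> carrier H; y \<in> carrier H\<rbrakk> \<Longrightarrow> rip x y = rip y x"
  unfolding rip_def by (rule Re_ip_commute)

lemma rip_add_left:
  "\<lbrakk>x \<in> carrier H; y \<in> carrier H; z \<in> carrier H\<rbrakk> \<Longrightarrow> rip (x \<oplus> y) z = rip x z + rip y z"
  by (simp add: rip_def ip_add)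

definition rscale :: "real \<Rightarrow> 'h \<Rightarrow> 'h" where
  "rscale r x = complex_of_real r \<odot> x"

lemma rscale_closed [simp]: "x \<in> carrier H \<Longrightarrow> rscale r x \<in> carrier H"
  by (simp add: rscale_def)

lemma rip_scale_left:
  "\<lbrakk>x \<in> carrier H; z \<in> carrier H\<rbrakk> \<Longrightarrow> rip (rscale r x) z = r * rip x z"
  by (simp add: rip_def rscale_def ip_smult)

lemma minus_eq_rscale: "\<lbrakk>x \<in> carrier H; y \<in> carrier H\<rbrakk> \<Longrightarrow> x \<ominus> y = x \<oplus> rscale (-1) y"
  by (simp add: minus_eq_smult rscale_def)

lemma minus_closed [simp]: "\<lbrakk>x \<in> carrier H; y \<in> carrier H\<rbrakk> \<Longrightarrow> x \<ominus> y \<in> carrier H"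
  by (simp add: minus_eq_smult)

lemma ominus_oplus_cancel: "\<lbrakk>x \<in> carrier H; y \<in> carrier H\<rbrakk> \<Longrightarrow> (x \<ominus> y) \<oplus> y = x"
  by (simp add: a_minus_def M.a_assoc M.l_neg)

lemma rip_minus_left:
  "\<lbrakk>x \<in> carrier H; y \<in> carrier H; z \<in> carrier H\<rbrakk> \<Longrightarrow> rip (x \<ominus> y) z = rip x z - rip y z"
  by (simp add: minus_eq_rscale rip_add_left rip_scale_left)

lemma rip_add_right:
  "\<lbrakk>x \<in> carrier H; y \<in> carrier H; z \<in> carrier H\<rbrakk> \<Longrightarrow> rip z (x \<oplus> y) = rip z x + rip z y"
  by (simp add: rip_commute[of z] rip_add_left)

lemma rip_scale_right:
  "\<lbrakk>x \<in> carrier H; z \<in> carrier H\<rbrakk> \<Longrightarrow> rip z (rscale r x) = r * rip z x"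
  by (simp add: rip_commute[of z] rip_scale_left)

lemma rip_minus_right:
  "\<lbrakk>x \<in> carrier H; y \<in> carrier H; z \<in> carrier H\<rbrakk> \<Longrightarrow> rip z (x \<ominus> y) = rip z x - rip z y"
  by (simp add: rip_commute[of z] rip_minus_left)

lemmas rip_simps = rip_add_left rip_add_right rip_scale_left rip_scale_right rip_minus_left rip_minus_right

lemma rip_self: "x \<in> carrier H \<Longrightarrow> rip x x = (hnorm H x)\<^sup>2"
  by (simp add: rip_def hnorm_power2)

lemma rip_self_nonneg: "x \<in> carrier H \<Longrightarrow> 0 \<le> rip x x"
  by (simp add: rip_self)

lemma rip_self_eq_0: "x \<in> carrier H \<Longrightarrow> rip x x = 0 \<longleftrightarrow> x = \<zero>"
  by (simp add: rip_self hnorm_eq_0)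

lemma rip_zero_left: "y \<in> carrier H \<Longrightarrow> rip \<zero> y = 0"
  using rip_minus_left[of y y y] minus_eq_0[of y y] by simp

lemma rip_minus_self:
  "\<lbrakk>x \<in> carrier H; y \<in> carrier H\<rbrakk> \<Longrightarrow> rip (x \<ominus> y) (x \<ominus> y) = rip x x - 2 * rip x y + rip y y"
  by (simp add: rip_simps rip_commute[of y x])

lemma rip_Cauchy_Schwarz:
  assumes "x \<in> carrier H" "y \<in> carrier H"
  shows "\<bar>rip x y\<bar> \<le> hnorm H x * hnorm H y"
proof -
  have "rip (rscale (-1) x) y \<le> hnorm H (rscale (-1) x) * hnorm H y"
    unfolding rip_def using assms by (intro Re_Cauchy_Schwarz) auto
  then have "- rip x y \<le> hnorm H x * hnorm H y"
    using assms rip_scale_left[of x y "-1"] by (simp add: rscale_def hnorm_smult)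
  moreover have "rip x y \<le> hnorm H x * hnorm H y"
    unfolding rip_def using assms by (rule Re_Cauchy_Schwarz)
  ultimately show ?thesis by linarith
qed

lemma rip_limit:
  assumes lim: "(\<lambda>n. hdist H (y n) z) \<longlonglongrightarrow> 0" and y: "\<And>n. y n \<in> carrier H" and z: "z \<in> carrier H"
    and t: "t \<in> carrier H"
  shows "(\<lambda>n. rip (y n) t) \<longlonglongrightarrow> rip z t"
proof -
  have "(\<lambda>n. rip (y n) t - rip z t) \<longlonglongrightarrow> 0"
  proof (rule Lim_null_comparison)
    show "\<forall>\<^sub>F n in sequentially. norm (rip (y n) t - rip z t) \<le> hdist H (y n) z * hnorm H t"
      using rip_Cauchy_Schwarz[of "y _ \<ominus> z" t] y z t
      by (intro always_eventually) (simp add: hdist_eq rip_minus_left)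
    show "(\<lambda>n. hdist H (y n) z * hnorm H t) \<longlonglongrightarrow> 0"
      using tendsto_mult_left_zero[OF lim] .
  qed
  then show ?thesis by (simp add: LIM_zero_iff)
qed

text \<open>
The vectors \<open>u n\<close> are \<open>t\<close> minus its orthogonal projection onto the span of \<open>z 0, \<dots>, z (n - 1)\<close>.
\<close>

lemma Bessel:
  fixes z :: "nat \<Rightarrow> 'h"
  assumes z: "\<And>n. z n \<in> carrier H" and orth: "\<And>m n. m \<noteq> n \<Longrightarrow> rip (z m) (z n) = 0"
    and D: "\<And>n. rip (z n) (z n) = D" "D > 0" and t: "t \<in> carrier H"
  shows "(\<Sum>k<n. (rip (z k) t)\<^sup>2) \<le> D * rip t t"
proof -
  define u where "u = rec_nat t (\<lambda>n u. u \<ominus> rscale (rip (z n) t / D) (z n))"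
  have u0: "u 0 = t" and uS: "u (Suc n) = u n \<ominus> rscale (rip (z n) t / D) (z n)" for n
    by (simp_all add: u_def)
  have uH: "u n \<in> carrier H" for n
    by (induction n) (auto simp: u0 uS t z)
  have zu: "rip (z m) (u n) = (if m < n then 0 else rip (z m) t)" for m n
    using D by (induction n) (auto simp: u0 uS rip_simps uH z orth t less_Suc_eq)
  have "rip (u n) (u n) = rip t t - (\<Sum>k<n. (rip (z k) t)\<^sup>2) / D" for n
  proof (induction n)
    case (Suc n)
    define q where "q = rip (z n) t"
    have *: "rip (u n) (rscale (q / D) (z n)) = q / D * q"
      using rip_commute[OF uH[of n] z[of n]] zu[of n n] uH z by (simp add: rip_simps q_def)
    have "rip (rscale (q / D) (z n)) (rscale (q / D) (z n)) = q / D * q"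
      using D z by (simp add: rip_simps)
    then have "rip (u (Suc n)) (u (Suc n)) = rip (u n) (u n) - q\<^sup>2 / D"
      unfolding uS using rip_minus_self[OF uH[of n], of "rscale (q / D) (z n)"] z *
      by (simp add: q_def power2_eq_square)
    then show ?case using Suc by (simp add: q_def diff_divide_distrib add_divide_distrib)
  qed (simp add: u0)
  then have "0 \<le> rip t t - (\<Sum>k<n. (rip (z k) t)\<^sup>2) / D"
    using rip_self_nonneg[OF uH, of n] by simp
  then show ?thesis using D by (simp add: field_simps)
qed

end

context complex_hilbert_space
begin

lemma Cauchy_limit:
  assumes y: "\<And>n. y n \<in> carrier H"
    and C: "\<And>m n. m \<le> n \<Longrightarrow> rip (y m \<ominus> y n) (y m \<ominus> y n) \<le> K / real (Suc m)"
  obtains z where "z \<in> carrier H" "(\<lambda>n. hdist H (y n) z) \<longlonglongrightarrow> 0"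
proof -
  have "metric.MCauchy y"
    unfolding metric.MCauchy_def
  proof (intro conjI allI impI)
    show "range y \<subseteq> carrier H" using y by blast
    fix e :: real assume e: "0 < e"
    obtain N where N: "\<bar>K\<bar> / real (Suc N) < e\<^sup>2"
    proof -
      obtain N where "\<bar>K\<bar> / e\<^sup>2 < real N" using reals_Archimedean2 by blast
      then have "\<bar>K\<bar> < e\<^sup>2 * real (Suc N)"
        using e by (simp add: divide_less_eq mult.commute distrib_right add_strict_increasing)
      then show ?thesis using that[of N] by (simp add: divide_less_eq mult.commute del: of_nat_Suc)
    qed
    have small: "hdist H (y m) (y n) < e" if "N \<le> m" "m \<le> n" for m n
    proof -
      have "(hdist H (y m) (y n))\<^sup>2 \<le> K / real (Suc m)"
        using C[OF that(2)] y by (simp add: hdist_eq rip_self)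
      also have "\<dots> \<le> \<bar>K\<bar> / real (Suc N)"
        using that(1) by (intro frac_le) auto
      also have "\<dots> < e\<^sup>2" by (rule N)
      finally show ?thesis using e by (simp add: power2_less_imp_less)
    qed
    show "\<exists>N. \<forall>n n'. N \<le> n \<longrightarrow> N \<le> n' \<longrightarrow> hdist H (y n) (y n') < e"
    proof (intro exI[of _ N] allI impI)
      fix n n' assume "N \<le> n" "N \<le> n'"
      then show "hdist H (y n) (y n') < e"
        using small[of n n'] small[of n' n] metric.commute[of "y n" "y n'"] by (cases "n \<le> n'") auto
    qed
  qed
  then obtain z where "limitin (hilbert_topology H) y z sequentially"
    using complete unfolding metric.mcomplete_def by blast
  then have "z \<in> carrier H" "(\<lambda>n. hdist H (y n) z) \<longlonglongrightarrow> 0"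
    using metric.limitin_metric_dist_null by auto
  then show ?thesis by (rule that)
qed

text \<open>
A sequence with constant Gram matrix off the diagonal converges weakly. Its Cesaro means
converge in norm to a vector \<open>\<eta>\<close>; the differences from \<open>\<eta>\<close> are pairwise orthogonal of equal
norm, so they tend weakly to zero by Bessel's inequality.
\<close>

lemma constant_gram_limit:
  assumes x: "\<And>n. x n \<in> carrier H" and c: "\<And>m n. m \<noteq> n \<Longrightarrow> rip (x m) (x n) = c"
    and d: "\<And>n. rip (x n) (x n) = d"
  shows "\<exists>\<eta>\<in>carrier H. rip \<eta> \<eta> = c \<and> (\<forall>t\<in>carrier H. (\<lambda>n. rip (x n) t) \<longlonglongrightarrow> rip \<eta> t)"
proof -
  define s where "s = rec_nat \<zero> (\<lambda>n s. s \<oplus> x n)"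
  have s0: "s 0 = \<zero>" and sS: "s (Suc n) = s n \<oplus> x n" for n
    by (simp_all add: s_def)
  have sH: "s n \<in> carrier H" for n
    by (induction n) (auto simp: s0 sS x)
  have sx: "rip (s n) (x m) = n * c + (if m < n then d - c else 0)" for m n
    by (induction n) (auto simp: s0 sS rip_simps sH x c d rip_zero_left algebra_simps less_Suc_eq)
  have ss: "rip (s m) (s n) = m * n * c + m * (d - c)" if "m \<le> n" for m n
    using that
  proof (induction m)
    case (Suc m)
    have "rip (x m) (s n) = n * c + (d - c)"
      using Suc.prems sx[of n m] rip_commute[OF x sH] by simp
    then show ?case using Suc by (simp add: sS rip_simps sH x algebra_simps)
  qed (simp add: s0 rip_zero_left sH)
  \<comment> \<open>The Cesaro means.\<close>
  define y where "y n = rscale (1 / real (Suc n)) (s (Suc n))" for n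
  have yH: "y n \<in> carrier H" for n by (simp add: y_def sH)
  have yt: "rip (y n) t = rip (s (Suc n)) t / real (Suc n)" if "t \<in> carrier H" for n t
    using that by (simp add: y_def rip_simps sH)
  have yy: "rip (y m) (y n) = c + (d - c) / real (Suc n)" if "m \<le> n" for m n
  proof -
    have "rip (y m) (y n) = rip (s (Suc m)) (s (Suc n)) / (real (Suc m) * real (Suc n))"
      unfolding y_def using sH by (simp add: rip_simps del: of_nat_Suc)
    also have "\<dots> = c + (d - c) / real (Suc n)"
      using ss[of "Suc m" "Suc n"] that by (simp add: field_simps del: of_nat_Suc)
    finally show ?thesis .
  qed
  have dc: "c \<le> d"
    using rip_self_nonneg[of "x 0 \<ominus> x 1"] rip_minus_self[of "x 0" "x 1"] x c[of 0 1] d by simp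
  have diff: "rip (y m \<ominus> y n) (y m \<ominus> y n) \<le> (d - c) / real (Suc m)" if "m \<le> n" for m n
    using rip_minus_self[OF yH yH, of m n] yy[OF that] yy[of m m] yy[of n n]
      divide_right_mono[OF dc, of "real (Suc n)"]
    by (simp add: diff_divide_distrib)
  obtain \<eta> where \<eta>: "\<eta> \<in> carrier H" "(\<lambda>n. hdist H (y n) \<eta>) \<longlonglongrightarrow> 0"
    using Cauchy_limit[of y "d - c"] yH diff by blast
  note lim = rip_limit[OF \<eta>(2) yH \<eta>(1)]
  have inv: "(\<lambda>n. K / real (Suc n)) \<longlonglongrightarrow> 0" for K
    using LIMSEQ_Suc[OF lim_const_over_n[of K]] by simp
  have \<eta>x: "rip (x m) \<eta> = c" for m
  proof -
    have "\<forall>\<^sub>F n in sequentially. rip (y n) (x m) = c + (d - c) / real (Suc n)"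
      using eventually_ge_at_top[of m]
    proof eventually_elim
      case (elim n)
      then show ?case using yt[OF x, of n m] sx[of "Suc n" m] by (simp add: add_divide_distrib)
    qed
    moreover have "(\<lambda>n. c + (d - c) / real (Suc n)) \<longlonglongrightarrow> c"
      using tendsto_add[OF tendsto_const[of c] inv[of "d - c"]] by simp
    ultimately have "(\<lambda>n. rip (y n) (x m)) \<longlonglongrightarrow> c"
      using tendsto_cong by force
    with lim[OF x] have "rip \<eta> (x m) = c" using LIMSEQ_unique by blast
    then show ?thesis using rip_commute \<eta>(1) x by simp
  qed
  have s\<eta>: "rip (s n) \<eta> = n * c" for n
    by (induction n) (auto simp: s0 sS rip_simps sH x \<eta> \<eta>x rip_zero_left algebra_simps)
  have "rip (y n) \<eta> = c" for n using yt[OF \<eta>(1)] s\<eta>[of "Suc n"] by simp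
  then have \<eta>\<eta>: "rip \<eta> \<eta> = c" using lim[OF \<eta>(1)] by (simp add: LIMSEQ_const_iff)
  define z where "z n = x n \<ominus> \<eta>" for n
  have zH: "z n \<in> carrier H" for n by (simp add: z_def x \<eta>)
  have zz: "rip (z m) (z n) = (if m = n then d - c else 0)" for m n
    using \<eta>x rip_commute[OF \<eta>(1) x] by (simp add: z_def rip_simps x \<eta> \<eta>\<eta> c d)
  have z0: "(\<lambda>n. rip (z n) t) \<longlonglongrightarrow> 0" if t: "t \<in> carrier H" for t
  proof (cases "c = d")
    case True
    then have "z n = \<zero>" for n using zz[of n n] rip_self_eq_0[OF zH] by simp
    then show ?thesis using t by (simp add: rip_zero_left)
  next
    case False
    then have "(\<Sum>k<n. (rip (z k) t)\<^sup>2) \<le> (d - c) * rip t t" for n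
      using dc zz by (intro Bessel zH t) auto
    then have "summable (\<lambda>k. (rip (z k) t)\<^sup>2)"
      by (intro summableI_nonneg_bounded) auto
    then have "(\<lambda>k. (rip (z k) t)\<^sup>2) \<longlonglongrightarrow> 0" by (rule summable_LIMSEQ_zero)
    then show ?thesis by (simp add: power_tendsto_0_iff)
  qed
  have "(\<lambda>n. rip (x n) t) \<longlonglongrightarrow> rip \<eta> t" if t: "t \<in> carrier H" for t
    using z0[OF t] by (simp add: z_def rip_simps x \<eta> t LIM_zero_iff)
  then show ?thesis using \<eta>(1) \<eta>\<eta> by blast
qed

text \<open>
By the parallelogram law, centres of two balls which contain \<open>B\<close> and whose radii are nearly
minimal are close to each other. Hence a minimal ball exists, and it is unique. Radii appear
squared.
\<close>

lemma circumcentre: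
  assumes O: "B \<subseteq> carrier H" "B \<noteq> {}" and \<xi>: "\<xi> \<in> carrier H" "\<And>b. b \<in> B \<Longrightarrow> rip (\<xi> \<ominus> b) (\<xi> \<ominus> b) \<le> \<rho>"
  shows "\<exists>r\<le>\<rho>. \<exists>!z. z \<in> carrier H \<and> (\<forall>b\<in>B. rip (z \<ominus> b) (z \<ominus> b) \<le> r)"
proof -
  define Q where "Q r z \<longleftrightarrow> z \<in> carrier H \<and> (\<forall>b\<in>B. rip (z \<ominus> b) (z \<ominus> b) \<le> r)" for r z
  define R where "R = {r. \<exists>z. Q r z}"
  have BH: "b \<in> carrier H" if "b \<in> B" for b using O that by blast
  have bdd: "bdd_below R"
  proof (rule bdd_belowI)
    fix r assume "r \<in> R"
    then obtain z where z: "Q r z" by (auto simp: R_def)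
    obtain b where "b \<in> B" using O by blast
    then show "0 \<le> r" using z rip_self_nonneg[of "z \<ominus> b"] BH by (fastforce simp: Q_def)
  qed
  have \<rho>: "\<rho> \<in> R" using \<xi> by (auto simp: R_def Q_def)
  define r where "r = Inf R"
  have r_le: "r \<le> r'" if "Q r' z" for r' z
    unfolding r_def using bdd that by (intro cInf_lower) (auto simp: R_def)
  have near: "rip (z \<ominus> z') (z \<ominus> z') \<le> 2 * (q + q' - 2 * r)" if z: "Q q z" and z': "Q q' z'" for z z' q q'
  proof -
    have zH: "z \<in> carrier H" "z' \<in> carrier H" using z z' by (auto simp: Q_def)
    define m where "m = rscale (1 / 2) z \<oplus> rscale (1 / 2) z'"
    have mH: "m \<in> carrier H" by (simp add: m_def zH)
    have m: "rip m t = (rip z t + rip z' t) / 2" if "t \<in> carrier H" for t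
      using zH that by (simp add: m_def rip_simps)
    have "rip (m \<ominus> b) (m \<ominus> b) \<le> (q + q') / 2 - rip (z \<ominus> z') (z \<ominus> z') / 4" if b: "b \<in> B" for b
    proof -
      have "rip m m = (rip m z + rip m z') / 2"
        using m[OF mH] rip_commute[OF mH] zH by simp
      then have "rip (m \<ominus> b) (m \<ominus> b) =
        rip (z \<ominus> b) (z \<ominus> b) / 2 + rip (z' \<ominus> b) (z' \<ominus> b) / 2 - rip (z \<ominus> z') (z \<ominus> z') / 4"
        using zH BH[OF b] rip_commute[of z z'] mH by (simp add: rip_minus_self m field_simps)
      moreover have "rip (z \<ominus> b) (z \<ominus> b) \<le> q" "rip (z' \<ominus> b) (z' \<ominus> b) \<le> q'"
        using z z' b by (auto simp: Q_def)
      ultimately show ?thesis by argo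
    qed
    then have "Q ((q + q') / 2 - rip (z \<ominus> z') (z \<ominus> z') / 4) m" using mH by (simp add: Q_def)
    from r_le[OF this] have "4 * r \<le> 2 * (q + q') - rip (z \<ominus> z') (z \<ominus> z')"
      by (simp add: field_simps)
    then show ?thesis by (simp add: algebra_simps)
  qed
  have "\<exists>z. Q (r + 1 / real (Suc n)) z" for n
  proof -
    have "r < r + 1 / real (Suc n)" by simp
    then obtain q where "q \<in> R" "q < r + 1 / real (Suc n)"
      using cInf_lessD[of R] \<rho> unfolding r_def by blast
    then show ?thesis unfolding R_def Q_def by (force intro: order_trans less_imp_le)
  qed
  then obtain y where y: "\<And>n. Q (r + 1 / real (Suc n)) (y n)" by metis
  then have yH: "y n \<in> carrier H" for n by (simp add: Q_def)
  have "rip (y m \<ominus> y n) (y m \<ominus> y n) \<le> 4 / real (Suc m)" if "m \<le> n" for m n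
  proof -
    have "1 / real (Suc n) \<le> 1 / real (Suc m)" using that by (simp add: frac_le)
    then show ?thesis using near[OF y[of m] y[of n]] by (simp del: of_nat_Suc)
  qed
  then obtain z where z: "z \<in> carrier H" "(\<lambda>n. hdist H (y n) z) \<longlonglongrightarrow> 0"
    using Cauchy_limit[of y 4] yH by blast
  have "r \<le> \<rho>" unfolding r_def using bdd \<rho> by (rule cInf_lower[rotated])
  have "Q r z"
    unfolding Q_def
  proof (intro conjI ballI z(1))
    fix b assume b: "b \<in> B"
    note lim = rip_limit[OF z(2) yH z(1)]
    have "rip (z \<ominus> b) (z \<ominus> b) \<le> r + 1 / real (Suc n) + 2 * (rip z (z \<ominus> b) - rip (y n) (z \<ominus> b))" for n
    proof -
      have "0 \<le> rip (y n \<ominus> z) (y n \<ominus> z)" using yH z by (intro rip_self_nonneg) simp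
      moreover have "rip (y n \<ominus> b) (y n \<ominus> b) \<le> r + 1 / real (Suc n)" using y[of n] b by (simp add: Q_def)
      ultimately show ?thesis
        using yH[of n] z(1) BH[OF b] rip_commute[of z "y n"] rip_commute[of z b] rip_commute[of "y n" b]
        by (simp add: rip_simps)
    qed
    moreover have "(\<lambda>n. r + 1 / real (Suc n) + 2 * (rip z (z \<ominus> b) - rip (y n) (z \<ominus> b)))
        \<longlonglongrightarrow> r + 0 + 2 * (rip z (z \<ominus> b) - rip z (z \<ominus> b))"
      using z(1) BH[OF b] LIMSEQ_Suc[OF lim_const_over_n[of 1]]
      by (intro tendsto_intros lim) auto
    ultimately show "rip (z \<ominus> b) (z \<ominus> b) \<le> r"
      by (intro LIMSEQ_le_const[of "\<lambda>n. r + 1 / real (Suc n) + 2 * (rip z (z \<ominus> b) - rip (y n) (z \<ominus> b))"]) auto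
  qed
  moreover have "z' = z" if "Q r z'" for z'
  proof -
    have "rip (z' \<ominus> z) (z' \<ominus> z) \<le> 0" using near[OF that \<open>Q r z\<close>] by simp
    moreover have "z' \<in> carrier H" using that by (simp add: Q_def)
    ultimately show ?thesis
      using rip_self_nonneg[of "z' \<ominus> z"] rip_self_eq_0[of "z' \<ominus> z"] minus_eq_0[of z' z] z(1) by force
  qed
  ultimately have "\<exists>!z. Q r z" by (intro ex1I)
  with \<open>r \<le> \<rho>\<close> show ?thesis unfolding Q_def by (intro exI[of _ r] conjI)
qed

end


section \<open>Weak limits of orbits\<close>

locale unitary_rep = complex_hilbert_space H + G: group G
  for H :: "'h hilbert_space" (structure) and G :: "('g, 'b) monoid_scheme" +
  fixes T :: "'g topology" and \<pi> :: "'g \<Rightarrow> 'h \<Rightarrow> 'h"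
  assumes rep: "unitary_representation G T H \<pi>"
begin

lemmas repD = unitary_representationD[OF rep G.group_axioms]

lemma rep_closed [simp]: "\<lbrakk>g \<in> carrier G; x \<in> carrier H\<rbrakk> \<Longrightarrow> \<pi> g x \<in> carrier H"
  by (rule repD(3))

lemma rep_rip: "\<lbrakk>g \<in> carrier G; x \<in> carrier H; y \<in> carrier H\<rbrakk> \<Longrightarrow> rip (\<pi> g x) (\<pi> g y) = rip x y"
  by (simp add: rip_def repD(6))

lemma rep_mult: "\<lbrakk>g \<in> carrier G; h \<in> carrier G; x \<in> carrier H\<rbrakk> \<Longrightarrow> \<pi> (g \<otimes>\<^bsub>G\<^esub> h) x = \<pi> g (\<pi> h x)"
  by (rule repD(7))

lemma rep_one [simp]: "x \<in> carrier H \<Longrightarrow> \<pi> \<one>\<^bsub>G\<^esub> x = x"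
  by (rule repD(8))

lemma rep_inv [simp]:
  assumes "g \<in> carrier G" "x \<in> carrier H"
  shows "\<pi> g (\<pi> (inv\<^bsub>G\<^esub> g) x) = x" "\<pi> (inv\<^bsub>G\<^esub> g) (\<pi> g x) = x"
  using assms rep_mult[of g "inv\<^bsub>G\<^esub> g" x] rep_mult[of "inv\<^bsub>G\<^esub> g" g x] by simp_all

lemma rep_adjoint:
  assumes "g \<in> carrier G" "x \<in> carrier H" "y \<in> carrier H"
  shows "rip (\<pi> g x) y = rip x (\<pi> (inv\<^bsub>G\<^esub> g) y)"
  using rep_rip[of g x "\<pi> (inv\<^bsub>G\<^esub> g) y"] assms by simp

lemma rep_minus:
  "\<lbrakk>g \<in> carrier G; x \<in> carrier H; y \<in> carrier H\<rbrakk> \<Longrightarrow> \<pi> g (x \<ominus> y) = \<pi> g x \<ominus> \<pi> g y"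
  by (simp add: minus_eq_smult repD(4,5))

lemma rep_hnorm: "\<lbrakk>g \<in> carrier G; x \<in> carrier H\<rbrakk> \<Longrightarrow> hnorm H (\<pi> g x) = hnorm H x"
  by (simp add: hnorm_def repD(6))

text \<open>
\<open>\<eta>\<close> lies in the weak closure of the \<open>\<Gamma>\<close>-orbit of \<open>\<xi>\<close>.
\<close>

definition wlim :: "'g set \<Rightarrow> 'h \<Rightarrow> 'h \<Rightarrow> bool" where
  "wlim \<Gamma> \<xi> \<eta> \<longleftrightarrow> \<eta> \<in> carrier H \<and> (\<forall>F e. finite F \<and> F \<subseteq> carrier H \<and> 0 < e \<longrightarrow>
     (\<exists>g\<in>\<Gamma>. \<forall>t\<in>F. \<bar>rip (\<pi> g \<xi>) t - rip \<eta> t\<bar> < e))"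

lemma wlim_carrier: "wlim \<Gamma> \<xi> \<eta> \<Longrightarrow> \<eta> \<in> carrier H"
  by (simp add: wlim_def)

lemma wlimD:
  assumes "wlim \<Gamma> \<xi> \<eta>" "finite F" "F \<subseteq> carrier H" "0 < e"
  shows "\<exists>g\<in>\<Gamma>. \<forall>t\<in>F. \<bar>rip (\<pi> g \<xi>) t - rip \<eta> t\<bar> < e"
  using assms unfolding wlim_def by blast

lemma wlim_orbit: "\<lbrakk>\<Gamma> \<subseteq> carrier G; g \<in> \<Gamma>; \<xi> \<in> carrier H\<rbrakk> \<Longrightarrow> wlim \<Gamma> \<xi> (\<pi> g \<xi>)"
  by (auto simp: wlim_def intro!: bexI[of _ g])

lemma wlim_trans:
  assumes \<Gamma>: "subgroup \<Gamma> G" and \<xi>: "\<xi> \<in> carrier H" and 1: "wlim \<Gamma> \<xi> \<eta>" and 2: "wlim \<Gamma> \<eta> \<zeta>"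
  shows "wlim \<Gamma> \<xi> \<zeta>"
  unfolding wlim_def
proof (intro conjI allI impI; (elim conjE)?)
  show "\<zeta> \<in> carrier H" using 2 by (rule wlim_carrier)
  have \<eta>: "\<eta> \<in> carrier H" using 1 by (rule wlim_carrier)
  fix F and e :: real assume F: "finite F" "F \<subseteq> carrier H" and e: "0 < e"
  obtain h where h: "h \<in> \<Gamma>" "\<forall>t\<in>F. \<bar>rip (\<pi> h \<eta>) t - rip \<zeta> t\<bar> < e / 2"
    using wlimD[OF 2 F half_gt_zero[OF e]] by blast
  have hG: "h \<in> carrier G" using h subgroup.subset[OF \<Gamma>] by blast
  have "finite (\<pi> (inv\<^bsub>G\<^esub> h) ` F)" "\<pi> (inv\<^bsub>G\<^esub> h) ` F \<subseteq> carrier H" using F hG by auto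
  from wlimD[OF 1 this half_gt_zero[OF e]]
  obtain g where g': "g \<in> \<Gamma>" "\<forall>t\<in>\<pi> (inv\<^bsub>G\<^esub> h) ` F. \<bar>rip (\<pi> g \<xi>) t - rip \<eta> t\<bar> < e / 2"
    by (rule bexE)
  then have g: "g \<in> \<Gamma>"
    "\<forall>t\<in>F. \<bar>rip (\<pi> g \<xi>) (\<pi> (inv\<^bsub>G\<^esub> h) t) - rip \<eta> (\<pi> (inv\<^bsub>G\<^esub> h) t)\<bar> < e / 2"
    by simp_all
  have gG: "g \<in> carrier G" using g subgroup.subset[OF \<Gamma>] by blast
  have "\<bar>rip (\<pi> (h \<otimes>\<^bsub>G\<^esub> g) \<xi>) t - rip \<zeta> t\<bar> < e" if t: "t \<in> F" for t
  proof -
    have tH: "t \<in> carrier H" using t F by blast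
    have "rip (\<pi> (h \<otimes>\<^bsub>G\<^esub> g) \<xi>) t = rip (\<pi> g \<xi>) (\<pi> (inv\<^bsub>G\<^esub> h) t)"
      using hG gG \<xi> tH by (simp add: rep_mult rep_adjoint[of h])
    moreover have "rip (\<pi> h \<eta>) t = rip \<eta> (\<pi> (inv\<^bsub>G\<^esub> h) t)"
      using hG \<eta> tH by (simp add: rep_adjoint)
    ultimately show ?thesis using bspec[OF h(2) t] bspec[OF g(2) t] by linarith
  qed
  then show "\<exists>g\<in>\<Gamma>. \<forall>t\<in>F. \<bar>rip (\<pi> g \<xi>) t - rip \<zeta> t\<bar> < e"
    using subgroup.m_closed[OF \<Gamma> h(1) g(1)] by blast
qed

lemma wlim_mono: "\<lbrakk>wlim \<Gamma> \<xi> \<eta>; \<Gamma> \<subseteq> \<Gamma>'\<rbrakk> \<Longrightarrow> wlim \<Gamma>' \<xi> \<eta>"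
  unfolding wlim_def by blast

lemma wlim_limit:
  fixes x :: "nat \<Rightarrow> 'h"
  assumes x: "\<And>n. wlim \<Gamma> \<xi> (x n)" and \<eta>: "\<eta> \<in> carrier H"
    and lim: "\<And>t. t \<in> carrier H \<Longrightarrow> (\<lambda>n. rip (x n) t) \<longlonglongrightarrow> rip \<eta> t"
  shows "wlim \<Gamma> \<xi> \<eta>"
  unfolding wlim_def
proof (intro conjI allI impI \<eta>; (elim conjE)?)
  fix F and e :: real assume F: "finite F" "F \<subseteq> carrier H" and e: "0 < e"
  have "\<forall>\<^sub>F n in sequentially. \<forall>t\<in>F. \<bar>rip (x n) t - rip \<eta> t\<bar> < e / 2"
  proof (intro eventually_ball_finite F ballI)
    fix t assume "t \<in> F"
    then have "(\<lambda>n. rip (x n) t) \<longlonglongrightarrow> rip \<eta> t" using F lim by blast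
    then show "\<forall>\<^sub>F n in sequentially. \<bar>rip (x n) t - rip \<eta> t\<bar> < e / 2"
      using half_gt_zero[OF e] unfolding tendsto_iff dist_real_def by blast
  qed
  then obtain n where n: "\<And>t. t \<in> F \<Longrightarrow> \<bar>rip (x n) t - rip \<eta> t\<bar> < e / 2"
    using eventually_happens by force
  obtain g where g: "g \<in> \<Gamma>" "\<forall>t\<in>F. \<bar>rip (\<pi> g \<xi>) t - rip (x n) t\<bar> < e / 2"
    using wlimD[OF x[of n] F half_gt_zero[OF e]] by blast
  have "\<bar>rip (\<pi> g \<xi>) t - rip \<eta> t\<bar> < e" if "t \<in> F" for t
    using n[OF that] bspec[OF g(2) that] by linarith
  then show "\<exists>g\<in>\<Gamma>. \<forall>t\<in>F. \<bar>rip (\<pi> g \<xi>) t - rip \<eta> t\<bar> < e" using g(1) by blast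
qed

text \<open>
Inner products of weak limits are limits of inner products of translates, taken one variable at
a time, and a finite set is closed.
\<close>

lemma wlim_value:
  assumes \<Gamma>: "subgroup \<Gamma> G" and \<xi>: "\<xi> \<in> carrier H" and fin: "finite {rip (\<pi> g \<xi>) \<xi> |g. g \<in> \<Gamma>}"
    and 1: "wlim \<Gamma> \<xi> \<eta>" and 2: "wlim \<Gamma> \<xi> \<zeta>"
  shows "rip \<eta> \<zeta> \<in> {rip (\<pi> g \<xi>) \<xi> |g. g \<in> \<Gamma>}" (is "_ \<in> ?V")
proof (rule ccontr)
  assume no: "rip \<eta> \<zeta> \<notin> ?V"
  obtain e where e: "0 < e" "\<forall>v\<in>?V. v \<noteq> rip \<eta> \<zeta> \<longrightarrow> e \<le> dist (rip \<eta> \<zeta>) v"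
    using finite_set_avoid[OF fin, of "rip \<eta> \<zeta>"] by (elim exE conjE)
  have H: "\<eta> \<in> carrier H" "\<zeta> \<in> carrier H" using 1 2 wlim_carrier by auto
  obtain g where g: "g \<in> \<Gamma>" "\<bar>rip (\<pi> g \<xi>) \<zeta> - rip \<eta> \<zeta>\<bar> < e / 2"
    using wlimD[OF 1, of "{\<zeta>}", OF _ _ half_gt_zero[OF e(1)]] H(2) by blast
  have gG: "g \<in> carrier G" using g subgroup.subset[OF \<Gamma>] by blast
  obtain h where h: "h \<in> \<Gamma>" "\<bar>rip (\<pi> h \<xi>) (\<pi> g \<xi>) - rip \<zeta> (\<pi> g \<xi>)\<bar> < e / 2"
    using wlimD[OF 2, of "{\<pi> g \<xi>}", OF _ _ half_gt_zero[OF e(1)]] rep_closed[OF gG \<xi>] by blast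
  have hG: "h \<in> carrier G" using h subgroup.subset[OF \<Gamma>] by blast
  have "rip (\<pi> h \<xi>) (\<pi> g \<xi>) = rip (\<pi> (inv\<^bsub>G\<^esub> g \<otimes>\<^bsub>G\<^esub> h) \<xi>) \<xi>"
    using gG hG \<xi> by (simp add: rep_mult rep_adjoint[of "inv\<^bsub>G\<^esub> g"])
  moreover have "inv\<^bsub>G\<^esub> g \<otimes>\<^bsub>G\<^esub> h \<in> \<Gamma>"
    using g h subgroup.m_closed[OF \<Gamma>] subgroup.m_inv_closed[OF \<Gamma>] by blast
  ultimately have V: "rip (\<pi> h \<xi>) (\<pi> g \<xi>) \<in> ?V" by auto
  with no have "rip (\<pi> h \<xi>) (\<pi> g \<xi>) \<noteq> rip \<eta> \<zeta>" by metis
  then have "e \<le> \<bar>rip \<eta> \<zeta> - rip (\<pi> h \<xi>) (\<pi> g \<xi>)\<bar>"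
    using bspec[OF e(2) V] by (simp add: dist_real_def)
  moreover have "rip \<zeta> (\<pi> g \<xi>) = rip (\<pi> g \<xi>) \<zeta>" using gG \<xi> H by (simp add: rip_commute)
  ultimately show False using g(2) h(2) by linarith
qed

text \<open>
By \<open>wlim_value\<close> the norms of the weak limits form a finite set, so there is a weak limit \<open>\<eta>\<close> of
minimal norm. If its orbit were infinite, then by Ramsey's theorem it would contain a sequence
of distinct vectors with constant mutual inner product \<open>c < \<parallel>\<eta>\<parallel>\<^sup>2\<close>. The weak limit of this
sequence is a weak limit of translates of \<open>\<xi>\<close> with squared norm \<open>c\<close>, contradicting the choice of
\<open>\<eta>\<close>.
\<close>

theorem wlim_finite_orbit:
  assumes \<Gamma>: "subgroup \<Gamma> G" and \<xi>: "\<xi> \<in> carrier H" and fin: "finite {rip (\<pi> g \<xi>) \<xi> |g. g \<in> \<Gamma>}"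
  shows "\<exists>\<eta>. wlim \<Gamma> \<xi> \<eta> \<and> finite {\<pi> g \<eta> |g. g \<in> \<Gamma>}"
proof -
  let ?V = "{rip (\<pi> g \<xi>) \<xi> |g. g \<in> \<Gamma>}"
  note vals = wlim_value[OF \<Gamma> \<xi> fin]
  have \<Gamma>G: "\<Gamma> \<subseteq> carrier G" using subgroup.subset[OF \<Gamma>] .
  define N where "N = {rip \<eta> \<eta> |\<eta>. wlim \<Gamma> \<xi> \<eta>}"
  have "N \<subseteq> ?V" using vals by (auto simp: N_def)
  then have "finite N" using fin finite_subset by blast
  moreover have "rip (\<pi> \<one>\<^bsub>G\<^esub> \<xi>) (\<pi> \<one>\<^bsub>G\<^esub> \<xi>) \<in> N"
    unfolding N_def using wlim_orbit[OF \<Gamma>G subgroup.one_closed[OF \<Gamma>] \<xi>] by blast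
  ultimately obtain m where m: "m \<in> N" "\<And>v. v \<in> N \<Longrightarrow> m \<le> v"
    using Min_in[of N] Min_le[of N] by blast
  from m(1) obtain \<eta> where \<eta>1: "wlim \<Gamma> \<xi> \<eta>" "m = rip \<eta> \<eta>" unfolding N_def by blast
  have \<eta>: "wlim \<Gamma> \<xi> \<eta>" "\<And>\<zeta>. wlim \<Gamma> \<xi> \<zeta> \<Longrightarrow> rip \<eta> \<eta> \<le> rip \<zeta> \<zeta>"
    using \<eta>1 m(2) unfolding N_def by blast+
  have \<eta>H: "\<eta> \<in> carrier H" using \<eta>(1) by (rule wlim_carrier)
  define B where "B = {\<pi> g \<eta> |g. g \<in> \<Gamma>}"
  have B: "x \<in> carrier H" "wlim \<Gamma> \<xi> x" "rip x x = rip \<eta> \<eta>" if x: "x \<in> B" for x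
  proof -
    obtain g where g: "g \<in> \<Gamma>" "x = \<pi> g \<eta>" using x by (auto simp: B_def)
    show "wlim \<Gamma> \<xi> x"
      unfolding g(2) by (rule wlim_trans[OF \<Gamma> \<xi> \<eta>(1) wlim_orbit[OF \<Gamma>G g(1) \<eta>H]])
    then show "x \<in> carrier H" by (rule wlim_carrier)
    show "rip x x = rip \<eta> \<eta>" using g \<Gamma>G \<eta>H by (auto simp: rep_rip)
  qed
  have "finite B"
  proof (rule ccontr)
    assume inf: "infinite B"
    obtain idx where idx: "bij_betw idx ?V {0..<card ?V}"
      using ex_bij_betw_finite_nat[OF fin] by blast
    \<comment> \<open>The inner product as a function of the unordered pair, as Ramsey's theorem requires.\<close>
    define val where "val P = (SOME v. \<exists>x y. P = {x, y} \<and> x \<in> B \<and> y \<in> B \<and> v = rip x y)" for P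
    have val: "val {x, y} = rip x y" if "x \<in> B" "y \<in> B" for x y
      unfolding val_def
    proof (rule some_equality)
      show "\<exists>x' y'. {x, y} = {x', y'} \<and> x' \<in> B \<and> y' \<in> B \<and> rip x y = rip x' y'" using that by blast
      fix v assume "\<exists>x' y'. {x, y} = {x', y'} \<and> x' \<in> B \<and> y' \<in> B \<and> v = rip x' y'"
      then show "v = rip x y" using B(1) rip_commute by (auto simp: doubleton_eq_iff)
    qed
    have inV: "rip x y \<in> ?V" if "x \<in> B" "y \<in> B" for x y
      using that B(2) by (intro vals)
    have "\<forall>x\<in>B. \<forall>y\<in>B. x \<noteq> y \<longrightarrow> idx (val {x, y}) < card ?V"
      using inV val bij_betwE[OF idx] by auto
    from Ramsey2[OF inf this] obtain Y n where Y: "Y \<subseteq> B" "infinite Y"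
      "\<forall>x\<in>Y. \<forall>y\<in>Y. x \<noteq> y \<longrightarrow> idx (val {x, y}) = n" by blast
    obtain x :: "nat \<Rightarrow> 'h" where x: "inj x" "range x \<subseteq> Y"
      using infinite_countable_subset[OF Y(2)] by blast
    have xB: "x i \<in> B" and xY: "x i \<in> Y" for i using x Y by auto
    have dist: "x i \<noteq> x j" if "i \<noteq> j" for i j using x(1) that by (auto dest: injD)
    define c where "c = rip (x 0) (x 1)"
    have const: "rip (x i) (x j) = c" if "i \<noteq> j" for i j
    proof -
      have "idx (rip (x i) (x j)) = idx c"
      proof -
        have "idx (val {x i, x j}) = n" using Y(3) xY dist[OF that] by blast
        moreover have "idx (val {x 0, x 1}) = n" using Y(3) xY dist[of 0 1] by simp
        ultimately show ?thesis by (simp only: val[OF xB xB] c_def)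
      qed
      then show ?thesis
        unfolding c_def by (rule inj_onD[OF bij_betw_imp_inj_on[OF idx] _ inV[OF xB xB] inV[OF xB xB]])
    qed
    have "\<exists>\<zeta>\<in>carrier H. rip \<zeta> \<zeta> = c \<and> (\<forall>t\<in>carrier H. (\<lambda>n. rip (x n) t) \<longlonglongrightarrow> rip \<zeta> t)"
      by (rule constant_gram_limit[OF B(1)[OF xB] const B(3)[OF xB]])
    then obtain \<zeta> where \<zeta>: "\<zeta> \<in> carrier H" "rip \<zeta> \<zeta> = c"
      "\<forall>t\<in>carrier H. (\<lambda>n. rip (x n) t) \<longlonglongrightarrow> rip \<zeta> t" by (elim bexE conjE) (rule that)
    have "wlim \<Gamma> \<xi> \<zeta>"
      by (rule wlim_limit[OF B(2)[OF xB] \<zeta>(1)]) (rule bspec[OF \<zeta>(3)])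
    then have "rip \<eta> \<eta> \<le> c" using \<eta>(2) \<zeta>(2) by metis
    moreover have "rip (x 0 \<ominus> x 1) (x 0 \<ominus> x 1) = 2 * (rip \<eta> \<eta> - c)"
      using B xB by (simp add: rip_minus_self c_def)
    ultimately have "rip (x 0 \<ominus> x 1) (x 0 \<ominus> x 1) = 0"
      using rip_self_nonneg[of "x 0 \<ominus> x 1"] B(1) xB by force
    then show False
      using rip_self_eq_0[of "x 0 \<ominus> x 1"] minus_eq_0[of "x 0" "x 1"] B(1) xB dist[of 0 1] by simp
  qed
  then show ?thesis using \<eta>(1) unfolding B_def by blast
qed

end


section \<open>Vectors fixed by the stabilizer of a finite set\<close>

locale aut_rep = weakly_eliminates_imaginaries S X + unitary_rep H "aut_group S X" "aut_topology S X" \<pi>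
  for S :: "'r signature" and X :: "('r, 'a) rel_structure" and H :: "'h hilbert_space" (structure)
    and \<pi> :: "('a \<Rightarrow> 'a) \<Rightarrow> 'h \<Rightarrow> 'h"
begin

definition fixed :: "'a set \<Rightarrow> 'h set" where
  "fixed A = {\<xi> \<in> carrier H. \<forall>g\<in>fixer S X A. \<pi> g \<xi> = \<xi>}"

lemma fixer_rep_closed: "\<lbrakk>g \<in> fixer S X A; x \<in> carrier H\<rbrakk> \<Longrightarrow> \<pi> g x \<in> carrier H"
  using fixer_Aut[of g S X A] by simp

lemma fixed_carrier: "\<xi> \<in> fixed A \<Longrightarrow> \<xi> \<in> carrier H"
  by (simp add: fixed_def)

lemma fixed_mono: "A \<subseteq> B \<Longrightarrow> fixed A \<subseteq> fixed B"
  using fixer_antimono[of A B S X] by (auto simp: fixed_def)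

lemma fixed_minus: "\<lbrakk>\<xi> \<in> fixed A; \<zeta> \<in> fixed A\<rbrakk> \<Longrightarrow> \<xi> \<ominus> \<zeta> \<in> fixed A"
  by (auto simp: fixed_def rep_minus fixer_Aut)

lemma small_displacement:
  assumes \<xi>: "\<xi> \<in> carrier H" and e: "0 < e"
  shows "\<exists>E. finite E \<and> E \<subseteq> universe X \<and> (\<forall>g\<in>fixer S X E. hnorm H (\<pi> g \<xi> \<ominus> \<xi>) < e)"
proof -
  let ?U = "universe X" and ?T = "aut_topology S X"
  have "\<one>\<^bsub>G\<^esub> \<in> topspace ?T" by (simp add: topspace_aut_topology)
  then obtain W where W: "openin ?T W" "\<one>\<^bsub>G\<^esub> \<in> W" "\<And>g. g \<in> W \<Longrightarrow> \<pi> g \<xi> \<in> metric.mball (\<pi> \<one>\<^bsub>G\<^esub> \<xi>) e"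
    using repD(9)[OF \<xi>] e unfolding metric.continuous_map_to_metric by meson
  obtain Z where Z: "openin (product_topology (\<lambda>_. discrete_topology ?U) ?U) Z" "W = Z \<inter> Aut S X"
    using W(1) by (auto simp: aut_topology_def openin_subtopology)
  have "\<one>\<^bsub>G\<^esub> \<in> Z" using W(2) Z(2) by blast
  then obtain F where F: "finite {i \<in> ?U. F i \<noteq> topspace (discrete_topology ?U)}"
    "\<one>\<^bsub>G\<^esub> \<in> Pi\<^sub>E ?U F" "Pi\<^sub>E ?U F \<subseteq> Z"
    using Z(1) unfolding openin_product_topology_alt by blast
  define E where "E = {i \<in> ?U. F i \<noteq> ?U}"
  have "hnorm H (\<pi> g \<xi> \<ominus> \<xi>) < e" if g: "g \<in> fixer S X E" for g
  proof -
    have gA: "g \<in> Aut S X" using g by (rule fixer_Aut)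
    have "g i \<in> F i" if i: "i \<in> ?U" for i
    proof (cases "i \<in> E")
      case True
      then have "g i = \<one>\<^bsub>G\<^esub> i" using g i by (simp add: fixer_def)
      then show ?thesis using PiE_mem[OF F(2) i] by (simp only:)
    next
      case False
      then show ?thesis using gA i by (simp add: E_def)
    qed
    moreover have "g \<in> extensional ?U" using gA by (simp add: Aut_iff Bij_def)
    ultimately have "g \<in> Z" using F(3) by (auto simp: PiE_def Pi_def)
    then have "\<pi> g \<xi> \<in> metric.mball \<xi> e" using W(3)[of g] Z(2) gA \<xi> by simp
    then have "hdist H (\<pi> g \<xi>) \<xi> < e" using metric.commute by (simp add: metric.in_mball)
    then show ?thesis using gA \<xi> by (simp add: hdist_eq)
  qed
  moreover have "finite E" using F(1) by (simp add: E_def)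
  ultimately show ?thesis by (intro exI[of _ E]) (auto simp: E_def)
qed

text \<open>
The circumcentre of the orbit of \<open>\<xi>\<close> under a stabilizer is fixed by the stabilizer, because it
is unique. Its distance from \<open>\<xi>\<close> is at most the supremum of the distances between \<open>\<xi>\<close> and its
translates, which is small for a small stabilizer.
\<close>

theorem fixed_dense:
  assumes \<xi>: "\<xi> \<in> carrier H" and e: "0 < e"
  shows "\<exists>A \<zeta>. finite A \<and> A \<subseteq> universe X \<and> \<zeta> \<in> fixed A \<and> hnorm H (\<xi> \<ominus> \<zeta>) \<le> e"
proof -
  obtain E where E: "finite E" "E \<subseteq> universe X" "\<And>g. g \<in> fixer S X E \<Longrightarrow> hnorm H (\<pi> g \<xi> \<ominus> \<xi>) < e"
    using small_displacement[OF \<xi> e] by blast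
  define B where "B = {\<pi> g \<xi> |g. g \<in> fixer S X E}"
  note K = subgroup_fixer[OF E(2)]
  have K1: "\<one>\<^bsub>G\<^esub> \<in> fixer S X E" using subgroup.one_closed[OF K] .
  have BH: "B \<subseteq> carrier H" using \<xi> by (auto simp: B_def intro: fixer_rep_closed)
  have \<xi>B: "\<xi> \<in> B" unfolding B_def using K1 rep_one[OF \<xi>] by (metis (mono_tags, lifting) mem_Collect_eq)
  have near: "rip (\<xi> \<ominus> b) (\<xi> \<ominus> b) \<le> e\<^sup>2" if bB: "b \<in> B" for b
  proof -
    obtain g where g: "g \<in> fixer S X E" "b = \<pi> g \<xi>" using bB by (auto simp: B_def)
    have b: "b \<in> carrier H" using bB BH by blast
    have "rip (\<xi> \<ominus> b) (\<xi> \<ominus> b) = rip (b \<ominus> \<xi>) (b \<ominus> \<xi>)"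
      using \<xi> b by (simp add: rip_minus_self rip_commute)
    also have "\<dots> = (hnorm H (\<pi> g \<xi> \<ominus> \<xi>))\<^sup>2" using \<xi> b g by (simp add: rip_self)
    also have "\<dots> \<le> e\<^sup>2" using E(3)[OF g(1)] b \<xi> g by (intro power_mono hnorm_nonneg) auto
    finally show ?thesis .
  qed
  have "\<exists>r\<le>e\<^sup>2. \<exists>!z. z \<in> carrier H \<and> (\<forall>b\<in>B. rip (z \<ominus> b) (z \<ominus> b) \<le> r)"
    using \<xi>B near by (intro circumcentre[OF BH _ \<xi>]) auto
  then obtain r z where r: "r \<le> e\<^sup>2" and z: "z \<in> carrier H" "\<And>b. b \<in> B \<Longrightarrow> rip (z \<ominus> b) (z \<ominus> b) \<le> r"
    and uniq: "\<And>y. \<lbrakk>y \<in> carrier H; \<forall>b\<in>B. rip (y \<ominus> b) (y \<ominus> b) \<le> r\<rbrakk> \<Longrightarrow> y = z" by metis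
  have "\<pi> g z = z" if g: "g \<in> fixer S X E" for g
  proof (rule uniq)
    have gA: "g \<in> Aut S X" using g by (rule fixer_Aut)
    show "\<pi> g z \<in> carrier H" using gA z by simp
    show "\<forall>b\<in>B. rip (\<pi> g z \<ominus> b) (\<pi> g z \<ominus> b) \<le> r"
    proof
      fix b assume b: "b \<in> B"
      then obtain h where h: "h \<in> fixer S X E" "b = \<pi> h \<xi>" by (auto simp: B_def)
      define b' where "b' = \<pi> (inv\<^bsub>G\<^esub> g) b"
      have "b' = \<pi> (inv\<^bsub>G\<^esub> g \<otimes>\<^bsub>G\<^esub> h) \<xi>" using h gA fixer_Aut[OF h(1)] \<xi> by (simp add: b'_def rep_mult)
      moreover have "inv\<^bsub>G\<^esub> g \<otimes>\<^bsub>G\<^esub> h \<in> fixer S X E"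
        using subgroup.m_closed[OF K subgroup.m_inv_closed[OF K g] h(1)] .
      ultimately have b': "b' \<in> B" by (auto simp: B_def)
      have "\<pi> g z \<ominus> b = \<pi> g (z \<ominus> b')"
        using gA z(1) b BH b' by (auto simp: rep_minus b'_def)
      then show "rip (\<pi> g z \<ominus> b) (\<pi> g z \<ominus> b) \<le> r"
        using z b' gA BH by (auto simp: rep_rip)
    qed
  qed
  then have "z \<in> fixed E" using z(1) by (simp add: fixed_def)
  moreover have "hnorm H (\<xi> \<ominus> z) \<le> e"
  proof -
    have "rip (\<xi> \<ominus> z) (\<xi> \<ominus> z) = rip (z \<ominus> \<xi>) (z \<ominus> \<xi>)" using \<xi> z(1) by (simp add: rip_minus_self rip_commute)
    also have "\<dots> \<le> e\<^sup>2" using z(2)[OF \<xi>B] r by linarith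
    finally show ?thesis using \<xi> z(1) e by (simp add: rip_self abs_le_square_iff[symmetric] hnorm_nonneg)
  qed
  ultimately show ?thesis using E by blast
qed

text \<open>
This property, unlike membership in \<open>fixed A\<close> for a given \<open>A\<close>, passes to all weak limits of
translates.
\<close>

definition finite_values :: "'h \<Rightarrow> bool" where
  "finite_values \<xi> \<longleftrightarrow> \<xi> \<in> carrier H \<and> finite {rip (\<pi> g \<xi>) \<xi> |g. g \<in> Aut S X}"

text \<open>
The inner product of \<open>\<pi> g \<xi>\<close> and \<open>\<xi>\<close> depends only on the orbit of the tuple which consists of an
enumeration of \<open>A\<close> and its image under \<open>g\<close>, and there are finitely many such orbits.
\<close>

lemma fixed_finite_values:
  assumes A: "finite A" "A \<subseteq> universe X" and \<xi>: "\<xi> \<in> fixed A"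
  shows "finite_values \<xi>"
proof -
  have \<xi>H: "\<xi> \<in> carrier H" using \<xi> by (rule fixed_carrier)
  obtain as where as: "set as = A" using finite_list[OF A(1)] by blast
  have asU: "set as \<subseteq> universe X" using as A by simp
  let ?n = "length as + length as"
  obtain R where R: "finite R" "R \<subseteq> tuples (universe X) ?n"
    "\<forall>xs\<in>tuples (universe X) ?n. \<exists>ys\<in>R. \<exists>g\<in>Aut S X. xs = map g ys"
    using finitely_many_orbits[of ?n] by metis
  define V where "V r = {rip (\<pi> g \<xi>) \<xi> |g. g \<in> Aut S X \<and> (\<exists>h\<in>Aut S X. as @ map g as = map h r)}" for r
  have same: "rip (\<pi> g \<xi>) \<xi> = rip (\<pi> g' \<xi>) \<xi>"
    if g: "g \<in> Aut S X" "g' \<in> Aut S X" and h: "h \<in> Aut S X" "h' \<in> Aut S X"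
      and r: "r \<in> R" "as @ map g as = map h r" "as @ map g' as = map h' r" for g g' h h' r
  proof -
    define u where "u = h' \<otimes>\<^bsub>G\<^esub> inv\<^bsub>G\<^esub> h"
    have u: "u \<in> Aut S X" using h by (simp add: u_def)
    have "u (h y) = h' y" if "y \<in> set r" for y
    proof -
      have "y \<in> universe X" using that r(1) R(2) by (auto simp: tuples_def)
      then show ?thesis unfolding u_def using h by (intro Aut_mult_inv)
    qed
    then have "map u (map h r) = map h' r" by simp
    then have eq: "map u as = as" "map u (map g as) = map g' as"
      unfolding r(2,3)[symmetric] by simp_all
    have "u a = a" if "a \<in> A" for a using eq(1) that map_eq_conv[of u as id] as by simp
    then have "u \<in> fixer S X A" using u by (simp add: fixer_def)
    then have u\<xi>: "\<pi> u \<xi> = \<xi>" using \<xi> by (simp add: fixed_def)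
    have "map (u \<otimes>\<^bsub>G\<^esub> g) as = map u (map g as)" using u g(1) asU by (auto simp: subset_iff)
    then have "map g' as = map (u \<otimes>\<^bsub>G\<^esub> g) as" using eq(2) by simp
    then have "inv\<^bsub>G\<^esub> g' \<otimes>\<^bsub>G\<^esub> (u \<otimes>\<^bsub>G\<^esub> g) \<in> fixer S X A"
      by (simp only: map_eq_iff_fixer[OF g(2) Aut_mult_closed[OF u g(1)] asU] as)
    then have "\<pi> (inv\<^bsub>G\<^esub> g' \<otimes>\<^bsub>G\<^esub> (u \<otimes>\<^bsub>G\<^esub> g)) \<xi> = \<xi>" using \<xi> by (simp add: fixed_def)
    then have "\<pi> (inv\<^bsub>G\<^esub> g') (\<pi> u (\<pi> g \<xi>)) = \<xi>" using u g \<xi>H by (simp add: rep_mult)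
    then have "\<pi> u (\<pi> g \<xi>) = \<pi> g' \<xi>" using rep_inv(1)[OF g(2), of "\<pi> u (\<pi> g \<xi>)"] u g(1) \<xi>H by simp
    then have "rip (\<pi> g' \<xi>) \<xi> = rip (\<pi> u (\<pi> g \<xi>)) (\<pi> u \<xi>)" by (simp add: u\<xi>)
    then show ?thesis using rep_rip[OF u] g(1) \<xi>H by simp
  qed
  have "finite (V r)" if r: "r \<in> R" for r
  proof (cases "V r = {}")
    case False
    then obtain v where v: "v \<in> V r" by blast
    have "V r \<subseteq> {v}"
    proof
      fix w assume "w \<in> V r"
      then show "w \<in> {v}" using v same[OF _ _ _ _ r] unfolding V_def by blast
    qed
    then show ?thesis using finite_subset by blast
  qed simp
  then have "finite (\<Union>r\<in>R. V r)" using R(1) by blast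
  moreover have "{rip (\<pi> g \<xi>) \<xi> |g. g \<in> Aut S X} \<subseteq> (\<Union>r\<in>R. V r)"
  proof
    fix v assume "v \<in> {rip (\<pi> g \<xi>) \<xi> |g. g \<in> Aut S X}"
    then obtain g where g: "g \<in> Aut S X" "v = rip (\<pi> g \<xi>) \<xi>" by blast
    then have "as @ map g as \<in> tuples (universe X) ?n" using asU by (auto simp: tuples_def)
    then obtain r h where "r \<in> R" "h \<in> Aut S X" "as @ map g as = map h r" using R(3) by blast
    then show "v \<in> (\<Union>r\<in>R. V r)" using g unfolding V_def by blast
  qed
  ultimately show ?thesis using \<xi>H finite_subset by (auto simp: finite_values_def)
qed

lemma finite_values_wlim:
  assumes \<xi>: "finite_values \<xi>" and \<eta>: "wlim (Aut S X) \<xi> \<eta>"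
  shows "finite_values \<eta>"
proof -
  have \<xi>H: "\<xi> \<in> carrier H" and fin: "finite {rip (\<pi> g \<xi>) \<xi> |g. g \<in> Aut S X}"
    using \<xi> by (auto simp: finite_values_def)
  have \<eta>H: "\<eta> \<in> carrier H" using \<eta> by (rule wlim_carrier)
  have "rip (\<pi> g \<eta>) \<eta> \<in> {rip (\<pi> g \<xi>) \<xi> |g. g \<in> Aut S X}" if g: "g \<in> Aut S X" for g
  proof (rule wlim_value[OF G.subgroup_self \<xi>H fin _ \<eta>])
    show "wlim (Aut S X) \<xi> (\<pi> g \<eta>)"
      by (rule wlim_trans[OF G.subgroup_self \<xi>H \<eta> wlim_orbit[OF subset_refl g \<eta>H]])
  qed
  then have "{rip (\<pi> g \<eta>) \<eta> |g. g \<in> Aut S X} \<subseteq> {rip (\<pi> g \<xi>) \<xi> |g. g \<in> Aut S X}" by blast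
  then show ?thesis using fin \<eta>H finite_subset by (auto simp: finite_values_def)
qed

text \<open>
The orbit is discrete, so by strong continuity the stabilizer of \<open>\<eta>\<close> is open; being of finite
index in \<open>fixer S X C\<close>, it is all of it.
\<close>

lemma finite_orbit_fixed:
  assumes C: "finite C" "C \<subseteq> universe X" and \<eta>: "\<eta> \<in> carrier H"
    and fin: "finite {\<pi> g \<eta> |g. g \<in> fixer S X C}" (is "finite ?B")
  shows "\<eta> \<in> fixed C"
proof -
  note VC = subgroup_fixer[OF C(2)]
  define K where "K = {g \<in> fixer S X C. \<pi> g \<eta> = \<eta>}"
  have K: "subgroup K G"
  proof (rule G.subgroupI)
    show "K \<subseteq> Aut S X" by (auto simp: K_def fixer_Aut)
    show "K \<noteq> {}" using subgroup.one_closed[OF VC] \<eta> by (auto simp: K_def)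
    fix g assume g: "g \<in> K"
    then have gA: "g \<in> Aut S X" "\<pi> g \<eta> = \<eta>" by (auto simp: K_def fixer_Aut)
    have "\<pi> (inv\<^bsub>G\<^esub> g) \<eta> = \<eta>" using rep_inv(2)[OF gA(1) \<eta>] gA(2) by simp
    then show "inv\<^bsub>G\<^esub> g \<in> K" using g subgroup.m_inv_closed[OF VC] by (auto simp: K_def)
    fix h assume h: "h \<in> K"
    then show "g \<otimes>\<^bsub>G\<^esub> h \<in> K"
      using g gA subgroup.m_closed[OF VC] \<eta> by (auto simp: K_def fixer_Aut rep_mult)
  qed
  have BH: "x \<in> carrier H" if "x \<in> ?B" for x using that \<eta> by (auto intro: fixer_rep_closed)
  have "\<exists>\<delta>>0. \<forall>x\<in>?B. x \<noteq> \<eta> \<longrightarrow> \<delta> \<le> hnorm H (x \<ominus> \<eta>)"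
  proof -
    let ?D = "(\<lambda>x. hnorm H (x \<ominus> \<eta>)) ` (?B - {\<eta>})"
    have pos: "0 < d" if d: "d \<in> ?D" for d
    proof -
      obtain x where x: "x \<in> ?B" "x \<noteq> \<eta>" "d = hnorm H (x \<ominus> \<eta>)" using d by blast
      then show ?thesis
        using BH[OF x(1)] \<eta> hnorm_nonneg[of "x \<ominus> \<eta>"] hnorm_eq_0[of "x \<ominus> \<eta>"] minus_eq_0[of x \<eta>] by force
    qed
    show ?thesis
    proof (cases "?D = {}")
      case True
      then show ?thesis by (intro exI[of _ 1]) auto
    next
      case False
      have "finite ?D" using fin by simp
      then have "0 < Min ?D" "\<forall>d\<in>?D. Min ?D \<le> d" using pos False by auto
      then show ?thesis by (intro exI[of _ "Min ?D"]) blast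
    qed
  qed
  then obtain \<delta> where \<delta>: "0 < \<delta>" "\<And>x. \<lbrakk>x \<in> ?B; hnorm H (x \<ominus> \<eta>) < \<delta>\<rbrakk> \<Longrightarrow> x = \<eta>" by fastforce
  obtain E where E: "finite E" "E \<subseteq> universe X" "\<And>g. g \<in> fixer S X E \<Longrightarrow> hnorm H (\<pi> g \<eta> \<ominus> \<eta>) < \<delta>"
    using small_displacement[OF \<eta> \<delta>(1)] by blast
  have sub: "fixer S X (E \<union> C) \<subseteq> K"
  proof
    fix g assume "g \<in> fixer S X (E \<union> C)"
    then have g: "g \<in> fixer S X E" "g \<in> fixer S X C" by (auto simp: fixer_def)
    have "\<pi> g \<eta> = \<eta>" using g(2) E(3)[OF g(1)] by (intro \<delta>(2)) blast+
    then show "g \<in> K" using g(2) by (simp add: K_def)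
  qed
  define t where "t x = (SOME g. g \<in> fixer S X C \<and> x = \<pi> g \<eta>)" for x
  have t: "t x \<in> fixer S X C \<and> x = \<pi> (t x) \<eta>" if "x \<in> ?B" for x
    unfolding t_def by (rule someI_ex[where P = "\<lambda>g. g \<in> fixer S X C \<and> x = \<pi> g \<eta>"]) (use that in blast)
  have "fixer S X C \<subseteq> K"
  proof (rule fixer_no_finite_index[OF K _ _ sub C])
    show "finite (E \<union> C)" "E \<union> C \<subseteq> universe X" using E C by auto
    show "finite (t ` ?B)" using fin by simp
    show "t ` ?B \<subseteq> Aut S X" using t fixer_Aut by blast
    fix g assume g: "g \<in> fixer S X C"
    define s where "s = t (\<pi> g \<eta>)"
    have inB: "\<pi> g \<eta> \<in> ?B" using g by blast
    have s: "s \<in> fixer S X C" "\<pi> s \<eta> = \<pi> g \<eta>" using t[OF inB] by (auto simp: s_def)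
    have gs: "g \<in> Aut S X" "s \<in> Aut S X" using g s fixer_Aut by auto
    have "\<pi> (inv\<^bsub>G\<^esub> s \<otimes>\<^bsub>G\<^esub> g) \<eta> = \<eta>"
      using gs \<eta> s(2)[symmetric] by (simp add: rep_mult)
    moreover have "inv\<^bsub>G\<^esub> s \<otimes>\<^bsub>G\<^esub> g \<in> fixer S X C"
      using subgroup.m_closed[OF VC subgroup.m_inv_closed[OF VC s(1)] g] .
    ultimately have "inv\<^bsub>G\<^esub> s \<otimes>\<^bsub>G\<^esub> g \<in> K" by (simp add: K_def)
    moreover have "g = s \<otimes>\<^bsub>G\<^esub> (inv\<^bsub>G\<^esub> s \<otimes>\<^bsub>G\<^esub> g)" using gs by (simp flip: G.m_assoc)
    moreover have "s \<in> t ` ?B" using inB by (simp add: s_def)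
    ultimately show "\<exists>s\<in>t ` ?B. \<exists>k\<in>K. g = s \<otimes>\<^bsub>G\<^esub> k" by blast
  qed
  then show ?thesis using \<eta> by (auto simp: fixed_def K_def)
qed

text \<open>
The orthogonal projection onto \<open>fixed C\<close> is a weak limit of translates, which is more than
completeness gives: it confines the inner products of the projection to a finite set.
\<close>

lemma projection_exists:
  assumes C: "finite C" "C \<subseteq> universe X" and \<xi>: "finite_values \<xi>"
  shows "\<exists>\<eta>\<in>fixed C. wlim (Aut S X) \<xi> \<eta> \<and> (\<forall>t\<in>fixed C. rip \<xi> t = rip \<eta> t)"
proof -
  have \<xi>H: "\<xi> \<in> carrier H" using \<xi> by (simp add: finite_values_def)
  have sub: "fixer S X C \<subseteq> Aut S X" using fixer_Aut by blast
  have "finite {rip (\<pi> g \<xi>) \<xi> |g. g \<in> fixer S X C}"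
    by (rule finite_subset[of _ "{rip (\<pi> g \<xi>) \<xi> |g. g \<in> Aut S X}"])
      (use \<xi> sub in \<open>auto simp: finite_values_def\<close>)
  from wlim_finite_orbit[OF subgroup_fixer[OF C(2)] \<xi>H this]
  obtain \<eta> where \<eta>: "wlim (fixer S X C) \<xi> \<eta>" "finite {\<pi> g \<eta> |g. g \<in> fixer S X C}" by blast
  have \<eta>H: "\<eta> \<in> carrier H" using \<eta>(1) by (rule wlim_carrier)
  have "rip \<xi> t = rip \<eta> t" if t: "t \<in> fixed C" for t
  proof (rule ccontr)
    assume "rip \<xi> t \<noteq> rip \<eta> t"
    then have "0 < \<bar>rip \<xi> t - rip \<eta> t\<bar>" by simp
    then obtain g where g: "g \<in> fixer S X C" "\<bar>rip (\<pi> g \<xi>) t - rip \<eta> t\<bar> < \<bar>rip \<xi> t - rip \<eta> t\<bar>"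
      using wlimD[OF \<eta>(1), of "{t}"] fixed_carrier[OF t] by blast
    have "rip (\<pi> g \<xi>) t = rip (\<pi> g \<xi>) (\<pi> g t)" using t g(1) by (simp add: fixed_def)
    also have "\<dots> = rip \<xi> t" using fixer_Aut[OF g(1)] \<xi>H fixed_carrier[OF t] by (rule rep_rip)
    finally show False using g(2) by simp
  qed
  then show ?thesis using finite_orbit_fixed[OF C \<eta>H \<eta>(2)] wlim_mono[OF \<eta>(1) sub] by blast
qed

lemma fixed_Int:
  assumes A: "finite A" "A \<subseteq> universe X" and B: "finite B" "B \<subseteq> universe X"
    and \<eta>: "\<eta> \<in> fixed A" "\<eta> \<in> fixed B"
  shows "\<eta> \<in> fixed (A \<inter> B)"
proof -
  have \<eta>H: "\<eta> \<in> carrier H" using \<eta> fixed_carrier by blast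
  define K where "K = {g \<in> Aut S X. \<pi> g \<eta> = \<eta>}"
  have "subgroup K G"
  proof (rule G.subgroupI)
    show "K \<noteq> {}" using \<eta>H Aut_one_closed by (auto simp: K_def)
    show "inv\<^bsub>G\<^esub> g \<in> K" if "g \<in> K" for g
      using that rep_inv(2)[of g \<eta>] \<eta>H by (auto simp: K_def)
    show "g \<otimes>\<^bsub>G\<^esub> h \<in> K" if "g \<in> K" "h \<in> K" for g h
      using that \<eta>H by (auto simp: K_def rep_mult)
  qed (auto simp: K_def)
  then have "fixer S X (A \<inter> B) \<subseteq> K"
    using A B \<eta> by (intro fixer_Int_subset) (auto simp: K_def fixed_def fixer_Aut)
  then show ?thesis using \<eta>H by (auto simp: fixed_def K_def)
qed

text \<open>
Let \<open>x\<close> be the sequence of alternating projections of \<open>\<xi>\<close> onto \<open>fixed B\<close> and \<open>fixed A\<close>, with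
squared norms \<open>s\<close>. As these decrease in a finite set, two successive ones agree, and then \<open>x\<close>
has reached a vector of \<open>fixed (A \<inter> B)\<close>. Since \<open>x\<close> stays orthogonal to that space, it has become
zero. For alternating projections \<open>s (n + 1)\<close> is the inner product of \<open>x (n + 2)\<close> and \<open>x n\<close>, so
already \<open>x 1\<close>, the projection of \<open>\<xi>\<close> onto \<open>fixed B\<close>, was zero.
\<close>

theorem fixed_orthogonal:
  assumes A: "finite A" "A \<subseteq> universe X" and B: "finite B" "B \<subseteq> universe X"
    and \<xi>: "\<xi> \<in> fixed A" and perp: "\<And>t. t \<in> fixed (A \<inter> B) \<Longrightarrow> rip \<xi> t = 0" and t: "t \<in> fixed B"
  shows "rip \<xi> t = 0"
proof -
  let ?V = "{rip (\<pi> g \<xi>) \<xi> |g. g \<in> Aut S X}"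
  define cur where "cur n = (if even n then A else B)" for n :: nat
  have cur: "finite (cur n)" "cur n \<subseteq> universe X" for n using A B by (auto simp: cur_def)
  have fv: "finite_values \<xi>" using fixed_finite_values A \<xi> by blast
  then have \<xi>H: "\<xi> \<in> carrier H" and finV: "finite ?V" by (auto simp: finite_values_def)
  have "\<exists>x. \<forall>n. (x n \<in> fixed (cur n) \<and> wlim (Aut S X) \<xi> (x n) \<and> (n = 0 \<longrightarrow> x n = \<xi>)) \<and>
      (\<forall>t\<in>fixed (cur (Suc n)). rip (x n) t = rip (x (Suc n)) t)"
  proof (rule dependent_nat_choice)
    have "wlim (Aut S X) \<xi> \<xi>"
      using wlim_orbit[OF subset_refl Aut_one_closed \<xi>H] \<xi>H by simp
    then show "\<exists>x. x \<in> fixed (cur 0) \<and> wlim (Aut S X) \<xi> x \<and> ((0::nat) = 0 \<longrightarrow> x = \<xi>)"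
      using \<xi> by (auto simp: cur_def)
    fix x and n :: nat assume x: "x \<in> fixed (cur n) \<and> wlim (Aut S X) \<xi> x \<and> (n = 0 \<longrightarrow> x = \<xi>)"
    then have "finite_values x" using finite_values_wlim[OF fv] by blast
    then obtain y where "y \<in> fixed (cur (Suc n))" "wlim (Aut S X) x y"
      "\<forall>t\<in>fixed (cur (Suc n)). rip x t = rip y t"
      using projection_exists[OF cur] by blast
    moreover have "wlim (Aut S X) \<xi> y"
      using wlim_trans[OF G.subgroup_self \<xi>H _ calculation(2)] x by blast
    ultimately show "\<exists>y. (y \<in> fixed (cur (Suc n)) \<and> wlim (Aut S X) \<xi> y \<and> (Suc n = 0 \<longrightarrow> y = \<xi>)) \<and>
      (\<forall>t\<in>fixed (cur (Suc n)). rip x t = rip y t)" by blast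
  qed
  then obtain x where x: "\<And>n. x n \<in> fixed (cur n)" "\<And>n. wlim (Aut S X) \<xi> (x n)" "x 0 = \<xi>"
    "\<And>n t. t \<in> fixed (cur (Suc n)) \<Longrightarrow> rip (x n) t = rip (x (Suc n)) t" by blast
  have xH: "x n \<in> carrier H" for n using x(1) fixed_carrier by blast
  define s where "s n = rip (x n) (x n)" for n
  have sV: "s n \<in> ?V" for n
    unfolding s_def by (rule wlim_value[OF G.subgroup_self \<xi>H finV x(2) x(2)])
  have step: "rip (x n) (x (Suc n)) = s (Suc n)" for n using x(4)[OF x(1)] by (simp add: s_def)
  have drop: "rip (x n \<ominus> x (Suc n)) (x n \<ominus> x (Suc n)) = s n - s (Suc n)" for n
    using rip_minus_self[OF xH xH] step[of n] by (simp add: s_def)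
  have decr: "s (Suc n) \<le> s n" for n using drop[of n] rip_self_nonneg[of "x n \<ominus> x (Suc n)"] xH by simp
  have two: "s (Suc n) = rip (x (Suc (Suc n))) (x n)" for n
  proof -
    have "x n \<in> fixed (cur (Suc (Suc n)))" using x(1)[of n] by (simp add: cur_def)
    then have "rip (x (Suc n)) (x n) = rip (x (Suc (Suc n))) (x n)" by (rule x(4))
    then show ?thesis using step[of n] rip_commute[OF xH xH] by metis
  qed
  have perp_n: "rip (x n) t = 0" if t: "t \<in> fixed (A \<inter> B)" for n t
  proof (induction n)
    case (Suc n)
    have "t \<in> fixed (cur (Suc n))"
      using t fixed_mono[of "A \<inter> B" "cur (Suc n)"] by (auto simp: cur_def)
    then show ?case using x(4) Suc by metis
  qed (use perp t x(3) in simp)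
  have "\<exists>n. s (Suc n) = s n"
  proof (rule ccontr)
    assume "\<nexists>n. s (Suc n) = s n"
    then have "s (Suc n) < s n" for n using decr[of n] by (simp add: less_le)
    then have "strict_mono (\<lambda>n. - s n)" by (simp add: strict_mono_Suc_iff)
    then have "inj (\<lambda>n. - s n)" by (rule strict_mono_imp_inj_on)
    then have "inj s" by (simp add: inj_on_def)
    moreover have "finite (range s)" by (rule finite_subset[OF image_subsetI[OF sV] finV])
    ultimately show False using range_inj_infinite by blast
  qed
  then obtain n where n: "s (Suc n) = s n" ..
  have "x n = x (Suc n)"
    using drop[of n] n rip_self_eq_0[of "x n \<ominus> x (Suc n)"] minus_eq_0 xH by simp
  then have "x n \<in> fixed (cur n)" "x n \<in> fixed (cur (Suc n))" using x(1)[of n] x(1)[of "Suc n"] by simp_all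
  then have "x n \<in> fixed A" "x n \<in> fixed B" by (auto simp: cur_def split: if_splits)
  then have "x n \<in> fixed (A \<inter> B)" using fixed_Int A B by blast
  then have "s n = 0" using perp_n unfolding s_def by blast
  then have "s (Suc n) = 0" using n by simp
  then have "s 1 = 0"
  proof (induction n)
    case (Suc n)
    have "x (Suc (Suc n)) = \<zero>" using Suc.prems rip_self_eq_0[OF xH] by (simp add: s_def)
    then have "s (Suc n) = 0" using two[of n] xH by (simp add: rip_zero_left)
    then show ?case by (rule Suc.IH)
  qed simp
  then have "x 1 = \<zero>" using rip_self_eq_0[OF xH] by (simp add: s_def)
  moreover have "rip \<xi> t = rip (x 1) t" using x(4)[of t 0] t x(3) by (simp add: cur_def)
  ultimately show ?thesis using t fixed_carrier by (simp add: rip_zero_left)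
qed

end


section \<open>The spectral gap\<close>

context aut_rep
begin

definition proj :: "'a set \<Rightarrow> 'h \<Rightarrow> 'h" where
  "proj C \<xi> = (SOME \<eta>. \<eta> \<in> fixed C \<and> (\<forall>t\<in>fixed C. rip \<xi> t = rip \<eta> t))"

lemma proj:
  assumes "finite C" "C \<subseteq> universe X" "finite_values \<xi>"
  shows "proj C \<xi> \<in> fixed C" "t \<in> fixed C \<Longrightarrow> rip (proj C \<xi>) t = rip \<xi> t"
proof -
  have "\<exists>\<eta>. \<eta> \<in> fixed C \<and> (\<forall>t\<in>fixed C. rip \<xi> t = rip \<eta> t)"
    using projection_exists[OF assms] by blast
  then have "proj C \<xi> \<in> fixed C \<and> (\<forall>t\<in>fixed C. rip \<xi> t = rip (proj C \<xi>) t)"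
    unfolding proj_def by (rule someI_ex)
  then show "proj C \<xi> \<in> fixed C" "t \<in> fixed C \<Longrightarrow> rip (proj C \<xi>) t = rip \<xi> t" by simp_all
qed

lemma proj_unique:
  assumes C: "finite C" "C \<subseteq> universe X" "finite_values \<xi>"
    and \<eta>: "\<eta> \<in> fixed C" "\<And>t. t \<in> fixed C \<Longrightarrow> rip \<eta> t = rip \<xi> t"
  shows "proj C \<xi> = \<eta>"
proof -
  note p = proj[OF C]
  let ?d = "proj C \<xi> \<ominus> \<eta>"
  have d: "?d \<in> fixed C" using p(1) \<eta>(1) by (rule fixed_minus)
  have H: "proj C \<xi> \<in> carrier H" "\<eta> \<in> carrier H" "?d \<in> carrier H"
    using p(1) \<eta>(1) d fixed_carrier by blast+
  have "rip ?d ?d = rip (proj C \<xi>) ?d - rip \<eta> ?d" using H by (simp only: rip_minus_left)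
  also have "\<dots> = 0" using p(2)[OF d] \<eta>(2)[OF d] by simp
  finally show ?thesis using H rip_self_eq_0 minus_eq_0 by simp
qed

text \<open>
The restatement of \<open>fixed_orthogonal\<close> for projections: what remains of \<open>\<xi>\<close> after projecting onto
\<open>fixed (A \<inter> B)\<close> is orthogonal to \<open>fixed B\<close>.
\<close>

lemma proj_Int:
  assumes A: "finite A" "A \<subseteq> universe X" and B: "finite B" "B \<subseteq> universe X" and \<xi>: "\<xi> \<in> fixed A"
  shows "proj B \<xi> = proj (A \<inter> B) \<xi>"
proof (rule proj_unique[OF B])
  show fv: "finite_values \<xi>" using fixed_finite_values[OF A \<xi>] .
  have AB: "finite (A \<inter> B)" "A \<inter> B \<subseteq> universe X" using A by auto
  note p = proj[OF AB fv]
  let ?\<eta> = "proj (A \<inter> B) \<xi>"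
  show \<eta>B: "?\<eta> \<in> fixed B" using p(1) fixed_mono[of "A \<inter> B" B] by blast
  have \<eta>A: "?\<eta> \<in> fixed A" using p(1) fixed_mono[of "A \<inter> B" A] by blast
  have H: "\<xi> \<in> carrier H" "?\<eta> \<in> carrier H" using \<xi> p(1) fixed_carrier by blast+
  fix t assume t: "t \<in> fixed B"
  have "rip (\<xi> \<ominus> ?\<eta>) t = 0"
  proof (rule fixed_orthogonal[OF A B fixed_minus[OF \<xi> \<eta>A] _ t])
    fix u assume u: "u \<in> fixed (A \<inter> B)"
    then show "rip (\<xi> \<ominus> ?\<eta>) u = 0" using p(2)[OF u] H fixed_carrier[OF u] by (simp add: rip_minus_left)
  qed
  then show "rip ?\<eta> t = rip \<xi> t" using H fixed_carrier[OF t] by (simp add: rip_minus_left)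
qed

lemma proj_minus:
  assumes A: "finite A" "A \<subseteq> universe X" and C: "finite C" "C \<subseteq> universe X"
    and \<xi>: "\<xi> \<in> fixed A" "\<zeta> \<in> fixed A"
  shows "proj C (\<xi> \<ominus> \<zeta>) = proj C \<xi> \<ominus> proj C \<zeta>"
proof (rule proj_unique[OF C])
  have d: "\<xi> \<ominus> \<zeta> \<in> fixed A" using \<xi> by (rule fixed_minus)
  note fv = fixed_finite_values[OF A]
  show "finite_values (\<xi> \<ominus> \<zeta>)" using fv[OF d] .
  note p = proj[OF C fv[OF \<xi>(1)]] and q = proj[OF C fv[OF \<xi>(2)]]
  show "proj C \<xi> \<ominus> proj C \<zeta> \<in> fixed C" using p(1) q(1) by (rule fixed_minus)
  show "rip (proj C \<xi> \<ominus> proj C \<zeta>) t = rip (\<xi> \<ominus> \<zeta>) t" if t: "t \<in> fixed C" for t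
    using p(2)[OF t] q(2)[OF t] fixed_carrier[OF t] fixed_carrier[OF p(1)] fixed_carrier[OF q(1)]
      fixed_carrier[OF \<xi>(1)] fixed_carrier[OF \<xi>(2)] by (simp add: rip_minus_left)
qed

lemma fixed_translate:
  assumes g: "g \<in> Aut S X" and A: "A \<subseteq> universe X" and \<xi>: "\<xi> \<in> fixed A"
  shows "\<pi> g \<xi> \<in> fixed (g ` A)"
proof -
  have \<xi>H: "\<xi> \<in> carrier H" using \<xi> by (rule fixed_carrier)
  have "\<pi> h (\<pi> g \<xi>) = \<pi> g \<xi>" if h: "h \<in> fixer S X (g ` A)" for h
  proof -
    have hA: "h \<in> Aut S X" using h by (rule fixer_Aut)
    let ?k = "inv\<^bsub>G\<^esub> g \<otimes>\<^bsub>G\<^esub> (h \<otimes>\<^bsub>G\<^esub> g)"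
    have "?k a = a" if "a \<in> A" for a
    proof -
      have a: "a \<in> universe X" "h (g a) = g a" using that A h by (auto simp: fixer_def)
      have "?k a = (inv\<^bsub>G\<^esub> g) (h (g a))" using g hA a(1) by simp
      then show ?thesis using g a by simp
    qed
    then have "?k \<in> fixer S X A" using g hA by (simp add: fixer_def)
    then have "\<pi> ?k \<xi> = \<xi>" using \<xi> by (simp add: fixed_def)
    then have "\<pi> (inv\<^bsub>G\<^esub> g) (\<pi> h (\<pi> g \<xi>)) = \<xi>" using g hA \<xi>H by (simp add: rep_mult)
    then show ?thesis using rep_inv(1)[OF g, of "\<pi> h (\<pi> g \<xi>)"] g hA \<xi>H by simp
  qed
  then show ?thesis using g \<xi>H by (simp add: fixed_def)
qed

lemma proj_translate:
  assumes g: "g \<in> Aut S X" and A: "finite A" "A \<subseteq> universe X" and C: "finite C" "C \<subseteq> universe X"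
    and \<xi>: "\<xi> \<in> fixed A"
  shows "proj (g ` C) (\<pi> g \<xi>) = \<pi> g (proj C \<xi>)"
proof (rule proj_unique)
  note p = proj[OF C fixed_finite_values[OF A \<xi>]]
  have \<xi>H: "\<xi> \<in> carrier H" "proj C \<xi> \<in> carrier H" using \<xi> p(1) fixed_carrier by blast+
  show gC: "finite (g ` C)" "g ` C \<subseteq> universe X" using C g by auto
  have "finite (g ` A)" "g ` A \<subseteq> universe X" using A g by auto
  then show "finite_values (\<pi> g \<xi>)" using fixed_translate[OF g A(2) \<xi>] by (rule fixed_finite_values)
  show "\<pi> g (proj C \<xi>) \<in> fixed (g ` C)" using fixed_translate[OF g C(2) p(1)] .
  fix t assume t: "t \<in> fixed (g ` C)"
  have tH: "t \<in> carrier H" using t by (rule fixed_carrier)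
  let ?h = "inv\<^bsub>G\<^esub> g"
  have "?h ` g ` C = C"
  proof -
    have "?h (g x) = x" if "x \<in> C" for x using g C that by (intro Aut_inv) auto
    then show ?thesis by (simp add: image_image)
  qed
  then have "\<pi> ?h t \<in> fixed C" using fixed_translate[OF Aut_inv_closed[OF g] gC(2) t] by simp
  then show "rip (\<pi> g (proj C \<xi>)) t = rip (\<pi> g \<xi>) t"
    using p(2) g \<xi>H tH by (simp add: rep_adjoint)
qed

lemma rip_proj_proj:
  assumes A: "finite A" "A \<subseteq> universe X" and \<xi>: "\<xi> \<in> fixed A"
    and CD: "C \<subseteq> D" "finite D" "D \<subseteq> universe X"
  shows "rip (proj D \<xi> \<ominus> proj C \<xi>) (proj D \<xi> \<ominus> proj C \<xi>) =
    rip (proj D \<xi>) (proj D \<xi>) - rip (proj C \<xi>) (proj C \<xi>)"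
proof -
  have C: "finite C" "C \<subseteq> universe X" using CD finite_subset by auto
  note fv = fixed_finite_values[OF A \<xi>]
  note p = proj[OF C fv] and q = proj[OF CD(2,3) fv]
  have "proj C \<xi> \<in> fixed D" using p(1) fixed_mono[OF CD(1)] by blast
  then have "rip (proj D \<xi>) (proj C \<xi>) = rip (proj C \<xi>) (proj C \<xi>)"
    using q(2) p(2)[OF p(1)] by simp
  then show ?thesis using rip_minus_self p(1) q(1) fixed_carrier by simp
qed

text \<open>
The sets \<open>L j\<close> of elements of colour at least \<open>j\<close> decrease from all of \<open>A'\<close> to the empty set, so
the differences \<open>d j \<zeta>\<close> of successive projections decompose \<open>\<zeta>\<close> orthogonally. The number \<open>\<rho> r \<zeta>\<close>
is the norm of the part with index congruent to \<open>r\<close> modulo \<open>3\<close>; it is a seminorm bounded by the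
norm. The set \<open>A'\<close> is large enough to treat \<open>\<xi>\<close> and its two translates together.
\<close>

theorem no_almost_invariant_fixed:
  assumes c: "\<And>x. x \<in> universe X \<Longrightarrow> c (b x) = c x + 1"
    "\<And>x k. x \<in> universe X \<Longrightarrow> 3 * k \<le> c (a x) \<longleftrightarrow> 3 * k + 1 \<le> c x"
    "\<And>x k. x \<in> universe X \<Longrightarrow> 3 * k + 1 \<le> c (a x) \<longleftrightarrow> 3 * k + 3 \<le> (c x :: int)"
    and ab: "a \<in> Aut S X" "b \<in> Aut S X"
    and no_inv: "\<And>\<xi>. \<xi> \<in> fixed {} \<Longrightarrow> \<xi> = \<zero>"
    and A: "finite A" "A \<subseteq> universe X" and \<xi>: "\<xi> \<in> fixed A"
    and small: "hnorm H (\<pi> a \<xi> \<ominus> \<xi>) \<le> hnorm H \<xi> / 20" "hnorm H (\<pi> b \<xi> \<ominus> \<xi>) \<le> hnorm H \<xi> / 20"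
  shows "\<xi> = \<zero>"
proof -
  have \<xi>H: "\<xi> \<in> carrier H" using \<xi> by (rule fixed_carrier)
  define A' where "A' = A \<union> a ` A \<union> b ` A"
  have A': "finite A'" "A' \<subseteq> universe X" using A ab by (auto simp: A'_def)
  define L where "L j = {x \<in> A'. j \<le> c x}" for j
  have L: "finite (L j)" "L j \<subseteq> universe X" for j using A' by (auto simp: L_def)
  have L_mono: "L (j + 1) \<subseteq> L j" for j by (auto simp: L_def)
  define p where "p j = proj (L j)" for j
  define d where "d j \<zeta> = p j \<zeta> \<ominus> p (j + 1) \<zeta>" for j \<zeta>
  have pH: "p j \<zeta> \<in> carrier H" if "\<zeta> \<in> fixed A'" for j \<zeta>
    unfolding p_def using proj(1)[OF L fixed_finite_values[OF A' that]] by (rule fixed_carrier)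
  have dH: "d j \<zeta> \<in> carrier H" if "\<zeta> \<in> fixed A'" for j \<zeta> using pH[OF that] by (simp add: d_def)
  have dd: "rip (d j \<zeta>) (d j \<zeta>) = rip (p j \<zeta>) (p j \<zeta>) - rip (p (j + 1) \<zeta>) (p (j + 1) \<zeta>)"
    if "\<zeta> \<in> fixed A'" for j \<zeta>
    unfolding d_def p_def by (rule rip_proj_proj[OF A' that L_mono L])
  have d_minus: "d j (\<zeta> \<ominus> \<zeta>') = d j \<zeta> \<ominus> d j \<zeta>'" if "\<zeta> \<in> fixed A'" "\<zeta>' \<in> fixed A'" for j \<zeta> \<zeta>'
  proof -
    have "p i (\<zeta> \<ominus> \<zeta>') = p i \<zeta> \<ominus> p i \<zeta>'" for i unfolding p_def by (rule proj_minus[OF A' L that])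
    then have "d j (\<zeta> \<ominus> \<zeta>') = (p j \<zeta> \<ominus> p j \<zeta>') \<ominus> (p (j + 1) \<zeta> \<ominus> p (j + 1) \<zeta>')" by (simp add: d_def)
    also have "\<dots> = d j \<zeta> \<ominus> d j \<zeta>'"
      using pH[OF that(1)] pH[OF that(2)] unfolding d_def a_minus_def
      by (simp add: M.minus_add M.a_ac)
    finally show ?thesis .
  qed
  obtain N where N: "\<And>x. x \<in> A' \<Longrightarrow> \<bar>c x\<bar> < int N"
  proof -
    define N where "N = nat (Max (insert 0 ((\<lambda>x. \<bar>c x\<bar>) ` A')) + 1)"
    have "\<bar>c x\<bar> < int N" if "x \<in> A'" for x
    proof -
      have "\<bar>c x\<bar> \<le> Max (insert 0 ((\<lambda>x. \<bar>c x\<bar>) ` A'))" using A' that by (intro Max_ge) auto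
      then show ?thesis by (simp add: N_def)
    qed
    then show ?thesis by (rule that)
  qed
  \<comment> \<open>The indices congruent to \<open>r\<close> between \<open>- 3 N\<close> and \<open>3 N\<close>, enumerated by natural numbers.\<close>
  define t where "t r i = 3 * (int i - int N) + r" for r :: int and i :: nat
  define I where "I = {..<2 * N}"
  define \<rho> where "\<rho> r \<zeta> = L2_set (\<lambda>i. hnorm H (d (t r i) \<zeta>)) I" for r \<zeta>
  have \<rho>_nonneg: "0 \<le> \<rho> r \<zeta>" for r \<zeta> by (simp add: \<rho>_def)
  have \<rho>2: "(\<rho> r \<zeta>)\<^sup>2 = (\<Sum>i\<in>I. rip (d (t r i) \<zeta>) (d (t r i) \<zeta>))" if "\<zeta> \<in> fixed A'" for r \<zeta>
    using dH[OF that] by (simp add: \<rho>_def L2_set_def sum_nonneg rip_self)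
  have total: "(\<rho> 0 \<zeta>)\<^sup>2 + (\<rho> 1 \<zeta>)\<^sup>2 + (\<rho> 2 \<zeta>)\<^sup>2 = (hnorm H \<zeta>)\<^sup>2" if \<zeta>: "\<zeta> \<in> fixed A'" for \<zeta>
  proof -
    define n where "n j = rip (p j \<zeta>) (p j \<zeta>)" for j
    have dn: "rip (d j \<zeta>) (d j \<zeta>) = n j - n (j + 1)" for j using dd[OF \<zeta>] by (simp add: n_def)
    have "(\<rho> 0 \<zeta>)\<^sup>2 + (\<rho> 1 \<zeta>)\<^sup>2 + (\<rho> 2 \<zeta>)\<^sup>2 = (\<Sum>i\<in>I. n (t 0 i) - n (t 0 (Suc i)))"
      unfolding \<rho>2[OF \<zeta>] dn sum.distrib[symmetric]
      by (rule sum.cong) (simp_all add: t_def algebra_simps)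
    also have "\<dots> = n (t 0 0) - n (t 0 (2 * N))"
      unfolding I_def by (rule sum_lessThan_telescope')
    also have "n (t 0 (2 * N)) = 0"
    proof -
      have "L (t 0 (2 * N)) = {}" using N by (force simp: L_def t_def)
      then have "p (t 0 (2 * N)) \<zeta> \<in> fixed {}"
        using proj(1)[OF L fixed_finite_values[OF A' \<zeta>]] by (metis p_def)
      then have "p (t 0 (2 * N)) \<zeta> = \<zero>" by (rule no_inv)
      then show ?thesis unfolding n_def by (simp add: rip_zero_left)
    qed
    also have "n (t 0 0) = (hnorm H \<zeta>)\<^sup>2"
    proof -
      have "L (t 0 0) = A'" using N by (force simp: L_def t_def)
      then have "p (t 0 0) \<zeta> = \<zeta>"
        unfolding p_def using \<zeta> by (intro proj_unique L fixed_finite_values[OF A' \<zeta>]) auto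
      then show ?thesis using \<zeta> fixed_carrier by (simp add: n_def rip_self)
    qed
    finally show ?thesis by simp
  qed
  have \<rho>_le: "\<rho> r \<zeta> \<le> hnorm H \<zeta>" if "r \<in> {0, 1, 2}" "\<zeta> \<in> fixed A'" for r \<zeta>
  proof (rule power2_le_imp_le)
    show "(\<rho> r \<zeta>)\<^sup>2 \<le> (hnorm H \<zeta>)\<^sup>2"
      using total[OF that(2)] that(1)
        zero_le_power2[of "\<rho> 0 \<zeta>"] zero_le_power2[of "\<rho> 1 \<zeta>"] zero_le_power2[of "\<rho> 2 \<zeta>"]
      by (elim insertE emptyE; hypsubst; linarith)
  qed (use that fixed_carrier hnorm_nonneg in blast)
  have lip: "\<rho> r \<zeta> \<le> \<rho> r \<zeta>' + hnorm H (\<zeta> \<ominus> \<zeta>')"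
    if r: "r \<in> {0, 1, 2}" and \<zeta>: "\<zeta> \<in> fixed A'" "\<zeta>' \<in> fixed A'" for r \<zeta> \<zeta>'
  proof -
    let ?\<delta> = "\<zeta> \<ominus> \<zeta>'"
    have \<delta>: "?\<delta> \<in> fixed A'" using \<zeta> by (rule fixed_minus)
    have "hnorm H (d j \<zeta>) \<le> hnorm H (d j \<zeta>') + hnorm H (d j ?\<delta>)" for j
    proof -
      have "d j \<zeta> = d j ?\<delta> \<oplus> d j \<zeta>'"
        unfolding d_minus[OF \<zeta>] using dH[OF \<zeta>(1)] dH[OF \<zeta>(2)] by (rule ominus_oplus_cancel[symmetric])
      then show ?thesis
        using hnorm_triangle[OF dH[OF \<delta>] dH[OF \<zeta>(2)]] by (metis add.commute)
    qed
    then have "\<rho> r \<zeta> \<le> L2_set (\<lambda>i. hnorm H (d (t r i) \<zeta>') + hnorm H (d (t r i) ?\<delta>)) I"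
      unfolding \<rho>_def using dH[OF \<zeta>(1)] by (intro L2_set_mono hnorm_nonneg)
    also have "\<dots> \<le> \<rho> r \<zeta>' + \<rho> r ?\<delta>" unfolding \<rho>_def by (rule L2_set_triangle_ineq)
    also have "\<dots> \<le> \<rho> r \<zeta>' + hnorm H ?\<delta>" using \<rho>_le[OF r \<delta>] by simp
    finally show ?thesis .
  qed
  have \<xi>A': "\<xi> \<in> fixed A'" using \<xi> fixed_mono[of A A'] by (auto simp: A'_def)
  have translate: "\<pi> g \<xi> \<in> fixed A'" "p j' (\<pi> g \<xi>) = \<pi> g (p j \<xi>)"
    if g: "g \<in> Aut S X" "g ` A \<subseteq> A'" and j: "\<And>x. x \<in> A \<Longrightarrow> j' \<le> c (g x) \<longleftrightarrow> j \<le> c x" for g j j'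
  proof -
    have gA: "finite (g ` A)" "g ` A \<subseteq> universe X" using A g by auto
    have g\<xi>: "\<pi> g \<xi> \<in> fixed (g ` A)" using fixed_translate[OF g(1) A(2) \<xi>] .
    then show "\<pi> g \<xi> \<in> fixed A'" using fixed_mono[OF g(2)] by blast
    have "p j' (\<pi> g \<xi>) = proj (g ` A \<inter> L j') (\<pi> g \<xi>)"
      unfolding p_def by (rule proj_Int[OF gA L g\<xi>])
    also have "g ` A \<inter> L j' = g ` (A \<inter> L j)" using j g(2) by (auto simp: L_def A'_def)
    also have "proj (g ` (A \<inter> L j)) (\<pi> g \<xi>) = \<pi> g (proj (A \<inter> L j) \<xi>)"
      using A by (intro proj_translate[OF g(1) A _ _ \<xi>]) auto
    also have "proj (A \<inter> L j) \<xi> = p j \<xi>" unfolding p_def by (rule proj_Int[OF A L \<xi>, symmetric])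
    finally show "p j' (\<pi> g \<xi>) = \<pi> g (p j \<xi>)" .
  qed
  have subs: "a ` A \<subseteq> A'" "b ` A \<subseteq> A'" by (auto simp: A'_def)
  have AU: "x \<in> universe X" if "x \<in> A" for x using A(2) that by blast
  have b\<xi>: "\<pi> b \<xi> \<in> fixed A'" and pb: "p (j + 1) (\<pi> b \<xi>) = \<pi> b (p j \<xi>)" for j
    using translate[OF ab(2) subs(2), of "j + 1" j] c(1) AU by auto
  have a\<xi>: "\<pi> a \<xi> \<in> fixed A'" and pa: "p (3 * k) (\<pi> a \<xi>) = \<pi> a (p (3 * k + 1) \<xi>)"
    "p (3 * k + 1) (\<pi> a \<xi>) = \<pi> a (p (3 * k + 3) \<xi>)" for k
    using translate[OF ab(1) subs(1), of "3 * k" "3 * k + 1"]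
      translate[OF ab(1) subs(1), of "3 * k + 1" "3 * k + 3"] c(2,3) AU by auto
  have \<rho>b: "\<rho> (r + 1) (\<pi> b \<xi>) = \<rho> r \<xi>" for r
  proof -
    have "hnorm H (d (j + 1) (\<pi> b \<xi>)) = hnorm H (d j \<xi>)" for j
    proof -
      have "d (j + 1) (\<pi> b \<xi>) = \<pi> b (d j \<xi>)"
        using pb[of j] pb[of "j + 1"] pH[OF \<xi>A'] ab(2) by (simp add: d_def rep_minus)
      then show ?thesis using ab(2) dH[OF \<xi>A'] by (simp add: rep_hnorm)
    qed
    then show ?thesis unfolding \<rho>_def by (simp add: t_def flip: add.assoc)
  qed
  have \<rho>a: "(\<rho> 0 (\<pi> a \<xi>))\<^sup>2 = (\<rho> 1 \<xi>)\<^sup>2 + (\<rho> 2 \<xi>)\<^sup>2"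
  proof -
    define n where "n j = rip (p j \<xi>) (p j \<xi>)" for j
    have dn: "rip (d j \<xi>) (d j \<xi>) = n j - n (j + 1)" for j using dd[OF \<xi>A'] by (simp add: n_def)
    have da: "rip (d (3 * k) (\<pi> a \<xi>)) (d (3 * k) (\<pi> a \<xi>)) = n (3 * k + 1) - n (3 * k + 3)" for k
      unfolding dd[OF a\<xi>] pa n_def using ab(1) pH[OF \<xi>A'] by (simp add: rep_rip)
    have "rip (d (t 0 i) (\<pi> a \<xi>)) (d (t 0 i) (\<pi> a \<xi>)) =
        rip (d (t 1 i) \<xi>) (d (t 1 i) \<xi>) + rip (d (t 2 i) \<xi>) (d (t 2 i) \<xi>)" for i
      using da[of "int i - int N"] unfolding dn by (simp add: t_def add.assoc)
    then show ?thesis unfolding \<rho>2[OF \<xi>A'] \<rho>2[OF a\<xi>] by (simp add: sum.distrib)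
  qed
  define h where "h = hnorm H \<xi>"
  have h0: "0 \<le> h" using \<xi>H by (simp add: h_def hnorm_nonneg)
  have sym: "hnorm H (\<xi> \<ominus> \<zeta>) = hnorm H (\<zeta> \<ominus> \<xi>)" if "\<zeta> \<in> carrier H" for \<zeta>
    using metric.commute[of \<xi> \<zeta>] that \<xi>H by (simp add: hdist_eq)
  have step: "\<bar>\<rho> (r + 1) \<xi> - \<rho> r \<xi>\<bar> \<le> h / 20" if r: "r \<in> {0, 1}" for r
  proof -
    have r': "r + 1 \<in> {0, 1, 2}" using r by auto
    have "\<rho> (r + 1) \<xi> \<le> \<rho> r \<xi> + h / 20" "\<rho> r \<xi> \<le> \<rho> (r + 1) \<xi> + h / 20"
      using lip[OF r' \<xi>A' b\<xi>] lip[OF r' b\<xi> \<xi>A'] \<rho>b[of r] small(2) sym[of "\<pi> b \<xi>"] ab(2) \<xi>H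
      by (simp_all add: h_def)
    then show ?thesis by linarith
  qed
  have s1: "\<bar>\<rho> 1 \<xi> - \<rho> 0 \<xi>\<bar> \<le> h / 20" using step[of 0] by simp
  have s2: "\<bar>\<rho> 2 \<xi> - \<rho> 1 \<xi>\<bar> \<le> h / 20" using step[of 1] by simp
  have s0: "\<rho> 0 (\<pi> a \<xi>) \<le> \<rho> 0 \<xi> + h / 20"
    using lip[OF _ a\<xi> \<xi>A', of 0] small(1) by (simp add: h_def)
  have "h = 0"
  proof (rule ccontr)
    assume "h \<noteq> 0"
    then have h: "0 < h" using h0 by simp
    \<comment> \<open>After normalization the three seminorms differ by at most \<open>1 / 20\<close> from their neighbours,
      and \<open>y\<^sup>2 + z\<^sup>2 \<le> (x + 1 / 20)\<^sup>2\<close>. Then \<open>x\<close> is at least \<open>0.68\<close>, which makes the three squares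
      add up to more than \<open>1\<close>.\<close>
    define x y z where "x = \<rho> 0 \<xi> / h" and "y = \<rho> 1 \<xi> / h" and "z = \<rho> 2 \<xi> / h"
    have nn: "0 \<le> x" "0 \<le> y" "0 \<le> z" using h \<rho>_nonneg by (simp_all add: x_def y_def z_def)
    have sq: "x\<^sup>2 + y\<^sup>2 + z\<^sup>2 = 1"
      using total[OF \<xi>A'] h by (simp add: x_def y_def z_def power_divide h_def field_simps)
    have yx: "\<bar>y - x\<bar> \<le> 1 / 20" using s1 h
      by (simp add: x_def y_def diff_divide_distrib[symmetric] abs_divide divide_le_eq)
    have zy: "\<bar>z - y\<bar> \<le> 1 / 20" using s2 h
      by (simp add: z_def y_def diff_divide_distrib[symmetric] abs_divide divide_le_eq)
    have "(\<rho> 1 \<xi>)\<^sup>2 + (\<rho> 2 \<xi>)\<^sup>2 \<le> (\<rho> 0 \<xi> + h / 20)\<^sup>2"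
      unfolding \<rho>a[symmetric] using s0 \<rho>_nonneg by (rule power_mono)
    then have "((\<rho> 1 \<xi>)\<^sup>2 + (\<rho> 2 \<xi>)\<^sup>2) / h\<^sup>2 \<le> (\<rho> 0 \<xi> + h / 20)\<^sup>2 / h\<^sup>2"
      by (rule divide_right_mono) simp
    then have le: "y\<^sup>2 + z\<^sup>2 \<le> (x + 1 / 20)\<^sup>2"
      using h by (simp add: x_def y_def z_def power_divide[symmetric] add_divide_distrib)
    have x2: "68 / 100 \<le> x"
    proof (rule ccontr)
      assume *: "\<not> 68 / 100 \<le> x"
      then have "x\<^sup>2 \<le> (68 / 100)\<^sup>2" "(x + 1 / 20)\<^sup>2 \<le> (73 / 100)\<^sup>2"
        using nn by (auto intro!: power_mono)
      then show False using sq le by (simp add: power2_eq_square)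
    qed
    then have "63 / 100 \<le> y" "58 / 100 \<le> z" using yx zy by linarith+
    then have "(68 / 100)\<^sup>2 \<le> x\<^sup>2" "(63 / 100)\<^sup>2 \<le> y\<^sup>2" "(58 / 100)\<^sup>2 \<le> z\<^sup>2"
      using x2 by (auto intro!: power_mono)
    then show False using sq by (simp add: power2_eq_square)
  qed
  then show ?thesis using \<xi>H hnorm_eq_0 by (simp add: h_def)
qed

end

theorem theorem6p6:
  fixes S :: "'r signature" and X :: "('r, 'a) rel_structure"
  assumes "countable (symbols S)" and "countable (universe X)"
    and "relational_structure S X"
    and "omega_categorical S X"
    and "homogeneous S X"
    and "no_algebraicity S X"
    and "weak_elimination_of_imaginaries S X"
  shows "property_T (aut_group S X) (aut_topology S X)"
proof -
  interpret weakly_eliminates_imaginaries S X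
    using assms by unfold_locales
  obtain c a b where ab: "a \<in> Aut S X" "b \<in> Aut S X"
    and c: "\<forall>x\<in>universe X. (c (b x) :: int) = c x + 1 \<and>
      (\<forall>k. (3 * k \<le> c (a x) \<longleftrightarrow> 3 * k + 1 \<le> c x) \<and> (3 * k + 1 \<le> c (a x) \<longleftrightarrow> 3 * k + 3 \<le> c x))"
    using paradoxical_automorphisms by blast
  have "compactin (aut_topology S X) {a, b}"
    using ab by (intro finite_imp_compactin) (auto simp: topspace_aut_topology)
  moreover have "kazhdan_pair TYPE(('a \<Rightarrow> 'a) hilbert_universe) (aut_group S X) (aut_topology S X) {a, b} (1 / 100)"
    unfolding kazhdan_pair_def
  proof (intro allI impI; elim conjE exE)
    fix H :: "('a \<Rightarrow> 'a) hilbert_universe hilbert_space" and \<pi> \<xi>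
    assume rep: "unitary_representation (aut_group S X) (aut_topology S X) H \<pi>"
      and inv: "almost_invariant H \<pi> {a, b} (1 / 100) \<xi>"
    interpret H: complex_hilbert_space H
      using unitary_representationD(1)[OF rep group_aut_group] .
    interpret aut_rep S X H \<pi>
      using rep by unfold_locales
    show "has_invariant_vector (aut_group S X) H \<pi>"
    proof (rule ccontr)
      assume no: "\<not> has_invariant_vector (aut_group S X) H \<pi>"
      have no_inv: "\<eta> = \<zero>\<^bsub>H\<^esub>" if "\<eta> \<in> fixed {}" for \<eta>
        using no that by (auto simp: has_invariant_vector_def fixed_def fixer_def)
      define h where "h = hnorm H \<xi>"
      have \<xi>: "\<xi> \<in> carrier H" "\<xi> \<noteq> \<zero>\<^bsub>H\<^esub>"
        and small: "hnorm H (\<pi> a \<xi> \<ominus>\<^bsub>H\<^esub> \<xi>) \<le> h / 100" "hnorm H (\<pi> b \<xi> \<ominus>\<^bsub>H\<^esub> \<xi>) \<le> h / 100"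
        using inv by (auto simp: almost_invariant_def h_def)
      have h: "0 < h" using \<xi> H.hnorm_nonneg[OF \<xi>(1)] H.hnorm_eq_0[OF \<xi>(1)] by (simp add: h_def)
      then obtain A \<zeta> where A: "finite A" "A \<subseteq> universe X" and \<zeta>: "\<zeta> \<in> fixed A"
        and near: "hnorm H (\<xi> \<ominus>\<^bsub>H\<^esub> \<zeta>) \<le> h / 100"
        using fixed_dense[OF \<xi>(1), of "h / 100"] by auto
      have \<zeta>H: "\<zeta> \<in> carrier H" using \<zeta> by (rule fixed_carrier)
      have near': "hdist H \<xi> \<zeta> \<le> h / 100" using near \<xi>(1) \<zeta>H by (simp add: hdist_def)
      have \<zeta>h: "h \<le> h / 100 + hnorm H \<zeta>"
        using H.hnorm_triangle[of "\<xi> \<ominus>\<^bsub>H\<^esub> \<zeta>" \<zeta>] H.ominus_oplus_cancel[OF \<xi>(1) \<zeta>H] near \<xi>(1) \<zeta>H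
        by (simp add: h_def)
      \<comment> \<open>The margin between \<open>1 / 100\<close> and the \<open>1 / 20\<close> of the preceding theorem pays for replacing an
        almost invariant vector by a nearby one in some \<open>fixed A\<close>.\<close>
      have move: "hnorm H (\<pi> g \<zeta> \<ominus>\<^bsub>H\<^esub> \<zeta>) \<le> hnorm H \<zeta> / 20"
        if g: "g \<in> Aut S X" and s: "hnorm H (\<pi> g \<xi> \<ominus>\<^bsub>H\<^esub> \<xi>) \<le> h / 100" for g
      proof -
        have H: "\<pi> g \<zeta> \<in> carrier H" "\<pi> g \<xi> \<in> carrier H" using g \<xi>(1) \<zeta>H by auto
        have "hdist H (\<pi> g \<zeta>) \<zeta> \<le> hdist H (\<pi> g \<zeta>) (\<pi> g \<xi>) + hdist H (\<pi> g \<xi>) \<zeta>"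
          using H \<zeta>H by (intro H.metric.triangle)
        also have "hdist H (\<pi> g \<xi>) \<zeta> \<le> hdist H (\<pi> g \<xi>) \<xi> + hdist H \<xi> \<zeta>"
          using H \<zeta>H \<xi>(1) by (intro H.metric.triangle)
        also have "hdist H (\<pi> g \<zeta>) (\<pi> g \<xi>) = hdist H \<xi> \<zeta>"
          using rep_hnorm[OF g, of "\<zeta> \<ominus>\<^bsub>H\<^esub> \<xi>"] \<xi>(1) \<zeta>H H rep_minus[OF g \<zeta>H \<xi>(1)]
            H.metric.commute[of \<xi> \<zeta>]
          by (simp add: hdist_def)
        finally have "hdist H (\<pi> g \<zeta>) \<zeta> \<le> 3 * (h / 100)"
          using near' s H \<xi>(1) by (simp add: hdist_def)
        then show ?thesis using \<zeta>h h H \<zeta>H by (simp add: hdist_def)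
      qed
      have "\<zeta> = \<zero>\<^bsub>H\<^esub>"
      proof (rule no_almost_invariant_fixed[of c b a, OF _ _ _ ab no_inv A \<zeta>])
        show "hnorm H (\<pi> a \<zeta> \<ominus>\<^bsub>H\<^esub> \<zeta>) \<le> hnorm H \<zeta> / 20" using move ab small by blast
        show "hnorm H (\<pi> b \<zeta> \<ominus>\<^bsub>H\<^esub> \<zeta>) \<le> hnorm H \<zeta> / 20" using move ab small by blast
      qed (use c in auto)
      then show False using \<zeta>h h H.hnorm_eq_0[of \<zeta>] \<zeta>H by simp
    qed
  qed
  ultimately show ?thesis
    unfolding property_T_def by (intro exI[of _ "{a, b}"] exI[of _ "1 / 100"]) simp
qed

end
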